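(* Let $F$ be a number field and let $K/F$ and $L/F$ be finite extensions (inside a fixed algebraic closure of $F$) with $[K:F]\le 5$ and $[L:F]\le 5$. If $K$ and $L$ are locally GCD equivalent over $F$, then $K$ and $L$ are $F$-isomorphic.
   Context: For a finite extension $M/F$ of number fields and a prime ideal $\mathfrak{p}\subset\mathcal{O}_F$ unramified in $M$, write $\mathfrak{p}\mathcal{O}_M=\mathfrak{q}_1\cdots\mathfrak{q}_t$ and let $f_{i,M}(\mathfrak{p})$ be the inertia degree of $\mathfrak{q}_i$ over $\mathfrak{p}$; the splitting type of $\mathfrak{p}$ in $M$ is the tuple $f_M(\mathfrak{p})=(f_{1,M}(\mathfrak{p}),\ldots,f_{t,M}(\mathfrak{p}))$ (sorted increasingly). Two finite extensions $K/F$, $L/F$ are locally GCD equivalent over $F$ if for every prime $\mathfrak{p}\subset\mathcal{O}_F$ unramified in both $K$ and $L$ one has $\gcd(f_{1,K}(\mathfrak{p}),\ldots,f_{t,K}(\mathfrak{p}))=\gcd(f_{1,L}(\mathfrak{p}),\ldots,f_{t',L}(\mathfrak{p}))$. *)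

theory Defs
  imports "HOL-Algebra.Algebra"
begin

text \<open>Everything lives inside one ambient field R of characteristic 0
  (playing the role of a fixed algebraic closure); subfields are subsets of carrier R.\<close>

definition char_zero_field :: "('a, 'b) ring_scheme \<Rightarrow> bool" where
  "char_zero_field R \<longleftrightarrow> field R \<and> (\<forall>n::nat. n > 0 \<longrightarrow> [n] \<cdot>\<^bsub>R\<^esub> \<one>\<^bsub>R\<^esub> \<noteq> \<zero>\<^bsub>R\<^esub>)"

definition int_img :: "('a, 'b) ring_scheme \<Rightarrow> 'a set" where
  "int_img R = {x. \<exists>k::int. x = [k] \<cdot>\<^bsub>R\<^esub> \<one>\<^bsub>R\<^esub>}"

definition rat_img :: "('a, 'b) ring_scheme \<Rightarrow> 'a set" where
  "rat_img R = {x \<in> carrier R. \<exists>(a::int) (b::int). b \<noteq> 0 \<and>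
       x \<otimes>\<^bsub>R\<^esub> ([b] \<cdot>\<^bsub>R\<^esub> \<one>\<^bsub>R\<^esub>) = [a] \<cdot>\<^bsub>R\<^esub> \<one>\<^bsub>R\<^esub>}"

definition ext_degree :: "('a, 'b) ring_scheme \<Rightarrow> 'a set \<Rightarrow> 'a set \<Rightarrow> nat" where
  "ext_degree R K E = (THE n. ring.dimension R n K E)"

definition finite_ext :: "('a, 'b) ring_scheme \<Rightarrow> 'a set \<Rightarrow> 'a set \<Rightarrow> bool" where
  "finite_ext R K E \<longleftrightarrow> subfield K R \<and> subfield E R \<and> K \<subseteq> E \<and> (\<exists>n. ring.dimension R n K E)"

definition number_field :: "('a, 'b) ring_scheme \<Rightarrow> 'a set \<Rightarrow> bool" where
  "number_field R F \<longleftrightarrow> finite_ext R (rat_img R) F"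

definition ring_of_integers :: "('a, 'b) ring_scheme \<Rightarrow> 'a set \<Rightarrow> 'a set" where
  "ring_of_integers R K = {x \<in> K. \<exists>p. p \<noteq> [] \<and> hd p = \<one>\<^bsub>R\<^esub> \<and> set p \<subseteq> int_img R
       \<and> ring.eval R p x = \<zero>\<^bsub>R\<^esub>}"

abbreviation OK :: "('a, 'b) ring_scheme \<Rightarrow> 'a set \<Rightarrow> ('a, 'b) ring_scheme" where
  "OK R K \<equiv> R\<lparr>carrier := ring_of_integers R K\<rparr>"

definition nz_prime :: "('a, 'b) ring_scheme \<Rightarrow> 'a set \<Rightarrow> 'a set \<Rightarrow> bool" where
  "nz_prime R F P \<longleftrightarrow> primeideal P (OK R F) \<and> P \<noteq> {\<zero>\<^bsub>R\<^esub>}"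

definition primes_above :: "('a, 'b) ring_scheme \<Rightarrow> 'a set \<Rightarrow> 'a set \<Rightarrow> 'a set \<Rightarrow> 'a set set" where
  "primes_above R F M P = {Q. primeideal Q (OK R M) \<and> Q \<inter> ring_of_integers R F = P}"

definition ext_ideal :: "('a, 'b) ring_scheme \<Rightarrow> 'a set \<Rightarrow> 'a set \<Rightarrow> 'a set" where
  "ext_ideal R M P = genideal (OK R M) P"

text \<open>p unramified in M: every ramification index is 1, i.e. p O_M is not contained in Q^2.\<close>
definition unramified :: "('a, 'b) ring_scheme \<Rightarrow> 'a set \<Rightarrow> 'a set \<Rightarrow> 'a set \<Rightarrow> bool" where
  "unramified R F M P \<longleftrightarrow> (\<forall>Q \<in> primes_above R F M P.
      \<not> ext_ideal R M P \<subseteq> ideal_prod (OK R M) Q Q)"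

text \<open>Inertia degree f(Q|p) = [O_M/Q : O_F/p], where O_F/p is identified with its image in O_M/Q.\<close>
definition inertia_degree :: "('a, 'b) ring_scheme \<Rightarrow> 'a set \<Rightarrow> 'a set \<Rightarrow> 'a set \<Rightarrow> nat" where
  "inertia_degree R F M Q =
     (THE f. ring.dimension (OK R M Quot Q) f
               ((\<lambda>a. Q +>\<^bsub>OK R M\<^esub> a) ` ring_of_integers R F)
               (carrier (OK R M Quot Q)))"

definition split_gcd :: "('a, 'b) ring_scheme \<Rightarrow> 'a set \<Rightarrow> 'a set \<Rightarrow> 'a set \<Rightarrow> nat" where
  "split_gcd R F M P = Gcd (inertia_degree R F M ` primes_above R F M P)"

definition locally_gcd_equivalent :: "('a, 'b) ring_scheme \<Rightarrow> 'a set \<Rightarrow> 'a set \<Rightarrow> 'a set \<Rightarrow> bool" where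
  "locally_gcd_equivalent R F K L \<longleftrightarrow>
     (\<forall>P. nz_prime R F P \<and> unramified R F K P \<and> unramified R F L P \<longrightarrow>
          split_gcd R F K P = split_gcd R F L P)"

definition F_isomorphic :: "('a, 'b) ring_scheme \<Rightarrow> 'a set \<Rightarrow> 'a set \<Rightarrow> 'a set \<Rightarrow> bool" where
  "F_isomorphic R F K L \<longleftrightarrow> (\<exists>\<phi>. \<phi> \<in> ring_iso (R\<lparr>carrier := K\<rparr>) (R\<lparr>carrier := L\<rparr>)
       \<and> (\<forall>x \<in> F. \<phi> x = x))"

end

theory Submission
  imports Defs "HOL-Algebra.Algebraic_Closure_Type" "Jordan_Normal_Form.Char_Poly"
begin

text \<open>
  Embed \<open>K\<close> and \<open>L\<close> over \<open>F\<close> into a normal number field \<open>N \<subseteq> \<complex>\<close>, let \<open>G\<close> be the group of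
  automorphisms of \<open>N\<close> over \<open>F\<close>, and write \<open>K = F(\<alpha>)\<close>, \<open>L = F(\<beta>)\<close>. If the Frobenius at a large
  prime is a power \<open>\<sigma>\<^sup>k\<close> of an element \<open>\<sigma> \<in> G\<close> of \<open>l\<close>-power order with \<open>l\<close> not dividing \<open>k\<close>, then the
  gcd of the splitting type in \<open>K\<close> is 1 if \<open>\<sigma>\<close> fixes a conjugate of \<open>\<alpha>\<close>, and divisible by \<open>l\<close> otherwise.
  Hence every \<open>l\<close>-element has a fixed point on \<open>G\<alpha>\<close> if and only if it has one on \<open>G\<beta>\<close>. For orbits of
  size at most 5 this forces a conjugate of \<open>\<alpha>\<close> to have the same stabilizer as \<open>\<beta>\<close>, and Galois theory
  gives the isomorphism.

  Such a prime exists by a weak form of Chebotarev's theorem with an elementary proof. Otherwise almost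
  all Frobenius elements that lie in \<open>\<langle>\<sigma>\<rangle>\<close>, up to conjugation, lie in \<open>\<langle>\<sigma>\<^sup>l\<rangle>\<close>, so every prime of degree one
  of the fixed field of \<open>\<sigma>\<close> lies below at least two primes of degree one of the fixed field of \<open>\<sigma>\<^sup>l\<close>.
  This contradicts the fact that in either field the sum of \<open>1/n\<close> over the norms \<open>n \<le> x\<close> of squarefree
  products of degree-one primes is of exact order \<open>log x\<close>: the upper bound is a pigeonhole argument on
  integer polynomials in a generator, the lower bound counts integer polynomials in a box whose norm
  has no large square factor.
\<close>

hide_const (open) Divisibility.prime Polynomial.order Ring_Hom.ring_hom

section \<open>Finite group actions\<close>

lemma card_image_le_if_factors:
  assumes "finite S" "\<And>x y. x \<in> S \<Longrightarrow> y \<in> S \<Longrightarrow> g x = g y \<Longrightarrow> f x = f y"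
  shows "card (f ` S) \<le> card (g ` S)"
proof -
  have "f x = f (inv_into S g (g x))" if "x \<in> S" for x
    using that f_inv_into_f[of "g x" g S] by (intro assms(2) inv_into_into) auto
  then have "f ` S \<subseteq> (f \<circ> inv_into S g) ` (g ` S)" by auto
  then have "card (f ` S) \<le> card ((f \<circ> inv_into S g) ` (g ` S))"
    using assms(1) by (intro card_mono) auto
  then show ?thesis
    using card_image_le[of "g ` S"] assms(1) by (meson finite_imageI order_trans)
qed

definition sylow_subgroup :: "nat \<Rightarrow> 'a set \<Rightarrow> ('a, 'b) monoid_scheme \<Rightarrow> bool" where
  "sylow_subgroup p S G \<longleftrightarrow> subgroup S G \<and> card S = p ^ multiplicity p (order G)"

definition prime_power_elements :: "nat \<Rightarrow> ('a, 'b) monoid_scheme \<Rightarrow> 'a set" where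
  "prime_power_elements p G = {g \<in> carrier G. \<exists>n::nat. g [^]\<^bsub>G\<^esub> (p ^ n) = \<one>\<^bsub>G\<^esub>}"

locale finite_group_action = group_action +
  assumes finite_carrier: "finite (carrier G)"

sublocale finite_group_action \<subseteq> group G
  using group_hom by (rule group_hom.axioms(1))

context finite_group_action
begin

lemma order_pos: "order G > 0"
  using order_gt_0_iff_finite finite_carrier by blast

lemma subgroup_action: "subgroup H G \<Longrightarrow> finite_group_action (G\<lparr>carrier := H\<rparr>) E \<phi>"
  using induced_action[of H] finite_subset[OF subgroup.subset finite_carrier]
  by (simp add: finite_group_action_def finite_group_action_axioms_def)

lemma card_subgroup_dvd: "subgroup H G \<Longrightarrow> card H dvd order G"
  by (metis lagrange dvd_triv_right)

lemma finite_orbit: "finite (orbit G \<phi> x)"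
  unfolding orbit_def using finite_carrier by (simp add: setcompr_eq_image)

lemma orbit_subset: "x \<in> E \<Longrightarrow> orbit G \<phi> x \<subseteq> E"
  using element_image by (auto simp: orbit_def)

lemma orbit_image: "g \<in> carrier G \<Longrightarrow> \<phi> g x \<in> orbit G \<phi> x"
  by (auto simp: orbit_def)

lemma orbit_eq:
  assumes "x \<in> E" "y \<in> orbit G \<phi> x" shows "orbit G \<phi> y = orbit G \<phi> x"
proof -
  have "y \<in> E" using orbit_subset assms by blast
  then show ?thesis
    using orbit_trans[of x y] orbit_trans[of y x] orbit_sym[of x y] assms orbit_subset by blast
qed

lemma orbit_closed: "x \<in> E \<Longrightarrow> y \<in> orbit G \<phi> x \<Longrightarrow> g \<in> carrier G \<Longrightarrow> \<phi> g y \<in> orbit G \<phi> x"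
  using orbit_eq orbit_image by blast

lemma card_orbit_pos: "x \<in> E \<Longrightarrow> card (orbit G \<phi> x) > 0"
  using orbit_refl finite_orbit by (auto simp: card_gt_0_iff)

lemma orbit_transitive:
  assumes "x \<in> E" "y \<in> orbit G \<phi> x" "z \<in> orbit G \<phi> x"
  shows "\<exists>g\<in>carrier G. \<phi> g y = z"
proof -
  have "z \<in> orbit G \<phi> y" using orbit_eq[OF assms(1,2)] assms(3) by simp
  then show ?thesis by (auto simp: orbit_def)
qed

lemma orbits_disjoint:
  "x \<in> E \<Longrightarrow> y \<in> E \<Longrightarrow> y \<notin> orbit G \<phi> x \<Longrightarrow> orbit G \<phi> x \<inter> orbit G \<phi> y = {}"
  using orbit_eq orbit_refl by blast

abbreviation suborbit :: "'a set \<Rightarrow> 'c \<Rightarrow> 'c set" where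
  "suborbit H \<equiv> orbit (G\<lparr>carrier := H\<rparr>) \<phi>"

abbreviation substabilizer :: "'a set \<Rightarrow> 'c \<Rightarrow> 'a set" where
  "substabilizer H \<equiv> stabilizer (G\<lparr>carrier := H\<rparr>) \<phi>"

lemma suborbit_subset:
  assumes "subgroup H G" shows "suborbit H x \<subseteq> orbit G \<phi> x"
  using subgroup.subset[OF assms] by (auto simp: orbit_def)

lemma substabilizer_subset:
  assumes "subgroup H G" shows "substabilizer H x \<subseteq> stabilizer G \<phi> x"
  using subgroup.subset[OF assms] by (auto simp: stabilizer_def)

lemma card_stabilizer_eq:
  assumes "x \<in> E" "y \<in> orbit G \<phi> x"
  shows "card (orbit G \<phi> x) * card (stabilizer G \<phi> y) = order G"
  using orbit_stabilizer_theorem[of y] orbit_eq[OF assms] orbit_subset assms by auto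

lemma fixed_if_card_orbit_1:
  assumes "x \<in> E" "card (orbit G \<phi> x) = 1" "g \<in> carrier G" shows "\<phi> g x = x"
  using assms orbit_refl[OF assms(1)] orbit_image[OF assms(3), of x] by (metis card_1_singletonE singletonD)

lemma sum_card_invariants:
  assumes x: "x \<in> E"
  shows "(\<Sum>g\<in>carrier G. card (invariants (orbit G \<phi> x) \<phi> g)) = order G"
proof -
  have "(\<Sum>g\<in>carrier G. card (invariants (orbit G \<phi> x) \<phi> g)) =
      (\<Sum>g\<in>carrier G. \<Sum>y\<in>orbit G \<phi> x. if \<phi> g y = y then 1 else 0)"
    by (rule sum.cong) (auto simp: invariants_def finite_orbit intro!: card_as_sums)
  also have "\<dots> = (\<Sum>y\<in>orbit G \<phi> x. \<Sum>g\<in>carrier G. if \<phi> g y = y then 1 else 0)"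
    by (rule sum.swap)
  also have "\<dots> = (\<Sum>y\<in>orbit G \<phi> x. card (stabilizer G \<phi> y))"
    by (rule sum.cong) (auto simp: stabilizer_def finite_carrier intro!: card_as_sums[symmetric])
  also have "\<dots> = order G"
    by (rule card_stablizer_sum[OF finite_carrier]) (use x in \<open>auto simp: orbits_def\<close>)
  finally show ?thesis .
qed

lemma exists_derangement:
  assumes x: "x \<in> E" and nontrivial: "card (orbit G \<phi> x) > 1"
  shows "\<exists>g\<in>carrier G. \<forall>y\<in>orbit G \<phi> x. \<phi> g y \<noteq> y"
proof (rule ccontr)
  assume "\<not> ?thesis"
  then have fixes_some: "card (invariants (orbit G \<phi> x) \<phi> g) \<ge> 1" if "g \<in> carrier G" for g
    using that finite_orbit by (fastforce simp: invariants_def Suc_le_eq card_gt_0_iff)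
  have "\<phi> \<one> y = y" if "y \<in> orbit G \<phi> x" for y
    using that orbit_subset[OF x] id_eq_one by (metis restrict_apply' subsetD)
  then have "invariants (orbit G \<phi> x) \<phi> \<one> = orbit G \<phi> x" by (auto simp: invariants_def)
  then have "(\<Sum>g\<in>carrier G. 1) < (\<Sum>g\<in>carrier G. card (invariants (orbit G \<phi> x) \<phi> g))"
    using fixes_some nontrivial by (intro sum_strict_mono_ex1 finite_carrier bexI[of _ \<one>]) auto
  then show False using sum_card_invariants[OF x] by (simp add: Coset.order_def)
qed

lemma orbit_card_2_fixes_all:
  assumes "x \<in> E" "card (orbit G \<phi> x) = 2" "g \<in> carrier G"
    and y: "y \<in> orbit G \<phi> x" "\<phi> g y = y" and z: "z \<in> orbit G \<phi> x"
  shows "\<phi> g z = z"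
proof (cases "z = y")
  case False
  then have "orbit G \<phi> x = {y, z}" using assms(2) y(1) z by (auto simp: card_2_iff)
  then have "\<phi> g z = y \<or> \<phi> g z = z" using orbit_closed[OF assms(1) z assms(3)] by simp
  moreover have "y \<in> E" "z \<in> E" using orbit_subset[OF assms(1)] y z by auto
  ultimately show ?thesis using False y(2) inj_prop[OF assms(3)] by (metis inj_onD)
qed (use y in simp)

lemma exists_derangement_two_orbits:
  assumes x: "x \<in> E" "card (orbit G \<phi> x) = 2" and y: "y \<in> E" "card (orbit G \<phi> y) = 2"
  shows "\<exists>g\<in>carrier G. \<forall>z\<in>orbit G \<phi> x \<union> orbit G \<phi> y. \<phi> g z \<noteq> z"
proof (rule ccontr)
  assume neg: "\<not> ?thesis"
  obtain t where t: "t \<in> carrier G" "\<forall>z\<in>orbit G \<phi> x. \<phi> t z \<noteq> z"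
    using exists_derangement[OF x(1)] x(2) by auto
  obtain u where u: "u \<in> carrier G" "\<forall>z\<in>orbit G \<phi> y. \<phi> u z \<noteq> z"
    using exists_derangement[OF y(1)] y(2) by auto
  have t_fixes: "\<phi> t z = z" if "z \<in> orbit G \<phi> y" for z
    using neg t orbit_card_2_fixes_all[OF y t(1) _ _ that] by (meson UnE)
  have u_fixes: "\<phi> u z = z" if "z \<in> orbit G \<phi> x" for z
    using neg u orbit_card_2_fixes_all[OF x u(1) _ _ that] by (meson UnE)
  have "\<phi> (t \<otimes> u) z \<noteq> z" if "z \<in> orbit G \<phi> x \<union> orbit G \<phi> y" for z
  proof -
    have "z \<in> E" using that orbit_subset x y by blast
    then have "\<phi> (t \<otimes> u) z = \<phi> t (\<phi> u z)" using composition_rule t u by simp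
    then show ?thesis using that t u t_fixes u_fixes orbit_closed[OF y(1) _ u(1)] by fastforce
  qed
  then show False using neg t u by blast
qed

lemma prime_dvd_card_orbit:
  assumes "prime l" "order G = l ^ b" "x \<in> E" "card (orbit G \<phi> x) \<noteq> 1"
  shows "l dvd card (orbit G \<phi> x)"
proof -
  have "card (orbit G \<phi> x) dvd l ^ b" using orbit_stabilizer_theorem[OF assms(3)] assms(2) by (metis dvd_triv_left)
  then obtain i where i: "card (orbit G \<phi> x) = l ^ i" using divides_primepow_nat[OF assms(1)] by blast
  moreover have "i \<noteq> 0" using assms(4) i by (intro notI) simp
  ultimately show ?thesis by simp
qed

lemma exists_common_fixed_point:
  assumes l: "prime l" "order G = l ^ b"
    and Z: "finite Z" "Z \<noteq> {}" "Z \<subseteq> E" "\<And>g z. g \<in> carrier G \<Longrightarrow> z \<in> Z \<Longrightarrow> \<phi> g z \<in> Z"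
    and card_Z: "card Z = l \<or> l = 2 \<and> card Z = 4"
    and elementwise: "\<And>g. g \<in> carrier G \<Longrightarrow> \<exists>z\<in>Z. \<phi> g z = z"
  shows "\<exists>z\<in>Z. \<forall>g\<in>carrier G. \<phi> g z = z"
proof (rule ccontr)
  assume neg: "\<not> ?thesis"
  have sub: "orbit G \<phi> z \<subseteq> Z" if "z \<in> Z" for z using Z(4) that by (auto simp: orbit_def)
  have dvd: "l dvd card (orbit G \<phi> z)" if "z \<in> Z" for z
    using prime_dvd_card_orbit[OF l] fixed_if_card_orbit_1 that Z(3) neg by (meson subsetD)
  have proper: "card (orbit G \<phi> z) < card Z" if z: "z \<in> Z" for z
  proof -
    have z_mem: "z \<in> E" using z Z(3) by blast
    have "card (orbit G \<phi> z) \<noteq> 1" using dvd[OF z] l(1) by auto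
    then have "card (orbit G \<phi> z) > 1" using card_orbit_pos[OF z_mem] by linarith
    then have "orbit G \<phi> z \<noteq> Z" using exists_derangement[OF z_mem] elementwise by blast
    then show ?thesis using sub[OF z] Z(1) by (meson psubsetI psubset_card_mono)
  qed
  obtain x where x: "x \<in> Z" using Z(2) by blast
  have "card Z \<noteq> l"
    using dvd_imp_le[OF dvd[OF x]] card_orbit_pos[of x] proper[OF x] x Z(3) by auto
  then have l2: "l = 2" "card Z = 4" using card_Z by auto
  have card2: "card (orbit G \<phi> z) = 2" if "z \<in> Z" for z
  proof -
    have "card (orbit G \<phi> z) > 0" using that Z(3) by (intro card_orbit_pos) blast
    then show ?thesis using dvd[OF that] proper[OF that] unfolding l2 by (auto elim!: evenE)
  qed
  obtain y where y: "y \<in> Z" "y \<notin> orbit G \<phi> x"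
    using proper[OF x] by (metis card_mono finite_orbit not_le subsetI)
  have E: "x \<in> E" "y \<in> E" using x y Z(3) by auto
  have "card (orbit G \<phi> x \<union> orbit G \<phi> y) = card Z"
    using orbits_disjoint[OF E y(2)] card2[OF x] card2[OF y(1)] l2 by (simp add: card_Un_disjoint finite_orbit)
  then have "orbit G \<phi> x \<union> orbit G \<phi> y = Z"
    using card_subset_eq[OF Z(1)] sub[OF x] sub[OF y(1)] by simp
  then show False
    using exists_derangement_two_orbits[OF E(1) card2[OF x] E(2) card2[OF y(1)]] elementwise by blast
qed

lemma exists_sylow_subgroup:
  assumes p: "prime p" shows "\<exists>S. sylow_subgroup p S G"
proof -
  obtain m where "order G = p ^ multiplicity p (order G) * m"
    using multiplicity_dvd[of p "order G"] by (elim dvdE)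
  then show ?thesis
    unfolding sylow_subgroup_def using sylow_thm[OF p is_group _ finite_carrier] by blast
qed

lemma dvd_card_sylow_subgroup:
  assumes "prime p" "sylow_subgroup p S G" "p ^ j dvd order G" shows "p ^ j dvd card S"
proof -
  have "j \<le> multiplicity p (order G)"
    using assms(1,3) order_pos by (subst power_dvd_iff_le_multiplicity[symmetric]) auto
  then show ?thesis using assms(2) by (simp add: sylow_subgroup_def le_imp_power_dvd)
qed

lemma sylow_subgroup_subset_prime_power_elements:
  assumes "prime p" "sylow_subgroup p S G" shows "S \<subseteq> prime_power_elements p G"
proof
  fix g assume g: "g \<in> S"
  have S: "subgroup S G" "card S = p ^ multiplicity p (order G)" using assms by (auto simp: sylow_subgroup_def)
  interpret S: finite_group_action "G\<lparr>carrier := S\<rparr>" E \<phi> by (rule subgroup_action[OF S(1)])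
  have "g [^] card S = \<one>"
    using S.pow_order_eq_1[of g] g by (simp add: Coset.order_def nat_pow_def)
  then show "g \<in> prime_power_elements p G"
    using g subgroup.subset[OF S(1)] S(2) by (auto simp: prime_power_elements_def)
qed

lemma card_orbit_mult_card_sylow_stabilizer_dvd:
  assumes p: "prime p" "sylow_subgroup p S G" and x: "x \<in> E" "card (orbit G \<phi> x) = p ^ k"
  shows "p ^ k * card (substabilizer S x) dvd card S"
proof -
  have S: "subgroup S G" "card S = p ^ multiplicity p (order G)" using p by (auto simp: sylow_subgroup_def)
  interpret S: finite_group_action "G\<lparr>carrier := S\<rparr>" E \<phi> by (rule subgroup_action[OF S(1)])
  let ?T = "substabilizer S x"
  have T: "subgroup ?T (G\<lparr>carrier := S\<rparr>)" by (rule S.stabilizer_subgroup[OF x(1)])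
  have "card ?T dvd card S" using S.card_subgroup_dvd[OF T] by (simp add: Coset.order_def)
  then obtain i where i: "card ?T = p ^ i" using S(2) divides_primepow_nat[OF p(1)] by auto
  have G_x: "subgroup (stabilizer G \<phi> x) G" by (rule stabilizer_subgroup[OF x(1)])
  then interpret G_x: finite_group_action "G\<lparr>carrier := stabilizer G \<phi> x\<rparr>" E \<phi> by (rule subgroup_action)
  have "subgroup ?T (G\<lparr>carrier := stabilizer G \<phi> x\<rparr>)"
    using subgroup_incl[OF incl_subgroup[OF S(1) T] G_x] substabilizer_subset[OF S(1)] by blast
  then have "card ?T dvd card (stabilizer G \<phi> x)"
    using G_x.card_subgroup_dvd by (simp add: Coset.order_def)
  then have "p ^ k * card ?T dvd order G"
    using orbit_stabilizer_theorem[OF x(1)] x(2) by (metis mult_dvd_mono dvd_refl)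
  then show ?thesis
    using dvd_card_sylow_subgroup[OF p, of "k + i"] i by (simp add: power_add)
qed

lemma sylow_orbit_eq:
  assumes p: "prime p" "sylow_subgroup p S G" and x: "x \<in> E" "card (orbit G \<phi> x) = p"
  shows "suborbit S x = orbit G \<phi> x"
proof -
  have S: "subgroup S G" using p by (auto simp: sylow_subgroup_def)
  interpret S: finite_group_action "G\<lparr>carrier := S\<rparr>" E \<phi> by (rule subgroup_action[OF S])
  let ?T = "substabilizer S x" and ?O = "suborbit S x"
  have orbit_stab: "card ?O * card ?T = card S"
    using S.orbit_stabilizer_theorem[OF x(1)] by (simp add: Coset.order_def)
  then have "p * card ?T dvd card ?O * card ?T"
    using card_orbit_mult_card_sylow_stabilizer_dvd[OF p x(1), of 1] x(2) by simp
  moreover have "card ?T > 0" using orbit_stab S.order_pos by (auto simp: Coset.order_def intro: ccontr)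
  ultimately have "p dvd card ?O" by simp
  then have "p \<le> card ?O" using S.card_orbit_pos[OF x(1)] dvd_imp_le by blast
  then show ?thesis
    using card_seteq[OF finite_orbit suborbit_subset[OF S]] x(2) by simp
qed

lemma exists_sylow_stabilizer_subset:
  assumes l: "prime l" "sylow_subgroup l S G" and x: "x \<in> E" and y: "y \<in> E"
    and card_orbit: "card (orbit G \<phi> x) = l \<or> l = 2 \<and> card (orbit G \<phi> x) = 4"
    and fixes_point: "\<And>g. g \<in> prime_power_elements l G \<Longrightarrow> \<phi> g y = y \<Longrightarrow> \<exists>z\<in>orbit G \<phi> x. \<phi> g z = z"
  shows "\<exists>z\<in>orbit G \<phi> x. substabilizer S y \<subseteq> substabilizer S z"
proof -
  have S: "subgroup S G" "card S = l ^ multiplicity l (order G)" using l by (auto simp: sylow_subgroup_def)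
  interpret S: finite_group_action "G\<lparr>carrier := S\<rparr>" E \<phi> by (rule subgroup_action[OF S(1)])
  let ?T = "substabilizer S y"
  have T: "subgroup ?T (G\<lparr>carrier := S\<rparr>)" by (rule S.stabilizer_subgroup[OF y])
  interpret T: finite_group_action "G\<lparr>carrier := ?T\<rparr>" E \<phi>
    by (rule subgroup_action[OF incl_subgroup[OF S(1) T]])
  have "card ?T dvd card S" using S.card_subgroup_dvd[OF T] by (simp add: Coset.order_def)
  then obtain b where b: "card ?T = l ^ b" using S(2) divides_primepow_nat[OF l(1)] by auto
  have TS: "?T \<subseteq> S" "?T \<subseteq> stabilizer G \<phi> y" "?T \<subseteq> carrier G"
    using subgroup.subset[OF S(1)] by (auto simp: stabilizer_def)
  have "\<exists>z\<in>orbit G \<phi> x. \<forall>g\<in>carrier (G\<lparr>carrier := ?T\<rparr>). \<phi> g z = z"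
  proof (rule T.exists_common_fixed_point[OF l(1) _ finite_orbit _ orbit_subset[OF x] _ card_orbit])
    show "order (G\<lparr>carrier := ?T\<rparr>) = l ^ b" using b by (simp add: Coset.order_def)
    show "orbit G \<phi> x \<noteq> {}" using orbit_refl[OF x] by blast
    show "\<phi> g z \<in> orbit G \<phi> x" if "g \<in> carrier (G\<lparr>carrier := ?T\<rparr>)" "z \<in> orbit G \<phi> x" for g z
      using that TS orbit_closed[OF x] by auto
    show "\<exists>z\<in>orbit G \<phi> x. \<phi> g z = z" if "g \<in> carrier (G\<lparr>carrier := ?T\<rparr>)" for g
      using that fixes_point[of g] sylow_subgroup_subset_prime_power_elements[OF l] TS by (auto simp: stabilizer_def)
  qed
  then obtain z where "z \<in> orbit G \<phi> x" "\<And>g. g \<in> ?T \<Longrightarrow> \<phi> g z = z" by auto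
  then show ?thesis using TS(1) by (intro bexI[of _ z]) (auto simp: stabilizer_def)
qed

lemma card_orbit_le_sylow_orbit:
  assumes l: "prime l" "sylow_subgroup l S G" and x: "x \<in> E" "card (orbit G \<phi> x) = l ^ k" and y: "y \<in> E"
    and z: "z \<in> orbit G \<phi> x" "substabilizer S y \<subseteq> substabilizer S z"
  shows "card (orbit G \<phi> x) \<le> card (suborbit S y)"
proof -
  let ?S_y = "substabilizer S y" and ?S_z = "substabilizer S z"
  have S: "subgroup S G" using l by (auto simp: sylow_subgroup_def)
  interpret S: finite_group_action "G\<lparr>carrier := S\<rparr>" E \<phi> by (rule subgroup_action[OF S])
  have z_mem: "z \<in> E" using z(1) orbit_subset[OF x(1)] by blast
  have orbit_stab: "card (suborbit S y) * card ?S_y = card S"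
    using S.orbit_stabilizer_theorem[OF y] by (simp add: Coset.order_def)
  have "finite ?S_z" using S.finite_carrier by (simp add: stabilizer_def)
  then have "l ^ k * card ?S_y \<le> l ^ k * card ?S_z" using z(2) by (intro mult_left_mono card_mono) auto
  also have "\<dots> \<le> card S"
    using card_orbit_mult_card_sylow_stabilizer_dvd[OF l z_mem, of k] orbit_eq[OF x(1) z(1)] x(2) S.order_pos
    by (intro dvd_imp_le) (auto simp: Coset.order_def)
  finally have "l ^ k * card ?S_y \<le> card (suborbit S y) * card ?S_y" using orbit_stab by simp
  moreover have "card ?S_y > 0" using orbit_stab S.order_pos by (auto simp: Coset.order_def intro: ccontr)
  ultimately show ?thesis using x(2) by simp
qed

lemma not_dvd_card_suborbit_stabilizer:
  assumes l: "prime l" "sylow_subgroup l S G" and y: "y \<in> E" and z: "z \<in> E"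
    and subset: "substabilizer S y \<subseteq> substabilizer S z"
    and transitive: "card (suborbit S y) = card (orbit G \<phi> y)"
  shows "\<not> l dvd card (suborbit (stabilizer G \<phi> y) z)"
proof
  let ?G_yz = "substabilizer (stabilizer G \<phi> y) z"
  assume "l dvd card (suborbit (stabilizer G \<phi> y) z)"
  moreover have S: "subgroup S G" "card S = l ^ multiplicity l (order G)" using l by (auto simp: sylow_subgroup_def)
  interpret S: finite_group_action "G\<lparr>carrier := S\<rparr>" E \<phi> by (rule subgroup_action[OF S(1)])
  have G_y: "subgroup (stabilizer G \<phi> y) G" by (rule stabilizer_subgroup[OF y])
  then interpret G_y: finite_group_action "G\<lparr>carrier := stabilizer G \<phi> y\<rparr>" E \<phi> by (rule subgroup_action)
  have "card (substabilizer S y) dvd card ?G_yz"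
  proof -
    have G_yz: "subgroup ?G_yz G" by (rule incl_subgroup[OF G_y G_y.stabilizer_subgroup[OF z]])
    interpret G_yz: finite_group_action "G\<lparr>carrier := ?G_yz\<rparr>" E \<phi> by (rule subgroup_action[OF G_yz])
    have "substabilizer S y \<subseteq> ?G_yz" using subset subgroup.subset[OF S(1)] by (auto simp: stabilizer_def)
    then show ?thesis
      using G_yz.card_subgroup_dvd subgroup_incl[OF incl_subgroup[OF S(1) S.stabilizer_subgroup[OF y]] G_yz]
      by (simp add: Coset.order_def)
  qed
  moreover have "card (suborbit (stabilizer G \<phi> y) z) * card ?G_yz = card (stabilizer G \<phi> y)"
    using G_y.orbit_stabilizer_theorem[OF z] by (simp add: Coset.order_def)
  ultimately have "l * card (substabilizer S y) dvd card (stabilizer G \<phi> y)" by (metis mult_dvd_mono)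
  then have "card (orbit G \<phi> y) * (l * card (substabilizer S y)) dvd order G"
    unfolding orbit_stabilizer_theorem[OF y, symmetric] by (intro mult_dvd_mono) auto
  moreover have "card (orbit G \<phi> y) * card (substabilizer S y) = l ^ multiplicity l (order G)"
    using S.orbit_stabilizer_theorem[OF y] S(2) transitive by (simp add: Coset.order_def)
  ultimately have "l ^ Suc (multiplicity l (order G)) dvd order G" by (simp add: mult_ac)
  then show False using dvd_card_sylow_subgroup[OF l] S(2) prime_gt_1_nat[OF l(1)]
    by (metis dvd_imp_le lessI not_less power_strict_increasing prime_gt_0_nat[OF l(1)] zero_less_power)
qed

lemma card_orbit_le_if_fixes_point:
  assumes l: "prime l" and x: "x \<in> E" and y: "y \<in> E"
    and card_orbit: "card (orbit G \<phi> x) = l \<or> l = 2 \<and> card (orbit G \<phi> x) = 4"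
    and fixes_point: "\<And>g. g \<in> prime_power_elements l G \<Longrightarrow> \<phi> g y = y \<Longrightarrow> \<exists>z\<in>orbit G \<phi> x. \<phi> g z = z"
  shows "card (orbit G \<phi> x) \<le> card (orbit G \<phi> y)"
    and "card (orbit G \<phi> x) = card (orbit G \<phi> y) \<Longrightarrow>
      \<exists>z\<in>orbit G \<phi> x. \<not> l dvd card (suborbit (stabilizer G \<phi> y) z)"
proof -
  obtain S where sylow: "sylow_subgroup l S G" using exists_sylow_subgroup[OF l] by blast
  then have S: "subgroup S G" by (simp add: sylow_subgroup_def)
  have "card (orbit G \<phi> x) = l ^ 1 \<or> card (orbit G \<phi> x) = l ^ 2" using card_orbit by auto
  then obtain k where k: "card (orbit G \<phi> x) = l ^ k" by blast
  obtain z where z: "z \<in> orbit G \<phi> x" "substabilizer S y \<subseteq> substabilizer S z"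
    using exists_sylow_stabilizer_subset[OF l sylow x y card_orbit] fixes_point by blast
  have le: "card (orbit G \<phi> x) \<le> card (suborbit S y)" "card (suborbit S y) \<le> card (orbit G \<phi> y)"
    using card_orbit_le_sylow_orbit[OF l sylow x k y z] card_mono[OF finite_orbit suborbit_subset[OF S]] by auto
  then show "card (orbit G \<phi> x) \<le> card (orbit G \<phi> y)" by (rule order_trans)
  assume "card (orbit G \<phi> x) = card (orbit G \<phi> y)"
  then have "card (suborbit S y) = card (orbit G \<phi> y)" using le by simp
  then show "\<exists>z\<in>orbit G \<phi> x. \<not> l dvd card (suborbit (stabilizer G \<phi> y) z)"
    using not_dvd_card_suborbit_stabilizer[OF l sylow y _ z(2)] z(1) orbit_subset[OF x] by blast
qed

subsection \<open>Translates of a subset\<close>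

definition translates :: "'c set \<Rightarrow> 'c set set" where
  "translates A = (\<lambda>g. \<phi> g ` A) ` carrier G"

lemma finite_translates: "finite (translates A)"
  unfolding translates_def using finite_carrier by simp

lemma translates_self: "A \<subseteq> E \<Longrightarrow> A \<in> translates A"
  unfolding translates_def using id_eq_one by (intro image_eqI[of _ _ \<one>]) (force simp flip: id_eq_one)+

lemma image_mult:
  assumes "A \<subseteq> E" "g \<in> carrier G" "h \<in> carrier G" shows "\<phi> (g \<otimes> h) ` A = \<phi> g ` \<phi> h ` A"
proof -
  have "\<phi> (g \<otimes> h) ` A = (\<lambda>x. \<phi> g (\<phi> h x)) ` A" using assms by (intro image_cong refl composition_rule) auto
  then show ?thesis by (simp add: image_image)
qed

lemma translates_closed:
  assumes "A \<subseteq> E" "T \<in> translates A" "g \<in> carrier G" shows "\<phi> g ` T \<in> translates A"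
proof -
  obtain h where h: "h \<in> carrier G" "T = \<phi> h ` A" using assms(2) by (auto simp: translates_def)
  then have "\<phi> g ` T = \<phi> (g \<otimes> h) ` A" using image_mult[OF assms(1,3) h(1)] by simp
  then show ?thesis unfolding translates_def using assms(3) h(1) by blast
qed

lemma card_translate:
  assumes "A \<subseteq> E" "T \<in> translates A" shows "card T = card A"
proof -
  obtain g where "g \<in> carrier G" "T = \<phi> g ` A" using assms(2) by (auto simp: translates_def)
  then show ?thesis using card_image[OF inj_on_subset[OF inj_prop assms(1)]] by simp
qed

lemma card_translates_le:
  assumes A: "A \<subseteq> E" and y: "y \<in> E" and stab: "\<And>h. h \<in> stabilizer G \<phi> y \<Longrightarrow> \<phi> h ` A = A"
  shows "card (translates A) \<le> card (orbit G \<phi> y)"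
proof -
  have "\<phi> g ` A = \<phi> h ` A" if gh: "g \<in> carrier G" "h \<in> carrier G" and eq: "\<phi> g y = \<phi> h y" for g h
  proof -
    have "\<phi> (inv g \<otimes> h) y = y"
      using composition_rule[OF y] orbit_sym_aux[OF gh(1) y eq] gh by simp
    then have "\<phi> (inv g \<otimes> h) ` A = A" using gh by (intro stab) (simp add: stabilizer_def)
    then have "\<phi> g ` A = \<phi> (g \<otimes> (inv g \<otimes> h)) ` A" using image_mult[OF A gh(1), of "inv g \<otimes> h"] gh by simp
    also have "g \<otimes> (inv g \<otimes> h) = h" using gh by (simp add: m_assoc[symmetric])
    finally show ?thesis .
  qed
  then have "card ((\<lambda>g. \<phi> g ` A) ` carrier G) \<le> card ((\<lambda>g. \<phi> g y) ` carrier G)"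
    by (intro card_image_le_if_factors finite_carrier)
  then show ?thesis by (simp add: translates_def orbit_def setcompr_eq_image)
qed

lemma card_translates_containing_le:
  assumes A: "A \<subseteq> E" and x: "x \<in> E" and y: "y \<in> orbit G \<phi> x"
  shows "card {T \<in> translates A. x \<in> T} \<le> card {T \<in> translates A. y \<in> T}"
proof -
  obtain g where g: "g \<in> carrier G" "\<phi> g x = y" using y by (auto simp: orbit_def)
  have TE: "T \<subseteq> E" if "T \<in> translates A" for T
    using that A element_image by (auto simp: translates_def)
  have "inj_on (image (\<phi> g)) {T \<in> translates A. x \<in> T}"
    using inj_prop[OF g(1)] TE by (intro inj_on_subset[OF inj_on_image_Pow]) auto
  moreover have "image (\<phi> g) ` {T \<in> translates A. x \<in> T} \<subseteq> {T \<in> translates A. y \<in> T}"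
    using translates_closed[OF A _ g(1)] g(2) by auto
  ultimately show ?thesis using finite_translates by (intro card_inj_on_le) auto
qed

lemma card_orbit_mult_card_translates_containing:
  assumes x: "x \<in> E" and A: "A \<subseteq> orbit G \<phi> x"
  shows "card (orbit G \<phi> x) * card {T \<in> translates A. x \<in> T} = card (translates A) * card A"
proof -
  let ?O = "orbit G \<phi> x"
  have AE: "A \<subseteq> E" using A orbit_subset[OF x] by blast
  have degree: "card {T \<in> translates A. y \<in> T} = card {T \<in> translates A. x \<in> T}" if y: "y \<in> ?O" for y
  proof (rule antisym)
    have "y \<in> E" "x \<in> orbit G \<phi> y" using y orbit_subset[OF x] orbit_eq[OF x y] orbit_refl[OF x] by auto
    then show "card {T \<in> translates A. y \<in> T} \<le> card {T \<in> translates A. x \<in> T}"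
      by (rule card_translates_containing_le[OF AE])
  qed (rule card_translates_containing_le[OF AE x y])
  have "card ?O * card {T \<in> translates A. x \<in> T} = (\<Sum>y\<in>?O. card {T \<in> translates A. y \<in> T})"
    using degree by simp
  also have "\<dots> = (\<Sum>y\<in>?O. \<Sum>T\<in>translates A. if y \<in> T then 1 else 0)"
    by (intro sum.cong refl card_as_sums finite_translates)
  also have "\<dots> = (\<Sum>T\<in>translates A. \<Sum>y\<in>?O. if y \<in> T then 1 else 0)" by (rule sum.swap)
  also have "\<dots> = (\<Sum>T\<in>translates A. card T)"
  proof (intro sum.cong refl card_as_sums[symmetric] finite_orbit)
    fix T assume "T \<in> translates A"
    then have "T \<subseteq> ?O" using A orbit_closed[OF x] by (auto simp: translates_def)
    then show "T = {y \<in> ?O. y \<in> T}" by blast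
  qed
  also have "\<dots> = card (translates A) * card A" using card_translate[OF AE] by simp
  finally show ?thesis .
qed

subsection \<open>Two orbits of size at most five\<close>

lemma sylow_fixes_small_orbit:
  assumes p: "prime p" "sylow_subgroup p S G" and x: "x \<in> E" "card (orbit G \<phi> x) < p" and s: "s \<in> S"
  shows "\<phi> s x = x"
proof -
  have S: "subgroup S G" "card S = p ^ multiplicity p (order G)" using p by (auto simp: sylow_subgroup_def)
  interpret S: finite_group_action "G\<lparr>carrier := S\<rparr>" E \<phi> by (rule subgroup_action[OF S(1)])
  have "card (suborbit S x) \<le> card (orbit G \<phi> x)"
    by (rule card_mono[OF finite_orbit suborbit_subset[OF S(1)]])
  then have "\<not> p dvd card (suborbit S x)"
    using S.card_orbit_pos[OF x(1)] x(2) by (auto dest: dvd_imp_le)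
  then have "card (suborbit S x) = 1"
    using S.prime_dvd_card_orbit[OF p(1) _ x(1)] S(2) by (auto simp: Coset.order_def)
  then show ?thesis using S.fixed_if_card_orbit_1[OF x(1)] s by simp
qed

lemma card_translates_containing_ge:
  assumes H: "subgroup H G" and A: "A \<subseteq> E" and edge: "{a, z} \<in> translates A" "a \<in> E" "z \<in> E"
    and p: "prime p" "card (suborbit H a) < p" "card (suborbit H z) = p"
  shows "p \<le> card {T \<in> translates A. a \<in> T}"
proof -
  interpret H: finite_group_action "G\<lparr>carrier := H\<rparr>" E \<phi> by (rule subgroup_action[OF H])
  obtain S where S: "sylow_subgroup p S (G\<lparr>carrier := H\<rparr>)" using H.exists_sylow_subgroup[OF p(1)] by blast
  then have "S \<subseteq> carrier G"
    using subgroup.subset subgroup.subset[OF H] by (fastforce simp: sylow_subgroup_def)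
  have transitive: "suborbit S z = suborbit H z"
    using H.sylow_orbit_eq[OF p(1) S edge(3) p(3)] by simp
  have "(\<lambda>w. {a, w}) ` suborbit H z \<subseteq> {T \<in> translates A. a \<in> T}"
  proof
    fix T assume "T \<in> (\<lambda>w. {a, w}) ` suborbit H z"
    then obtain s where s: "s \<in> S" "T = {a, \<phi> s z}" unfolding transitive[symmetric] by (auto simp: orbit_def)
    have "\<phi> s ` {a, z} \<in> translates A"
      using \<open>S \<subseteq> carrier G\<close> s(1) by (intro translates_closed[OF A edge(1)]) auto
    then show "T \<in> {T \<in> translates A. a \<in> T}"
      using H.sylow_fixes_small_orbit[OF p(1) S edge(2) p(2) s(1)] s(2) by simp
  qed
  then have "card ((\<lambda>w. {a, w}) ` suborbit H z) \<le> card {T \<in> translates A. a \<in> T}"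
    using finite_translates by (intro card_mono) auto
  moreover have "inj_on (\<lambda>w. {a, w}) (suborbit H z)" by (auto simp: inj_on_def doubleton_eq_iff)
  ultimately show ?thesis using p(3) by (simp add: card_image)
qed

text \<open>The translates of the two-element orbit would be the edges of a 2-regular graph on five vertices,
  but an element of order three of the stabilizer makes its degree at least three.\<close>

lemma orbit_card_5_no_two_three_split:
  assumes x: "x \<in> E" "card (orbit G \<phi> x) = 5" and y: "y \<in> E" "card (orbit G \<phi> y) = 5"
    and a: "a \<in> orbit G \<phi> x" "card (suborbit (stabilizer G \<phi> y) a) = 2"
    and c: "c \<in> orbit G \<phi> x" "card (suborbit (stabilizer G \<phi> y) c) = 3"
  shows "orbit G \<phi> x \<noteq> suborbit (stabilizer G \<phi> y) a \<union> suborbit (stabilizer G \<phi> y) c"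
proof
  let ?H = "stabilizer G \<phi> y"
  let ?A = "suborbit ?H a" and ?C = "suborbit ?H c"
  assume split: "orbit G \<phi> x = ?A \<union> ?C"
  have H: "subgroup ?H G" by (rule stabilizer_subgroup[OF y(1)])
  interpret H: finite_group_action "G\<lparr>carrier := ?H\<rparr>" E \<phi> by (rule subgroup_action[OF H])
  have E: "a \<in> E" "c \<in> E" using a c orbit_subset[OF x(1)] by auto
  have A: "?A \<subseteq> E" "?A \<subseteq> orbit G \<phi> a" "a \<in> ?A"
    using H.orbit_subset H.orbit_refl E suborbit_subset[OF H] by auto
  have "\<phi> h ` ?A = ?A" if "h \<in> ?H" for h
    using that A(1) H.inj_prop[of h] H.orbit_closed[OF E(1), of _ h]
    by (intro endo_inj_surj H.finite_orbit) (auto intro: inj_on_subset)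
  then have "card (translates ?A) \<le> 5" using card_translates_le[OF A(1) y(1)] y(2) by simp
  moreover have "5 * card {T \<in> translates ?A. a \<in> T} = card (translates ?A) * 2"
    using card_orbit_mult_card_translates_containing[OF E(1) A(2)] orbit_eq[OF x(1) a(1)] x(2) a(2) by simp
  moreover have A_translate: "?A \<in> {T \<in> translates ?A. a \<in> T}" using translates_self[OF A(1)] A(3) by simp
  then have "card {T \<in> translates ?A. a \<in> T} > 0" using finite_translates by (auto simp: card_gt_0_iff)
  ultimately have degree: "card {T \<in> translates ?A. a \<in> T} = 2" by presburger
  then obtain T where T: "T \<in> translates ?A" "a \<in> T" "T \<noteq> ?A"
    using A_translate by (metis (no_types, lifting) card_2_iff insert_iff mem_Collect_eq)
  have "card T = 2" using card_translate[OF A(1) T(1)] a(2) by simp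
  then obtain z where z: "T = {a, z}" using T(2) by (auto simp: card_2_iff)
  have "z \<notin> ?A" using T(3) z A(3) a(2) \<open>card T = 2\<close> card_seteq[OF H.finite_orbit, of T a] by auto
  moreover have "T \<subseteq> orbit G \<phi> x"
    using T(1) A(2) orbit_eq[OF x(1) a(1)] orbit_closed[OF x(1)] by (auto simp: translates_def)
  ultimately have z_mem_C: "z \<in> ?C" using split z by blast
  then have "card (suborbit ?H z) = 3" using H.orbit_eq[OF E(2)] c(2) by simp
  then show False
    using card_translates_containing_ge[OF H A(1), of a z 3] T(1) z E z_mem_C H.orbit_subset[OF E(2)] a(2) degree
    by auto
qed

lemma orbit_eq_union_of_two_suborbits:
  assumes H: "subgroup H G" and x: "x \<in> E" "card (orbit G \<phi> x) \<le> 5"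
    and no_fixed_point: "\<And>w. w \<in> orbit G \<phi> x \<Longrightarrow> card (suborbit H w) \<noteq> 1"
    and z: "z \<in> orbit G \<phi> x" and w: "w \<in> orbit G \<phi> x" "w \<notin> suborbit H z"
  shows "orbit G \<phi> x = suborbit H z \<union> suborbit H w"
    and "card (orbit G \<phi> x) = card (suborbit H z) + card (suborbit H w)"
    and "card (suborbit H z) \<ge> 2" and "card (suborbit H w) \<ge> 2"
proof -
  let ?orb = "suborbit H" and ?O = "orbit G \<phi> x"
  interpret H: finite_group_action "G\<lparr>carrier := H\<rparr>" E \<phi> by (rule subgroup_action[OF H])
  have OE: "v \<in> E" if "v \<in> ?O" for v using that orbit_subset[OF x(1)] by blast
  have sub: "?orb v \<subseteq> ?O" if "v \<in> ?O" for v
    using suborbit_subset[OF H, of v] orbit_eq[OF x(1) that] by simp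
  have ge2: "card (?orb v) \<ge> 2" if "v \<in> ?O" for v
    using no_fixed_point[OF that] H.card_orbit_pos[OF OE[OF that]] by linarith
  show "card (?orb z) \<ge> 2" "card (?orb w) \<ge> 2" using ge2 z w by auto
  have card_union: "card (?orb z \<union> ?orb w) = card (?orb z) + card (?orb w)"
    using H.orbits_disjoint[OF OE[OF z] OE[OF w(1)] w(2)] by (intro card_Un_disjoint H.finite_orbit)
  show split: "?O = ?orb z \<union> ?orb w"
  proof (rule ccontr)
    assume "?O \<noteq> ?orb z \<union> ?orb w"
    then obtain v where v: "v \<in> ?O" "v \<notin> ?orb z" "v \<notin> ?orb w" using sub z w by blast
    have "(?orb z \<union> ?orb w) \<inter> ?orb v = {}"
      using H.orbits_disjoint[OF OE OE] z w(1) v by blast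
    then have "card (?orb z \<union> ?orb w \<union> ?orb v) = card (?orb z) + card (?orb w) + card (?orb v)"
      using card_union by (simp add: card_Un_disjoint H.finite_orbit)
    moreover have "card (?orb z \<union> ?orb w \<union> ?orb v) \<le> card ?O"
      using sub z w v by (intro card_mono finite_orbit) blast
    ultimately show False using ge2[OF z] ge2[OF w(1)] ge2[OF v(1)] x(2) by linarith
  qed
  show "card ?O = card (?orb z) + card (?orb w)" using card_union split by simp
qed

lemma exists_point_fixed_by_stabilizer:
  assumes x: "x \<in> E" and y: "y \<in> E" and card_eq: "card (orbit G \<phi> x) = card (orbit G \<phi> y)"
    and l: "prime l" "card (orbit G \<phi> x) = l \<or> l = 2 \<and> card (orbit G \<phi> x) = 4" "card (orbit G \<phi> x) \<le> 5"
    and z: "z \<in> orbit G \<phi> x" "\<not> l dvd card (suborbit (stabilizer G \<phi> y) z)"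
  shows "\<exists>w\<in>orbit G \<phi> x. card (suborbit (stabilizer G \<phi> y) w) = 1"
proof (rule ccontr)
  assume no_fixed_point: "\<not> ?thesis"
  let ?orb = "suborbit (stabilizer G \<phi> y)" and ?O = "orbit G \<phi> x"
  have H: "subgroup (stabilizer G \<phi> y) G" by (rule stabilizer_subgroup[OF y])
  have "?orb z \<subseteq> ?O" using suborbit_subset[OF H, of z] orbit_eq[OF x z(1)] by simp
  moreover have "?orb z \<noteq> ?O" using l(2) z(2) by auto
  ultimately obtain w where w: "w \<in> ?O" "w \<notin> ?orb z" by blast
  have split: "?O = ?orb z \<union> ?orb w" and card_O: "card ?O = card (?orb z) + card (?orb w)"
    and ge2: "card (?orb z) \<ge> 2" "card (?orb w) \<ge> 2"
    using orbit_eq_union_of_two_suborbits[OF H x l(3) _ z(1) w] no_fixed_point by blast+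
  have card5: "card ?O = 5"
  proof (rule ccontr)
    assume "card ?O \<noteq> 5"
    then have "card ?O = 4" "card (?orb z) = 2" using card_O ge2 l(3) by linarith+
    moreover have "\<not> prime (4::nat)" by simp
    ultimately show False using l(1,2) z(2) by auto
  qed
  have card_y: "card (orbit G \<phi> y) = 5" using card_eq card5 by simp
  consider (two_three) "card (?orb z) = 2" "card (?orb w) = 3" | (three_two) "card (?orb z) = 3" "card (?orb w) = 2"
    using card_O card5 ge2 by linarith
  then show False
  proof cases
    case two_three
    then show False using orbit_card_5_no_two_three_split[OF x card5 y card_y z(1) _ w(1)] split by blast
  next
    case three_two
    then show False using orbit_card_5_no_two_three_split[OF x card5 y card_y w(1) _ z(1)] split by blast
  qed
qed

lemma exists_prime_eq_or_4:
  assumes "n > 1" "n \<le> (5::nat)" shows "\<exists>l. prime l \<and> (n = l \<or> l = 2 \<and> n = 4)"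
proof -
  have "n = 2 \<or> n = 3 \<or> n = 4 \<or> n = 5" using assms by linarith
  moreover have "prime (2::nat)" "prime (3::nat)" "prime (5::nat)" by simp_all
  ultimately show ?thesis by blast
qed

lemma card_orbit_le_if_fixes_some:
  assumes x: "x \<in> E" "card (orbit G \<phi> x) \<le> 5" and y: "y \<in> E"
    and fixes_some: "\<And>l g. prime l \<Longrightarrow> g \<in> prime_power_elements l G \<Longrightarrow>
      (\<exists>z\<in>orbit G \<phi> y. \<phi> g z = z) \<Longrightarrow> (\<exists>z\<in>orbit G \<phi> x. \<phi> g z = z)"
  shows "card (orbit G \<phi> x) \<le> card (orbit G \<phi> y)"
proof (cases "card (orbit G \<phi> x) > 1")
  case True
  then obtain l where l: "prime l" "card (orbit G \<phi> x) = l \<or> l = 2 \<and> card (orbit G \<phi> x) = 4"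
    using exists_prime_eq_or_4 x(2) by blast
  show ?thesis
    by (rule card_orbit_le_if_fixes_point(1)[OF l(1) x(1) y l(2)]) (use fixes_some[OF l(1)] orbit_refl[OF y] in blast)
qed (use card_orbit_pos[OF y] in linarith)

lemma exists_singleton_suborbit:
  assumes x: "x \<in> E" "card (orbit G \<phi> x) \<le> 5" and y: "y \<in> E" and card_eq: "card (orbit G \<phi> x) = card (orbit G \<phi> y)"
    and fixes_some: "\<And>l g. prime l \<Longrightarrow> g \<in> prime_power_elements l G \<Longrightarrow>
      (\<exists>z\<in>orbit G \<phi> y. \<phi> g z = z) \<Longrightarrow> (\<exists>z\<in>orbit G \<phi> x. \<phi> g z = z)"
  shows "\<exists>z\<in>orbit G \<phi> x. card (suborbit (stabilizer G \<phi> y) z) = 1"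
proof (cases "card (orbit G \<phi> x) > 1")
  case True
  then obtain l where l: "prime l" "card (orbit G \<phi> x) = l \<or> l = 2 \<and> card (orbit G \<phi> x) = 4"
    using exists_prime_eq_or_4 x(2) by blast
  have "\<exists>z\<in>orbit G \<phi> x. \<not> l dvd card (suborbit (stabilizer G \<phi> y) z)"
    by (rule card_orbit_le_if_fixes_point(2)[OF l(1) x(1) y l(2) _ card_eq])
      (use fixes_some[OF l(1)] orbit_refl[OF y] in blast)
  then show ?thesis using exists_point_fixed_by_stabilizer[OF x(1) y card_eq l x(2)] by blast
next
  case False
  note H = stabilizer_subgroup[OF y]
  interpret H: finite_group_action "G\<lparr>carrier := stabilizer G \<phi> y\<rparr>" E \<phi> by (rule subgroup_action[OF H])
  have "card (suborbit (stabilizer G \<phi> y) x) \<le> card (orbit G \<phi> x)"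
    by (rule card_mono[OF finite_orbit suborbit_subset[OF H]])
  then have "card (suborbit (stabilizer G \<phi> y) x) = 1"
    using False H.card_orbit_pos[OF x(1)] by linarith
  then show ?thesis using orbit_refl[OF x(1)] by blast
qed

theorem exists_equal_stabilizers:
  assumes x: "x \<in> E" "card (orbit G \<phi> x) \<le> 5" and y: "y \<in> E" "card (orbit G \<phi> y) \<le> 5"
    and fixes_iff: "\<And>l g. prime l \<Longrightarrow> g \<in> prime_power_elements l G \<Longrightarrow>
      (\<exists>z\<in>orbit G \<phi> x. \<phi> g z = z) \<longleftrightarrow> (\<exists>z\<in>orbit G \<phi> y. \<phi> g z = z)"
  shows "\<exists>z\<in>orbit G \<phi> x. stabilizer G \<phi> z = stabilizer G \<phi> y"
proof -
  have card_eq: "card (orbit G \<phi> x) = card (orbit G \<phi> y)"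
    using card_orbit_le_if_fixes_some[OF x y(1)] card_orbit_le_if_fixes_some[OF y x(1)] fixes_iff
    by (simp add: le_antisym)
  obtain z where z: "z \<in> orbit G \<phi> x" "card (suborbit (stabilizer G \<phi> y) z) = 1"
    using exists_singleton_suborbit[OF x y(1) card_eq] fixes_iff by blast
  have z_mem: "z \<in> E" using z(1) orbit_subset[OF x(1)] by blast
  interpret H: finite_group_action "G\<lparr>carrier := stabilizer G \<phi> y\<rparr>" E \<phi>
    by (rule subgroup_action[OF stabilizer_subgroup[OF y(1)]])
  have "stabilizer G \<phi> y \<subseteq> stabilizer G \<phi> z"
    using H.fixed_if_card_orbit_1[OF z_mem z(2)] by (auto simp: stabilizer_def)
  moreover have "card (stabilizer G \<phi> z) = card (stabilizer G \<phi> y)"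
    using card_stabilizer_eq[OF x(1) z(1)] orbit_stabilizer_theorem[OF y(1)] card_eq card_orbit_pos[OF x(1)]
    by (metis mult_left_cancel not_gr_zero)
  moreover have "finite (stabilizer G \<phi> z)" using finite_carrier by (simp add: stabilizer_def)
  ultimately show ?thesis using z(1) by (metis card_subset_eq)
qed

end

section \<open>Congruences in subrings\<close>

locale comm_subring =
  fixes A :: "'a::comm_ring_1 set"
  assumes one_mem: "1 \<in> A"
    and diff_mem: "x \<in> A \<Longrightarrow> y \<in> A \<Longrightarrow> x - y \<in> A"
    and mult_mem: "x \<in> A \<Longrightarrow> y \<in> A \<Longrightarrow> x * y \<in> A"
begin

lemma zero_mem: "0 \<in> A"
  using diff_mem[OF one_mem one_mem] by simp

lemma minus_mem: "x \<in> A \<Longrightarrow> - x \<in> A"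
  using diff_mem[OF zero_mem] by force

lemma add_mem: "x \<in> A \<Longrightarrow> y \<in> A \<Longrightarrow> x + y \<in> A"
  using diff_mem[OF _ minus_mem] by force

lemma sum_mem: "(\<And>i. i \<in> I \<Longrightarrow> f i \<in> A) \<Longrightarrow> sum f I \<in> A"
  by (induction I rule: infinite_finite_induct) (auto simp: zero_mem add_mem)

lemma prod_mem: "(\<And>i. i \<in> I \<Longrightarrow> f i \<in> A) \<Longrightarrow> prod f I \<in> A"
  by (induction I rule: infinite_finite_induct) (auto simp: one_mem mult_mem)

lemma power_mem: "x \<in> A \<Longrightarrow> x ^ n \<in> A"
  by (induction n) (auto simp: one_mem mult_mem)

lemma of_nat_mem: "of_nat n \<in> A"
  by (induction n) (auto simp: zero_mem one_mem add_mem)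

lemma of_int_mem: "of_int n \<in> A"
  by (cases n) (auto simp: of_nat_mem minus_mem diff_mem one_mem simp del: of_nat_Suc)

lemmas mem_simps =
  zero_mem one_mem diff_mem minus_mem add_mem mult_mem sum_mem prod_mem power_mem of_nat_mem of_int_mem

subsection \<open>Polynomials over a subring\<close>

definition polys :: "'a poly set" where
  "polys = {q. \<forall>i. coeff q i \<in> A}"

lemma coeff_mem: "q \<in> polys \<Longrightarrow> coeff q i \<in> A"
  by (simp add: polys_def)

lemma polys_add: "p \<in> polys \<Longrightarrow> q \<in> polys \<Longrightarrow> p + q \<in> polys"
  and polys_diff: "p \<in> polys \<Longrightarrow> q \<in> polys \<Longrightarrow> p - q \<in> polys"
  and polys_mult: "p \<in> polys \<Longrightarrow> q \<in> polys \<Longrightarrow> p * q \<in> polys"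
  and polys_smult: "c \<in> A \<Longrightarrow> p \<in> polys \<Longrightarrow> smult c p \<in> polys"
  and polys_0: "0 \<in> polys"
  and polys_1: "1 \<in> polys"
  and polys_monom: "c \<in> A \<Longrightarrow> monom c n \<in> polys"
  and polys_linear: "c \<in> A \<Longrightarrow> [:- c, 1:] \<in> polys"
  by (auto simp: polys_def mem_simps coeff_mult coeff_pCons split: nat.splits)

lemma polys_pCons: "pCons a q \<in> polys \<longleftrightarrow> a \<in> A \<and> q \<in> polys"
  unfolding polys_def by (force simp: coeff_pCons split: nat.splits)

lemma polys_prod: "(\<And>i. i \<in> I \<Longrightarrow> f i \<in> polys) \<Longrightarrow> prod f I \<in> polys"
  by (induction I rule: infinite_finite_induct) (auto simp: polys_1 polys_mult)

lemma polys_sum: "(\<And>i. i \<in> I \<Longrightarrow> f i \<in> polys) \<Longrightarrow> sum f I \<in> polys"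
  by (induction I rule: infinite_finite_induct) (auto simp: polys_0 polys_add)

lemma poly_mem: "q \<in> polys \<Longrightarrow> y \<in> A \<Longrightarrow> poly q y \<in> A"
  by (auto simp: poly_altdef polys_def intro!: mem_simps)

lemma polys_synthetic_div: "q \<in> polys \<Longrightarrow> c \<in> A \<Longrightarrow> synthetic_div q c \<in> polys"
  by (induction q) (auto simp: polys_pCons polys_0 poly_mem)

subsection \<open>Ideals\<close>

definition is_ideal :: "'a set \<Rightarrow> bool" where
  "is_ideal I \<longleftrightarrow> I \<subseteq> A \<and> 0 \<in> I \<and> (\<forall>x\<in>I. \<forall>y\<in>I. x + y \<in> I) \<and> (\<forall>x\<in>A. \<forall>y\<in>I. x * y \<in> I)"

lemma ideal_mem: "is_ideal I \<Longrightarrow> x \<in> I \<Longrightarrow> x \<in> A"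
  and ideal_zero: "is_ideal I \<Longrightarrow> 0 \<in> I"
  and ideal_add: "is_ideal I \<Longrightarrow> x \<in> I \<Longrightarrow> y \<in> I \<Longrightarrow> x + y \<in> I"
  and ideal_mult_left: "is_ideal I \<Longrightarrow> x \<in> A \<Longrightarrow> y \<in> I \<Longrightarrow> x * y \<in> I"
  and ideal_mult_right: "is_ideal I \<Longrightarrow> x \<in> I \<Longrightarrow> y \<in> A \<Longrightarrow> x * y \<in> I"
  by (auto simp: is_ideal_def mult.commute)

lemma ideal_minus: "is_ideal I \<Longrightarrow> x \<in> I \<Longrightarrow> - x \<in> I"
  using ideal_mult_left[of I "-1" x] mem_simps by auto

lemma ideal_diff: "is_ideal I \<Longrightarrow> x \<in> I \<Longrightarrow> y \<in> I \<Longrightarrow> x - y \<in> I"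
  using ideal_add[of I x "-y"] ideal_minus by auto

lemma ideal_sum: "is_ideal I \<Longrightarrow> (\<And>i. i \<in> S \<Longrightarrow> f i \<in> I) \<Longrightarrow> sum f S \<in> I"
  by (induction S rule: infinite_finite_induct) (auto simp: ideal_zero ideal_add)

lemma ideal_cong_trans: "is_ideal I \<Longrightarrow> x - y \<in> I \<Longrightarrow> y - z \<in> I \<Longrightarrow> x - z \<in> I"
  using ideal_add[of I "x - y" "y - z"] by simp

lemma ideal_cong_sym: "is_ideal I \<Longrightarrow> x - y \<in> I \<Longrightarrow> y - x \<in> I"
  using ideal_minus[of I "x - y"] by simp

lemma ideal_cong_mem: "is_ideal I \<Longrightarrow> x - y \<in> I \<Longrightarrow> x \<in> I \<longleftrightarrow> y \<in> I"
  using ideal_cong_trans[of I x y 0] ideal_cong_trans[of I y x 0] ideal_cong_sym by auto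

lemma ideal_cong_mult:
  assumes "is_ideal I" "x - x' \<in> I" "y - y' \<in> I" "x \<in> A" "y' \<in> A"
  shows "x * y - x' * y' \<in> I"
proof -
  have "x * y - x' * y' = x * (y - y') + (x - x') * y'" by (simp add: algebra_simps)
  then show ?thesis using assms by (simp add: ideal_add ideal_mult_left ideal_mult_right)
qed

lemma ideal_cong_power:
  "is_ideal I \<Longrightarrow> x - y \<in> I \<Longrightarrow> x \<in> A \<Longrightarrow> y \<in> A \<Longrightarrow> x ^ n - y ^ n \<in> I"
  by (induction n) (auto simp: ideal_zero intro!: ideal_cong_mult mem_simps)

lemma ideal_cong_sum: "is_ideal I \<Longrightarrow> (\<And>i. i \<in> S \<Longrightarrow> f i - g i \<in> I) \<Longrightarrow> sum f S - sum g S \<in> I"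
  using ideal_sum[of I S "\<lambda>i. f i - g i"] by (simp add: sum_subtractf)

lemma ideal_prod_cong_1:
  "is_ideal I \<Longrightarrow> (\<And>i. i \<in> S \<Longrightarrow> f i \<in> A \<and> f i - 1 \<in> I) \<Longrightarrow> prod f S - 1 \<in> I"
proof (induction S rule: infinite_finite_induct)
  case (insert a S)
  have "f a * prod f S - 1 * 1 \<in> I" using insert by (intro ideal_cong_mult) (auto simp: one_mem)
  then show ?case using insert by simp
qed (auto simp: ideal_zero)

lemma ideal_power: "is_ideal I \<Longrightarrow> x \<in> I \<Longrightarrow> n > 0 \<Longrightarrow> x ^ n \<in> I"
  using ideal_cong_power[of I x 0 n] ideal_mem[of I x] by (simp add: mem_simps power_0_left)

lemma ideal_poly: "is_ideal I \<Longrightarrow> (\<And>i. coeff q i \<in> I) \<Longrightarrow> y \<in> A \<Longrightarrow> poly q y \<in> I"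
  unfolding poly_altdef by (intro ideal_sum) (auto simp: ideal_mult_right mem_simps)

lemma ideal_cong_poly:
  "is_ideal I \<Longrightarrow> q \<in> polys \<Longrightarrow> x \<in> A \<Longrightarrow> y \<in> A \<Longrightarrow> x - y \<in> I \<Longrightarrow> poly q x - poly q y \<in> I"
  unfolding poly_altdef
  by (intro ideal_cong_sum ideal_cong_mult ideal_cong_power) (auto simp: coeff_mem mem_simps ideal_zero)

definition multiples :: "nat \<Rightarrow> 'a set" where
  "multiples n = (\<lambda>x. of_nat n * x) ` A"

lemma multiplesI: "x \<in> A \<Longrightarrow> of_nat n * x \<in> multiples n"
  by (auto simp: multiples_def)

lemma is_ideal_multiples: "is_ideal (multiples n)"
  unfolding is_ideal_def
proof (intro conjI ballI)
  show "multiples n \<subseteq> A" by (auto simp: multiples_def mem_simps)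
  show "0 \<in> multiples n" using multiplesI[OF zero_mem, of n] by simp
next
  fix x y assume "x \<in> multiples n" "y \<in> multiples n"
  then obtain a b where "a \<in> A" "b \<in> A" "x = of_nat n * a" "y = of_nat n * b" by (auto simp: multiples_def)
  then show "x + y \<in> multiples n"
    using multiplesI[of "a + b" n] by (simp add: add_mem distrib_left)
next
  fix x y assume "x \<in> A" "y \<in> multiples n"
  then obtain b where "b \<in> A" "y = of_nat n * b" by (auto simp: multiples_def)
  then show "x * y \<in> multiples n"
    using multiplesI[of "x * b" n] \<open>x \<in> A\<close> by (simp add: mult_mem mult.left_commute)
qed

lemma of_int_multiples: "int n dvd m \<Longrightarrow> of_int m \<in> multiples n"
  using multiplesI[OF of_int_mem, of n] by (auto elim!: dvdE)

subsection \<open>The Frobenius congruence\<close>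

lemma power_prime_add_cong:
  assumes p: "prime p" and xy: "x \<in> A" "y \<in> A"
  shows "(x + y) ^ p - (x ^ p + y ^ p) \<in> multiples p"
proof -
  have "(x + y) ^ p = (\<Sum>k\<in>{0, p} \<union> {1..<p}. of_nat (p choose k) * x ^ k * y ^ (p - k))"
    unfolding binomial_ring by (intro sum.cong) auto
  also have "\<dots> = (x ^ p + y ^ p) + (\<Sum>k\<in>{1..<p}. of_nat (p choose k) * x ^ k * y ^ (p - k))"
    using prime_gt_0_nat[OF p] by (subst sum.union_disjoint) auto
  finally have "(x + y) ^ p - (x ^ p + y ^ p) = (\<Sum>k\<in>{1..<p}. of_nat (p choose k) * x ^ k * y ^ (p - k))"
    by simp
  also have "\<dots> \<in> multiples p"
  proof (rule ideal_sum[OF is_ideal_multiples])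
    fix k assume "k \<in> {1..<p}"
    then have "p dvd (p choose k)" using p by (intro dvd_choose_prime) auto
    then have "of_int (int (p choose k)) \<in> multiples p" by (intro of_int_multiples) simp
    then show "of_nat (p choose k) * x ^ k * y ^ (p - k) \<in> multiples p"
      using xy by (auto intro!: ideal_mult_right[OF is_ideal_multiples] mem_simps)
  qed
  finally show ?thesis .
qed

lemma power_prime_sum_cong:
  assumes p: "prime p" and "\<And>i. i \<in> S \<Longrightarrow> f i \<in> A"
  shows "(sum f S) ^ p - (\<Sum>i\<in>S. f i ^ p) \<in> multiples p"
  using assms(2)
proof (induction S rule: infinite_finite_induct)
  case (insert a S)
  have "(f a + sum f S) ^ p - (f a ^ p + sum f S ^ p) \<in> multiples p"
    using insert by (intro power_prime_add_cong p mem_simps) auto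
  moreover have "(f a ^ p + sum f S ^ p) - (f a ^ p + (\<Sum>i\<in>S. f i ^ p)) \<in> multiples p"
    using insert by simp
  ultimately have "(f a + sum f S) ^ p - (f a ^ p + (\<Sum>i\<in>S. f i ^ p)) \<in> multiples p"
    by (rule ideal_cong_trans[OF is_ideal_multiples])
  then show ?case using insert by simp
qed (use prime_gt_0_nat[OF p] in \<open>auto simp: ideal_zero[OF is_ideal_multiples] power_0_left\<close>)

lemma power_prime_power_sum_cong:
  assumes p: "prime p" and f: "\<And>i. i \<in> S \<Longrightarrow> f i \<in> A"
  shows "(sum f S) ^ (p ^ t) - (\<Sum>i\<in>S. f i ^ (p ^ t)) \<in> multiples p"
proof (induction t)
  case 0
  then show ?case by (simp add: ideal_zero[OF is_ideal_multiples])
next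
  case (Suc t)
  have "((sum f S) ^ (p ^ t)) ^ p - (\<Sum>i\<in>S. f i ^ (p ^ t)) ^ p \<in> multiples p"
    by (intro ideal_cong_power[OF is_ideal_multiples Suc]) (auto intro!: mem_simps f)
  moreover have "(\<Sum>i\<in>S. f i ^ (p ^ t)) ^ p - (\<Sum>i\<in>S. (f i ^ (p ^ t)) ^ p) \<in> multiples p"
    by (intro power_prime_sum_cong p mem_simps f)
  ultimately have "((sum f S) ^ (p ^ t)) ^ p - (\<Sum>i\<in>S. (f i ^ (p ^ t)) ^ p) \<in> multiples p"
    by (rule ideal_cong_trans[OF is_ideal_multiples])
  then show ?case by (simp add: power_mult[symmetric] mult.commute)
qed

lemma power_prime_of_int_cong:
  assumes p: "prime p" shows "of_int n ^ p - of_int n \<in> multiples p"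
proof -
  define m where "m = nat (n mod int p)"
  have "int p dvd n - int m"
    unfolding m_def using prime_gt_0_nat[OF p] by (simp add: mod_eq_dvd_iff[symmetric])
  then have nm: "of_int n - of_nat m \<in> multiples p" using of_int_multiples[of p "n - int m"] by simp
  have "of_int n ^ p - of_nat m ^ p \<in> multiples p"
    by (intro ideal_cong_power[OF is_ideal_multiples nm] mem_simps)
  moreover have "of_nat m ^ p - of_nat m \<in> multiples p"
    using power_prime_sum_cong[OF p, of "{..<m}" "\<lambda>_. 1"] by (simp add: one_mem)
  ultimately show ?thesis
    using ideal_cong_trans[OF is_ideal_multiples] ideal_cong_sym[OF is_ideal_multiples nm] by blast
qed

lemma power_prime_poly_cong:
  assumes p: "prime p" and q: "\<And>i. coeff q i \<in> \<int>" and y: "y \<in> A"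
  shows "poly q y ^ p - poly q (y ^ p) \<in> multiples p"
proof -
  have coeff_A: "coeff q i \<in> A" for i using q[of i] of_int_mem by (auto elim: Ints_cases)
  have "poly q y ^ p - (\<Sum>i\<le>degree q. (coeff q i * y ^ i) ^ p) \<in> multiples p"
    unfolding poly_altdef by (intro power_prime_sum_cong p mem_simps coeff_A y)
  moreover have "(\<Sum>i\<le>degree q. (coeff q i * y ^ i) ^ p) - poly q (y ^ p) \<in> multiples p"
    unfolding poly_altdef
  proof (rule ideal_cong_sum[OF is_ideal_multiples])
    fix i
    obtain n where n: "coeff q i = of_int n" using q[of i] by (auto elim: Ints_cases)
    have "(coeff q i * y ^ i) ^ p - coeff q i * (y ^ p) ^ i = (of_int n ^ p - of_int n) * (y ^ p) ^ i"
      by (simp add: n left_diff_distrib power_mult_distrib) (simp add: power_mult[symmetric] mult.commute)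
    then show "(coeff q i * y ^ i) ^ p - coeff q i * (y ^ p) ^ i \<in> multiples p"
      using power_prime_of_int_cong[OF p] y by (simp add: ideal_mult_right[OF is_ideal_multiples] mem_simps)
  qed
  ultimately show ?thesis by (rule ideal_cong_trans[OF is_ideal_multiples])
qed

subsection \<open>Prime ideals\<close>

definition is_prime_ideal :: "'a set \<Rightarrow> bool" where
  "is_prime_ideal Q \<longleftrightarrow> is_ideal Q \<and> 1 \<notin> Q \<and> (\<forall>x\<in>A. \<forall>y\<in>A. x * y \<in> Q \<longrightarrow> x \<in> Q \<or> y \<in> Q)"

lemma prime_ideal_ideal: "is_prime_ideal Q \<Longrightarrow> is_ideal Q"
  and prime_ideal_one: "is_prime_ideal Q \<Longrightarrow> 1 \<notin> Q"
  and prime_ideal_multD: "is_prime_ideal Q \<Longrightarrow> x * y \<in> Q \<Longrightarrow> x \<in> A \<Longrightarrow> y \<in> A \<Longrightarrow> x \<in> Q \<or> y \<in> Q"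
  by (auto simp: is_prime_ideal_def)

lemma prime_ideal_complement_mult: "is_prime_ideal Q \<Longrightarrow> x \<in> A - Q \<Longrightarrow> y \<in> A - Q \<Longrightarrow> x * y \<in> A - Q"
  by (auto simp: is_prime_ideal_def mem_simps)

lemma prime_ideal_prodD:
  "is_prime_ideal Q \<Longrightarrow> (\<And>i. i \<in> S \<Longrightarrow> f i \<in> A) \<Longrightarrow> prod f S \<in> Q \<Longrightarrow> \<exists>i\<in>S. f i \<in> Q"
proof (induction S rule: infinite_finite_induct)
  case (insert a S)
  have "f a * prod f S \<in> Q" using insert by simp
  then have "f a \<in> Q \<or> prod f S \<in> Q" using insert.prems by (intro prime_ideal_multD prod_mem) auto
  then show ?case using insert by auto
qed (auto simp: is_prime_ideal_def)

lemma prime_ideal_powerD: "is_prime_ideal Q \<Longrightarrow> x \<in> A \<Longrightarrow> x ^ n \<in> Q \<Longrightarrow> x \<in> Q"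
  using prime_ideal_prodD[of Q "{..<n}" "\<lambda>_. x"] by auto

lemma is_ideal_Union_chain:
  assumes "\<C> \<noteq> {}" "\<And>J. J \<in> \<C> \<Longrightarrow> is_ideal J" "\<And>J K. J \<in> \<C> \<Longrightarrow> K \<in> \<C> \<Longrightarrow> J \<subseteq> K \<or> K \<subseteq> J"
  shows "is_ideal (\<Union>\<C>)"
  unfolding is_ideal_def
proof (intro conjI ballI)
  show "\<Union>\<C> \<subseteq> A" using assms(2) ideal_mem by blast
  show "0 \<in> \<Union>\<C>" using assms(1,2) ideal_zero by blast
next
  fix x y assume "x \<in> \<Union>\<C>" "y \<in> \<Union>\<C>"
  then obtain J where "J \<in> \<C>" "x \<in> J" "y \<in> J" using assms(3) by blast
  then show "x + y \<in> \<Union>\<C>" using assms(2) ideal_add by blast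
next
  fix x y assume "x \<in> A" "y \<in> \<Union>\<C>"
  then show "x * y \<in> \<Union>\<C>" using assms(2) ideal_mult_left by blast
qed

lemma is_ideal_adjoin:
  assumes I: "is_ideal I" and x: "x \<in> A"
  shows "is_ideal {m + a * x | m a. m \<in> I \<and> a \<in> A}" (is "is_ideal ?J")
  unfolding is_ideal_def
proof (intro conjI ballI)
  show "?J \<subseteq> A" using x ideal_mem[OF I] by (auto simp: mem_simps)
  show "0 \<in> ?J" using ideal_zero[OF I] zero_mem by force
next
  fix u v assume "u \<in> ?J" "v \<in> ?J"
  then obtain m a n b where "u = m + a * x" "v = n + b * x" "m \<in> I" "n \<in> I" "a \<in> A" "b \<in> A" by auto
  then have "u + v = (m + n) + (a + b) * x" "m + n \<in> I" "a + b \<in> A"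
    using ideal_add[OF I] by (auto simp: mem_simps algebra_simps)
  then show "u + v \<in> ?J" by blast
next
  fix c u assume c: "c \<in> A" and "u \<in> ?J"
  then obtain m a where "u = m + a * x" "m \<in> I" "a \<in> A" by auto
  then have "c * u = c * m + (c * a) * x" "c * m \<in> I" "c * a \<in> A"
    using ideal_mult_left[OF I c] c by (auto simp: mult_mem distrib_left mult.assoc)
  then show "c * u \<in> ?J" by blast
qed

lemma maximal_ideal_is_prime:
  assumes M: "is_ideal M" "1 \<notin> M" and maximal: "\<And>J. is_ideal J \<Longrightarrow> 1 \<notin> J \<Longrightarrow> M \<subseteq> J \<Longrightarrow> J = M"
  shows "is_prime_ideal M"
  unfolding is_prime_ideal_def
proof (intro conjI ballI impI M)
  fix x y assume xy: "x \<in> A" "y \<in> A" "x * y \<in> M"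
  show "x \<in> M \<or> y \<in> M"
  proof (rule ccontr)
    assume not_mem: "\<not> (x \<in> M \<or> y \<in> M)"
    let ?J = "{m + a * x | m a. m \<in> M \<and> a \<in> A}"
    have "M \<subseteq> ?J" "x \<in> ?J" using ideal_zero[OF M(1)] zero_mem one_mem by force+
    then have "1 \<in> ?J" using maximal[OF is_ideal_adjoin[OF M(1) xy(1)]] not_mem by blast
    then obtain m a where ma: "1 = m + a * x" "m \<in> M" "a \<in> A" by blast
    have "y = m * y + a * (x * y)" using ma(1) by (metis distrib_right mult.assoc mult_1)
    also have "\<dots> \<in> M"
      by (rule ideal_add[OF M(1) ideal_mult_right[OF M(1) ma(2) xy(2)] ideal_mult_left[OF M(1) ma(3) xy(3)]])
    finally show False using not_mem by simp
  qed
qed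

lemma exists_prime_ideal:
  assumes I: "is_ideal I" "1 \<notin> I"
  shows "\<exists>Q. is_prime_ideal Q \<and> I \<subseteq> Q"
proof -
  let ?\<I> = "{J. is_ideal J \<and> 1 \<notin> J \<and> I \<subseteq> J}"
  have "\<exists>M\<in>?\<I>. \<forall>J\<in>?\<I>. M \<subseteq> J \<longrightarrow> J = M"
  proof (rule subset_Zorn_nonempty)
    show "?\<I> \<noteq> {}" using I by blast
    show "\<Union>\<C> \<in> ?\<I>" if \<C>: "\<C> \<noteq> {}" "subset.chain ?\<I> \<C>" for \<C>
    proof -
      have \<C>_mem: "is_ideal J" "1 \<notin> J" "I \<subseteq> J" if "J \<in> \<C>" for J
        using \<C>(2) that by (auto simp: subset.chain_def)
      moreover have "J \<subseteq> K \<or> K \<subseteq> J" if "J \<in> \<C>" "K \<in> \<C>" for J K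
        using \<C>(2) that by (auto simp: subset.chain_def)
      ultimately have "is_ideal (\<Union>\<C>)" by (intro is_ideal_Union_chain \<C>(1))
      then show ?thesis using \<C>(1) \<C>_mem by blast
    qed
  qed
  then obtain M where M: "M \<in> ?\<I>" and maximal: "\<forall>J\<in>?\<I>. M \<subseteq> J \<longrightarrow> J = M" by (elim bexE)
  have "is_prime_ideal M"
  proof (rule maximal_ideal_is_prime)
    show "J = M" if "is_ideal J" "1 \<notin> J" "M \<subseteq> J" for J using maximal M that by auto
  qed (use M in auto)
  then show ?thesis using M by auto
qed

lemma multiples_subset: "is_prime_ideal Q \<Longrightarrow> of_nat p \<in> Q \<Longrightarrow> multiples p \<subseteq> Q"
  using ideal_mult_right[OF prime_ideal_ideal] by (auto simp: multiples_def)

lemma prime_ideal_of_int_iff: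
  assumes Q: "is_prime_ideal Q" "of_nat p \<in> Q" and p: "prime p"
  shows "of_int n \<in> Q \<longleftrightarrow> int p dvd n"
proof
  assume n: "of_int n \<in> Q"
  show "int p dvd n"
  proof (rule ccontr)
    assume "\<not> int p dvd n"
    then have "coprime (int p) n" using p by (simp add: prime_imp_coprime)
    then obtain u v where "u * int p + v * n = 1" by (metis bezout_int coprime_iff_gcd_eq_1)
    then have "of_int u * of_nat p + of_int v * of_int n = (1 :: 'a)"
      by (metis of_int_1 of_int_add of_int_mult of_int_of_nat_eq)
    moreover have "of_int u * of_nat p + of_int v * of_int n \<in> Q"
      using n Q by (intro ideal_add ideal_mult_left prime_ideal_ideal) (auto simp: mem_simps)
    ultimately show False using prime_ideal_one[OF Q(1)] by simp
  qed
next
  assume "int p dvd n"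
  then show "of_int n \<in> Q" using of_int_multiples multiples_subset Q by blast
qed

lemma coeffs_mem_prime_ideal_if_many_roots:
  assumes Q: "is_prime_ideal Q" and "finite S" "S \<subseteq> A" "q \<in> polys" "degree q < card S"
    and "\<And>r s. r \<in> S \<Longrightarrow> s \<in> S \<Longrightarrow> r \<noteq> s \<Longrightarrow> r - s \<notin> Q" "\<And>r. r \<in> S \<Longrightarrow> poly q r \<in> Q"
  shows "coeff q i \<in> Q"
  using assms(2-)
proof (induction S arbitrary: q i rule: finite_induct)
  case (insert r S)
  note ideal_Q = prime_ideal_ideal[OF Q]
  let ?d = "synthetic_div q r"
  have q: "q = [:- r, 1:] * ?d + [:poly q r:]" by (rule synthetic_div_correct'[symmetric])
  have r: "r \<in> A" "poly q r \<in> Q" and S: "S \<subseteq> A" using insert.prems by auto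
  have d: "?d \<in> polys" using insert.prems(2) r(1) by (intro polys_synthetic_div) auto
  have coeff_d: "coeff ?d j \<in> Q" for j
  proof (cases "degree q = 0")
    case True
    then have "?d = 0" by (simp add: synthetic_div_eq_0_iff)
    then show ?thesis using ideal_zero[OF ideal_Q] by simp
  next
    case False
    show ?thesis
    proof (rule insert.IH[OF S d])
      show "degree ?d < card S"
        using False insert.prems(3) insert.hyps by (simp add: degree_synthetic_div)
      show "u - v \<notin> Q" if "u \<in> S" "v \<in> S" "u \<noteq> v" for u v using that insert.prems(4) by simp
      fix s assume s: "s \<in> S"
      have "poly q s = (s - r) * poly ?d s + poly q r" by (subst q) (simp add: algebra_simps)
      then have "(s - r) * poly ?d s = poly q s - poly q r" by simp
      also have "\<dots> \<in> Q" using insert.prems(5) s by (intro ideal_diff[OF ideal_Q]) auto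
      finally have "(s - r) * poly ?d s \<in> Q" .
      moreover have "s - r \<notin> Q" using insert.prems(4)[of s r] insert.hyps(2) s by auto
      ultimately show "poly ?d s \<in> Q"
        using prime_ideal_multD[OF Q] diff_mem poly_mem[OF d] r(1) s S by blast
    qed
  qed
  have "coeff q i = (case i of 0 \<Rightarrow> - r * coeff ?d 0 + poly q r | Suc j \<Rightarrow> coeff ?d j - r * coeff ?d (Suc j))"
    by (subst q) (simp add: coeff_pCons split: nat.split)
  then show ?case
    using coeff_d r by (auto simp: ideal_add[OF ideal_Q] ideal_diff[OF ideal_Q] ideal_mult_left[OF ideal_Q] minus_mem
        split: nat.split simp del: mult_minus_left)
qed simp

lemma exists_of_nat_residue:
  assumes p: "prime p" and Q: "is_prime_ideal Q" "of_nat p \<in> Q" and y: "y \<in> A" "y ^ p - y \<in> Q"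
  shows "\<exists>r<p. y - of_nat r \<in> Q"
proof -
  note ideal_Q = prime_ideal_ideal[OF Q(1)]
  let ?S = "of_nat ` {..<p} :: 'a set"
  let ?f = "monom 1 p - monom 1 1 :: 'a poly" and ?g = "\<Prod>r<p. [:- of_nat r, 1:] :: 'a poly"
  have incongruent: "of_nat r - of_nat s \<notin> Q" if "r < p" "s < p" "r \<noteq> s" for r s
  proof
    assume "of_nat r - of_nat s \<in> Q"
    then have "of_int (int r - int s) \<in> Q" by simp
    then have "int p dvd int r - int s" using prime_ideal_of_int_iff[OF Q p] by blast
    then show False using that by (auto simp: mod_eq_dvd_iff[symmetric] zmod_trivial_iff)
  qed
  have card_S: "card ?S = p"
    using incongruent ideal_zero[OF ideal_Q] by (subst card_image) (force simp: inj_on_def)+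
  have "coeff (?f - ?g) i \<in> Q" for i
  proof (rule coeffs_mem_prime_ideal_if_many_roots[OF Q(1), of ?S])
    show "?S \<subseteq> A" using of_nat_mem by auto
    show "?f - ?g \<in> polys" by (intro polys_diff polys_monom polys_prod polys_linear mem_simps)
    have g: "degree ?g = p" "coeff ?g p = 1"
      using degree_prod_monic[of p "\<lambda>r. [:- of_nat r, 1:] :: 'a poly"] by (simp_all add: lessThan_atLeast0)
    have "coeff (?f - ?g) k = 0" if "k \<ge> p" for k
      using that g prime_gt_1_nat[OF p] by (cases "k = p") (auto simp: coeff_eq_0)
    then show "degree (?f - ?g) < card ?S"
      unfolding card_S using prime_gt_0_nat[OF p] by (intro degree_lessI) auto
    fix x assume "x \<in> ?S"
    then obtain r where r: "r < p" "x = of_nat r" by auto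
    have "of_int (int r) ^ p - of_int (int r) \<in> Q"
      using power_prime_of_int_cong[OF p] multiples_subset[OF Q] by blast
    moreover have "(\<Prod>s<p. x - of_nat s) = 0" using r by (intro prod_zero) auto
    ultimately show "poly (?f - ?g) x \<in> Q" using r(2) by (simp add: poly_monom poly_prod)
  qed (use incongruent in auto)
  then have "poly (?f - ?g) y \<in> Q" using y(1) by (intro ideal_poly[OF ideal_Q])
  then have "(y ^ p - y) - (\<Prod>r<p. y - of_nat r) \<in> Q" by (simp add: poly_monom poly_prod)
  then have "(\<Prod>r<p. y - of_nat r) \<in> Q" using ideal_cong_mem[OF ideal_Q] y(2) by blast
  then show ?thesis using prime_ideal_prodD[OF Q(1), of "{..<p}" "\<lambda>r. y - of_nat r"] y(1) by (auto simp: mem_simps)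
qed

text \<open>The ideal \<open>A \<inter> n A\<^sub>Q\<close>, where \<open>A\<^sub>Q\<close> is the localization at \<open>Q\<close>.\<close>

definition local_multiples :: "'a set \<Rightarrow> nat \<Rightarrow> 'a set" where
  "local_multiples Q n = {x \<in> A. \<exists>s\<in>A - Q. s * x \<in> multiples n}"

lemma local_multiples_diff:
  assumes Q: "is_prime_ideal Q" and "x \<in> local_multiples Q n" "y \<in> local_multiples Q n"
  shows "x - y \<in> local_multiples Q n"
proof -
  obtain s t where s: "s \<in> A - Q" "s * x \<in> multiples n" and t: "t \<in> A - Q" "t * y \<in> multiples n"
    and xy: "x \<in> A" "y \<in> A"
    using assms by (auto simp: local_multiples_def)
  have "t * (s * x) - s * (t * y) \<in> multiples n"
    by (intro ideal_diff is_ideal_multiples ideal_mult_left[OF is_ideal_multiples _ s(2)]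
        ideal_mult_left[OF is_ideal_multiples _ t(2)]) (use s t in auto)
  then have "(s * t) * (x - y) \<in> multiples n" by (simp add: algebra_simps)
  then show ?thesis using prime_ideal_complement_mult[OF Q s(1) t(1)] xy by (auto simp: local_multiples_def diff_mem)
qed

lemma local_multiples_mult_left:
  assumes "x \<in> A" "y \<in> local_multiples Q n" shows "x * y \<in> local_multiples Q n"
proof -
  obtain s where "s \<in> A - Q" "s * y \<in> multiples n" "y \<in> A" using assms(2) by (auto simp: local_multiples_def)
  moreover from this have "s * (x * y) \<in> multiples n"
    using ideal_mult_left[OF is_ideal_multiples assms(1), of "s * y" n] by (simp add: mult.left_commute)
  ultimately show ?thesis using assms(1) by (auto simp: local_multiples_def mult_mem)
qed

lemma local_multiples_mult:
  assumes Q: "is_prime_ideal Q" and "x \<in> local_multiples Q m" "y \<in> local_multiples Q n"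
  shows "x * y \<in> local_multiples Q (m * n)"
proof -
  obtain s u t v where s: "s \<in> A - Q" "s * x = of_nat m * u" "u \<in> A" and t: "t \<in> A - Q" "t * y = of_nat n * v" "v \<in> A"
    and xy: "x \<in> A" "y \<in> A"
    using assms(2,3) by (auto simp: local_multiples_def multiples_def)
  have "(s * t) * (x * y) = (s * x) * (t * y)" by (simp add: algebra_simps)
  also have "\<dots> = of_nat (m * n) * (u * v)" unfolding s t by (simp add: algebra_simps)
  finally have "(s * t) * (x * y) \<in> multiples (m * n)" using s t by (simp add: multiplesI mult_mem del: of_nat_mult)
  then show ?thesis using prime_ideal_complement_mult[OF Q s(1) t(1)] xy by (auto simp: local_multiples_def mult_mem)
qed

lemma local_multiples_cancel:
  assumes Q: "is_prime_ideal Q" and k: "k \<in> A - Q" and x: "x \<in> A" "k * x \<in> local_multiples Q n"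
  shows "x \<in> local_multiples Q n"
proof -
  obtain s where s: "s \<in> A - Q" "s * (k * x) \<in> multiples n" using x(2) by (auto simp: local_multiples_def)
  then have "(s * k) * x \<in> multiples n" by (simp add: mult.assoc)
  then show ?thesis using prime_ideal_complement_mult[OF Q s(1) k] x(1) unfolding local_multiples_def by blast
qed

lemma local_multiples_add:
  assumes Q: "is_prime_ideal Q" and x: "x \<in> local_multiples Q n" and y: "y \<in> local_multiples Q n"
  shows "x + y \<in> local_multiples Q n"
  using local_multiples_diff[OF Q x local_multiples_mult_left[of "- 1", OF _ y]] by (simp add: mem_simps)

lemma local_multiplesI_annihilator:
  assumes Q: "is_prime_ideal Q" and x: "x \<in> Q" "n > 0" "x * (x ^ n - 1) \<in> multiples m"
  shows "x \<in> local_multiples Q m"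
proof -
  have ideal_Q: "is_ideal Q" by (rule prime_ideal_ideal[OF Q])
  have x_mem: "x \<in> A" by (rule ideal_mem[OF ideal_Q x(1)])
  have "x ^ n - 1 \<notin> Q"
    using ideal_cong_mem[OF ideal_Q] ideal_power[OF ideal_Q x(1,2)] prime_ideal_one[OF Q] by blast
  then show ?thesis
    using x(3) x_mem unfolding local_multiples_def by (auto simp: mem_simps mult.commute intro!: bexI[of _ "x ^ n - 1"])
qed

end

section \<open>Finite groups of permutations\<close>

definition perm_group :: "('a \<Rightarrow> 'a) set \<Rightarrow> ('a \<Rightarrow> 'a) monoid" where
  "perm_group G = \<lparr>carrier = G, monoid.mult = (\<circ>), one = id\<rparr>"

lemma perm_group_simps [simp]:
  "carrier (perm_group G) = G" "g \<otimes>\<^bsub>perm_group G\<^esub> h = g \<circ> h" "\<one>\<^bsub>perm_group G\<^esub> = id"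
  by (simp_all add: perm_group_def)

locale finite_perm_group =
  fixes G :: "('a \<Rightarrow> 'a) set"
  assumes finite_G: "finite G"
    and id_mem: "id \<in> G"
    and comp_mem: "g \<in> G \<Longrightarrow> h \<in> G \<Longrightarrow> g \<circ> h \<in> G"
    and inverse_mem: "g \<in> G \<Longrightarrow> \<exists>h\<in>G. h \<circ> g = id \<and> g \<circ> h = id"
begin

lemma exists_inverse:
  assumes "g \<in> G" obtains h where "h \<in> G" "\<And>x. h (g x) = x" "\<And>x. g (h x) = x"
  using inverse_mem[OF assms] by (metis comp_apply id_apply)

lemma bij_mem: "g \<in> G \<Longrightarrow> bij g"
  using inverse_mem o_bij by metis

lemma inj_mem: "g \<in> G \<Longrightarrow> g x = g y \<Longrightarrow> x = y"
  using bij_mem by (metis bij_pointE)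

lemma funpow_mem: "g \<in> G \<Longrightarrow> g ^^ n \<in> G"
  by (induction n) (auto simp: id_mem comp_mem simp flip: id_def)

sublocale perm: finite_group_action "perm_group G" UNIV "\<lambda>g. g"
proof -
  have group: "group (perm_group G)"
    by (rule groupI) (auto simp: comp_mem id_mem comp_assoc dest: inverse_mem)
  have "(\<lambda>g. g) \<in> hom (perm_group G) (BijGroup UNIV)"
    using bij_mem by (auto simp: hom_def BijGroup_def Bij_def compose_def comp_def)
  then show "finite_group_action (perm_group G) UNIV (\<lambda>g. g)"
    using group by (simp add: finite_group_action_def finite_group_action_axioms_def finite_G
        group_action_def group_hom_def group_hom_axioms_def group_BijGroup)
qed

abbreviation conjugates :: "'a \<Rightarrow> 'a set" where
  "conjugates x \<equiv> orbit (perm_group G) (\<lambda>g. g) x"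

lemma conjugates_eq: "conjugates x = (\<lambda>g. g x) ` G"
  by (auto simp: orbit_def)

lemma pow_perm_group: "g [^]\<^bsub>perm_group G\<^esub> (n::nat) = g ^^ n"
  by (induction n) (auto simp: funpow_Suc_right simp del: funpow.simps(2) simp flip: id_def)

lemma bij_betw_comp: "g \<in> G \<Longrightarrow> bij_betw (\<lambda>h. g \<circ> h) G G"
proof -
  assume g: "g \<in> G"
  obtain k where k: "k \<in> G" "k \<circ> g = id" "g \<circ> k = id" using inverse_mem[OF g] by auto
  show ?thesis
    by (rule bij_betw_byWitness[where f' = "\<lambda>h. k \<circ> h"])
      (use g k in \<open>auto simp: comp_mem comp_assoc[symmetric]\<close>)
qed

lemma bij_betw_invariant:
  assumes "g \<in> G" "finite S" "\<And>x. x \<in> S \<Longrightarrow> g x \<in> S" shows "bij_betw g S S"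
proof -
  have "inj_on g S" using inj_mem[OF assms(1)] by (auto simp: inj_on_def)
  moreover have "g ` S = S" by (rule endo_inj_surj[OF assms(2) _ calculation]) (use assms(3) in blast)
  ultimately show ?thesis by (simp add: bij_betw_def)
qed

lemma conjugates_closed: "g \<in> G \<Longrightarrow> y \<in> conjugates x \<Longrightarrow> g y \<in> conjugates x"
  using perm.orbit_closed[of x y g] by simp

lemma finite_conjugates: "finite (conjugates x)"
  by (rule perm.finite_orbit)

lemma conjugates_refl: "x \<in> conjugates x"
  by (rule perm.orbit_refl) simp

lemma bij_betw_conjugates: "g \<in> G \<Longrightarrow> bij_betw g (conjugates x) (conjugates x)"
  by (rule bij_betw_invariant[OF _ finite_conjugates conjugates_closed])

end

lemma finite_zeros_affine:
  fixes a b :: "'a::field_char_0"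
  assumes "a \<noteq> 0 \<or> b \<noteq> 0" shows "finite {n::nat. a + of_nat n * b = 0}"
proof (cases "b = 0")
  case False
  then have "{n::nat. a + of_nat n * b = 0} = of_nat -` {- a / b}"
    by (auto simp: field_simps eq_neg_iff_add_eq_0)
  then show ?thesis by (simp add: finite_vimageI inj_of_nat)
qed (use assms in simp)

lemma exists_moved_by_all:
  fixes V :: "'a::field_char_0 set" and T :: "('a \<Rightarrow> 'a) set"
  assumes "finite T" and nonempty: "V \<noteq> {}"
    and closed: "\<And>x y n. x \<in> V \<Longrightarrow> y \<in> V \<Longrightarrow> x + of_nat n * y \<in> V"
    and linear: "\<And>\<tau> x y n. \<tau> \<in> T \<Longrightarrow> x \<in> V \<Longrightarrow> y \<in> V \<Longrightarrow> \<tau> (x + of_nat n * y) = \<tau> x + of_nat n * \<tau> y"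
    and moved: "\<And>\<tau>. \<tau> \<in> T \<Longrightarrow> \<exists>v\<in>V. \<tau> v \<noteq> v"
  shows "\<exists>v\<in>V. \<forall>\<tau>\<in>T. \<tau> v \<noteq> v"
  using assms(1) linear moved
proof (induction T rule: finite_induct)
  case (insert \<tau> T)
  have "\<exists>v\<in>V. \<forall>\<tau>\<in>T. \<tau> v \<noteq> v"
    using insert.prems by (intro insert.IH) auto
  then obtain x where x: "x \<in> V" "\<And>\<tau>'. \<tau>' \<in> T \<Longrightarrow> \<tau>' x \<noteq> x" by auto
  obtain y where y: "y \<in> V" "\<tau> y \<noteq> y" using insert.prems(2)[of \<tau>] by auto
  have "finite {n::nat. (\<tau>' x - x) + of_nat n * (\<tau>' y - y) = 0}" if "\<tau>' \<in> insert \<tau> T" for \<tau>'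
    using that x(2) y(2) by (intro finite_zeros_affine) auto
  then have "finite (\<Union>\<tau>'\<in>insert \<tau> T. {n::nat. (\<tau>' x - x) + of_nat n * (\<tau>' y - y) = 0})"
    using insert.hyps by (intro finite_UN_I) auto
  then obtain n where "n \<notin> (\<Union>\<tau>'\<in>insert \<tau> T. {n::nat. (\<tau>' x - x) + of_nat n * (\<tau>' y - y) = 0})"
    using ex_new_if_finite[OF infinite_UNIV_nat] by blast
  then have "\<tau>' (x + of_nat n * y) - (x + of_nat n * y) \<noteq> 0" if "\<tau>' \<in> insert \<tau> T" for \<tau>'
    using that insert.prems(1)[OF that x(1) y(1), of n] by (auto simp: right_diff_distrib add_diff_add)
  then show ?case using closed[OF x(1) y(1), of n] by force
qed (use nonempty in auto)

lemma of_int_the_inv: "x \<in> \<int> \<Longrightarrow> of_int (the_inv of_int x) = (x::'a::ring_char_0)"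
  by (auto elim!: Ints_cases simp: the_inv_f_f inj_on_def)

section \<open>Galois action on a ring of algebraic integers\<close>

locale galois_ring = comm_subring A + finite_perm_group G
  for A :: "'a::field_char_0 set" and G :: "('a \<Rightarrow> 'a) set" +
  assumes act_mem: "g \<in> G \<Longrightarrow> x \<in> A \<Longrightarrow> g x \<in> A"
    and act_diff: "g \<in> G \<Longrightarrow> x \<in> A \<Longrightarrow> y \<in> A \<Longrightarrow> g (x - y) = g x - g y"
    and act_mult: "g \<in> G \<Longrightarrow> x \<in> A \<Longrightarrow> y \<in> A \<Longrightarrow> g (x * y) = g x * g y"
    and act_one: "g \<in> G \<Longrightarrow> g 1 = 1"
    and faithful: "g \<in> G \<Longrightarrow> (\<And>x. x \<in> A \<Longrightarrow> g x = x) \<Longrightarrow> g = id"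
    and fixed_in_Ints: "x \<in> A \<Longrightarrow> (\<And>g. g \<in> G \<Longrightarrow> g x = x) \<Longrightarrow> x \<in> \<int>"
begin

lemma act_zero: "g \<in> G \<Longrightarrow> g 0 = 0"
  using act_diff[OF _ one_mem one_mem] by simp

lemma act_minus: "g \<in> G \<Longrightarrow> x \<in> A \<Longrightarrow> g (- x) = - g x"
  using act_diff[OF _ zero_mem, of g x] act_zero by simp

lemma act_add: "g \<in> G \<Longrightarrow> x \<in> A \<Longrightarrow> y \<in> A \<Longrightarrow> g (x + y) = g x + g y"
  using act_diff[OF _ _ minus_mem, of g x y] act_minus[of g y] by simp

lemma act_sum: "g \<in> G \<Longrightarrow> (\<And>i. i \<in> S \<Longrightarrow> f i \<in> A) \<Longrightarrow> g (sum f S) = (\<Sum>i\<in>S. g (f i))"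
  by (induction S rule: infinite_finite_induct) (auto simp: act_zero act_add mem_simps)

lemma act_prod: "g \<in> G \<Longrightarrow> (\<And>i. i \<in> S \<Longrightarrow> f i \<in> A) \<Longrightarrow> g (prod f S) = (\<Prod>i\<in>S. g (f i))"
  by (induction S rule: infinite_finite_induct) (auto simp: act_one act_mult mem_simps)

lemma act_power: "g \<in> G \<Longrightarrow> x \<in> A \<Longrightarrow> g (x ^ n) = g x ^ n"
  by (induction n) (auto simp: act_one act_mult mem_simps)

lemma act_of_nat: "g \<in> G \<Longrightarrow> g (of_nat n) = of_nat n"
  by (induction n) (auto simp: act_zero act_one act_add mem_simps)

lemma act_of_int: "g \<in> G \<Longrightarrow> g (of_int n) = of_int n"
  by (cases n) (auto simp: act_of_nat act_minus act_diff mem_simps act_one simp del: of_nat_Suc)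

lemma act_eq_0_iff: "g \<in> G \<Longrightarrow> g x = 0 \<longleftrightarrow> x = 0"
  using inj_mem[of g x 0] act_zero by auto

lemma act_multiples: "g \<in> G \<Longrightarrow> x \<in> multiples n \<Longrightarrow> g x \<in> multiples n"
  by (auto simp: multiples_def act_mult act_of_nat mem_simps act_mem)

lemma conjugates_mem: "x \<in> A \<Longrightarrow> y \<in> conjugates x \<Longrightarrow> y \<in> A"
  by (auto simp: conjugates_eq act_mem)

subsection \<open>Action on polynomials\<close>

lemma map_poly_act_mult:
  "g \<in> G \<Longrightarrow> p \<in> polys \<Longrightarrow> q \<in> polys \<Longrightarrow> map_poly g (p * q) = map_poly g p * map_poly g q"
  by (rule poly_eqI) (auto simp: coeff_map_poly act_zero coeff_mult act_sum act_mult mem_simps coeff_mem)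

lemma map_poly_act_add:
  "g \<in> G \<Longrightarrow> p \<in> polys \<Longrightarrow> q \<in> polys \<Longrightarrow> map_poly g (p + q) = map_poly g p + map_poly g q"
  by (rule poly_eqI) (auto simp: coeff_map_poly act_zero act_add mem_simps coeff_mem)

lemma map_poly_act_smult:
  "g \<in> G \<Longrightarrow> c \<in> A \<Longrightarrow> p \<in> polys \<Longrightarrow> map_poly g (smult c p) = smult (g c) (map_poly g p)"
  by (rule poly_eqI) (auto simp: coeff_map_poly act_zero act_mult mem_simps coeff_mem)

lemma map_poly_act_linear: "g \<in> G \<Longrightarrow> c \<in> A \<Longrightarrow> map_poly g [:- c, 1:] = [:- g c, 1:]"
  by (rule poly_eqI) (auto simp: coeff_map_poly act_zero act_minus act_one coeff_pCons split: nat.splits)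

lemma map_poly_act_prod:
  "g \<in> G \<Longrightarrow> (\<And>i. i \<in> S \<Longrightarrow> f i \<in> polys) \<Longrightarrow> map_poly g (prod f S) = (\<Prod>i\<in>S. map_poly g (f i))"
  by (induction S rule: infinite_finite_induct) (auto simp: map_poly_1' act_one map_poly_act_mult polys_prod)

lemma map_poly_act_sum:
  "g \<in> G \<Longrightarrow> (\<And>i. i \<in> S \<Longrightarrow> f i \<in> polys) \<Longrightarrow> map_poly g (sum f S) = (\<Sum>i\<in>S. map_poly g (f i))"
  by (induction S rule: infinite_finite_induct) (auto simp: map_poly_act_add polys_sum)

lemma map_poly_act_prod_linear:
  assumes "g \<in> G" "x \<in> A" "H \<subseteq> G"
  shows "map_poly g (\<Prod>h\<in>H. [:- h x, 1:]) = (\<Prod>h\<in>H. [:- (g \<circ> h) x, 1:])"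
proof -
  have H: "h \<in> G" if "h \<in> H" for h using assms(3) that by blast
  have "map_poly g (\<Prod>h\<in>H. [:- h x, 1:]) = (\<Prod>h\<in>H. map_poly g [:- h x, 1:])"
    using assms act_mem H by (intro map_poly_act_prod polys_linear) auto
  then show ?thesis using assms(1,2) act_mem H by (simp add: map_poly_act_linear del: map_poly_pCons)
qed

lemma act_poly: "g \<in> G \<Longrightarrow> q \<in> polys \<Longrightarrow> y \<in> A \<Longrightarrow> g (poly q y) = poly (map_poly g q) (g y)"
proof (induction q)
  case (pCons a q)
  then have "map_poly g (pCons a q) = pCons (g a) (map_poly g q)"
    by (intro poly_eqI) (auto simp: coeff_map_poly act_zero coeff_pCons split: nat.splits)
  then show ?case using pCons by (simp add: polys_pCons act_add act_mult mem_simps poly_mem)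
qed (simp add: act_zero)

lemma coeff_Ints_if_fixed:
  assumes "q \<in> polys" "\<And>g. g \<in> G \<Longrightarrow> map_poly g q = q" shows "coeff q i \<in> \<int>"
proof (rule fixed_in_Ints)
  show "g (coeff q i) = coeff q i" if "g \<in> G" for g
    using assms(2)[OF that] act_zero[OF that] by (metis coeff_map_poly)
qed (use assms(1) in \<open>simp add: coeff_mem\<close>)

subsection \<open>The norm\<close>

definition galois_norm :: "'a \<Rightarrow> 'a" where
  "galois_norm x = (\<Prod>g\<in>G. g x)"

lemma galois_norm_Ints: assumes x: "x \<in> A" shows "galois_norm x \<in> \<int>"
proof (rule fixed_in_Ints)
  show "galois_norm x \<in> A" unfolding galois_norm_def using x by (intro prod_mem) (simp add: act_mem)
  fix g assume g: "g \<in> G"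
  have "g (galois_norm x) = (\<Prod>h\<in>G. (g \<circ> h) x)"
    unfolding galois_norm_def using g x by (simp add: act_prod act_mem)
  also have "\<dots> = galois_norm x"
    unfolding galois_norm_def by (rule prod.reindex_bij_betw[OF bij_betw_comp[OF g]])
  finally show "g (galois_norm x) = galois_norm x" .
qed

lemma galois_norm_eq_0_iff: "galois_norm x = 0 \<longleftrightarrow> x = 0"
  unfolding galois_norm_def using finite_G id_mem by (auto simp: act_eq_0_iff)

lemma galois_norm_eq_mult:
  assumes "x \<in> A" shows "\<exists>y\<in>A. galois_norm x = x * y"
proof
  show "galois_norm x = x * (\<Prod>g\<in>G - {id}. g x)"
    unfolding galois_norm_def using prod.remove[OF finite_G id_mem, of "\<lambda>g. g x"] by simp
  show "(\<Prod>g\<in>G - {id}. g x) \<in> A" using assms by (intro prod_mem) (simp add: act_mem)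
qed

lemma not_mem_prime_ideal_above_large_prime:
  assumes x: "x \<in> A" "x \<noteq> 0"
  shows "\<exists>B. \<forall>p Q. prime p \<longrightarrow> is_prime_ideal Q \<longrightarrow> of_nat p \<in> Q \<longrightarrow> B < p \<longrightarrow> x \<notin> Q"
proof -
  obtain m where m: "galois_norm x = of_int m" using galois_norm_Ints[OF x(1)] by (auto elim: Ints_cases)
  then have m0: "m \<noteq> 0" using x(2) galois_norm_eq_0_iff[of x] by auto
  have "x \<notin> Q" if p: "prime p" and Q: "is_prime_ideal Q" "of_nat p \<in> Q" and B: "nat \<bar>m\<bar> < p" for p Q
  proof
    assume "x \<in> Q"
    then have "of_int m \<in> Q"
      using galois_norm_eq_mult[OF x(1)] ideal_mult_right[OF prime_ideal_ideal[OF Q(1)]] m by metis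
    then have "int p dvd m" using prime_ideal_of_int_iff[OF Q p] by simp
    then show False using dvd_imp_le_int[OF m0] B by fastforce
  qed
  then show ?thesis by blast
qed

lemma disjoint_prime_ideal_above_large_prime:
  assumes "finite T" "T \<subseteq> A - {0}"
  shows "\<exists>B. \<forall>p Q. prime p \<longrightarrow> is_prime_ideal Q \<longrightarrow> of_nat p \<in> Q \<longrightarrow> B < p \<longrightarrow> T \<inter> Q = {}"
  using assms
proof (induction T rule: finite_induct)
  case (insert x T)
  obtain B where B: "\<forall>p Q. prime p \<longrightarrow> is_prime_ideal Q \<longrightarrow> of_nat p \<in> Q \<longrightarrow> B < p \<longrightarrow> T \<inter> Q = {}"
    using insert by auto
  obtain C where C: "\<forall>p Q. prime p \<longrightarrow> is_prime_ideal Q \<longrightarrow> of_nat p \<in> Q \<longrightarrow> C < p \<longrightarrow> x \<notin> Q"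
    using not_mem_prime_ideal_above_large_prime[of x] insert by auto
  have "insert x T \<inter> Q = {}" if "prime p" "is_prime_ideal Q" "of_nat p \<in> Q" "max B C < p" for p Q
    using B[rule_format, of p Q] C[rule_format, of p Q] that by simp
  then show ?case by blast
qed auto

lemma of_int_multiples_iff:
  assumes "n > 0" shows "of_int m \<in> multiples n \<longleftrightarrow> int n dvd m"
proof
  assume "of_int m \<in> multiples n"
  then obtain z where z: "of_int m = of_nat n * z" "z \<in> A" by (auto simp: multiples_def)
  have "z \<in> \<int>"
  proof (rule fixed_in_Ints[OF z(2)])
    fix g assume g: "g \<in> G"
    have "of_nat n * g z = of_nat n * z"
      using act_of_int[OF g, of m] g z by (simp add: act_mult act_of_nat mem_simps)
    then show "g z = z" using assms by simp
  qed
  then obtain k where "z = of_int k" by (auto elim: Ints_cases)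
  then have "(of_int m :: 'a) = of_int (int n * k)" using z by simp
  then show "int n dvd m" unfolding of_int_eq_iff by simp
qed (rule of_int_multiples)

lemma dvd_if_of_int_local_multiples:
  assumes p: "prime p" and Q: "is_prime_ideal Q" "of_nat p \<in> Q" and n: "of_int n \<in> local_multiples Q (p ^ k)"
  shows "int p ^ k dvd n"
proof -
  obtain s where s: "s \<in> A" "s \<notin> Q" "s * of_int n \<in> multiples (p ^ k)" using n by (auto simp: local_multiples_def)
  from s(3) show ?thesis
  proof (induction k arbitrary: n)
    case (Suc k)
    then obtain z where z: "s * of_int n = of_nat (p ^ Suc k) * z" "z \<in> A" by (auto simp: multiples_def)
    have "s * of_int n = of_nat p * (of_nat (p ^ k) * z)" using z(1) by simp
    also have "\<dots> \<in> Q" by (intro ideal_mult_right[OF prime_ideal_ideal[OF Q(1)] Q(2)] mem_simps z(2))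
    finally have "of_int n \<in> Q" using prime_ideal_multD[OF Q(1)] s(1,2) of_int_mem by blast
    then obtain m where m: "n = int p * m" using prime_ideal_of_int_iff[OF Q p] by auto
    have "of_nat p * (s * of_int m) = of_nat p * (of_nat (p ^ k) * z)" using z(1) m by (simp add: algebra_simps)
    then have "s * of_int m = of_nat (p ^ k) * z" using prime_gt_0_nat[OF p] by simp
    then have "int p ^ k dvd m" using multiplesI[OF z(2)] by (intro Suc.IH) metis
    then show ?case using m by simp
  qed simp
qed

subsection \<open>Lagrange interpolation on the conjugates of a generator\<close>

definition generator :: 'a where
  "generator = (SOME x. x \<in> A \<and> (\<forall>g\<in>G - {id}. g x \<noteq> x))"

lemma generator: "generator \<in> A" "g \<in> G \<Longrightarrow> g generator = generator \<Longrightarrow> g = id"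
proof -
  have "\<exists>v\<in>A. \<forall>\<tau>\<in>G - {id}. \<tau> v \<noteq> v"
  proof (rule exists_moved_by_all)
    show "finite (G - {id})" using finite_G by auto
    show "A \<noteq> {}" using zero_mem by auto
  qed (use faithful in \<open>auto simp: mem_simps act_add act_mult act_of_nat\<close>)
  then have "\<exists>x. x \<in> A \<and> (\<forall>g\<in>G - {id}. g x \<noteq> x)" by blast
  then have "generator \<in> A \<and> (\<forall>g\<in>G - {id}. g generator \<noteq> generator)"
    unfolding generator_def by (rule someI_ex)
  then show "generator \<in> A" "g \<in> G \<Longrightarrow> g generator = generator \<Longrightarrow> g = id" by auto
qed

lemma act_generator_mem: "g \<in> G \<Longrightarrow> g generator \<in> A"
  using act_mem generator(1) by simp

lemma act_generator_inj:
  assumes g: "g \<in> G" and h: "h \<in> G" and eq: "g generator = h generator" shows "g = h"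
proof -
  obtain k where k: "k \<in> G" "k \<circ> h = id" "h \<circ> k = id" using inverse_mem[OF h] by auto
  have "(k \<circ> g) generator = generator" using eq k(2) by (metis comp_apply id_apply)
  then have "k \<circ> g = id" using generator(2) comp_mem k(1) g by blast
  then show "g = h" using k(3) by (metis comp_assoc comp_id id_comp)
qed

definition lagrange_poly :: "('a \<Rightarrow> 'a) \<Rightarrow> 'a poly" where
  "lagrange_poly g = (\<Prod>h\<in>G - {g}. [:- h generator, 1:])"

definition interpolation :: "'a \<Rightarrow> 'a poly" where
  "interpolation x = (\<Sum>g\<in>G. smult (g x) (lagrange_poly g))"

definition different :: 'a where
  "different = (\<Prod>h\<in>G - {id}. generator - h generator)"

definition discriminant :: int where
  "discriminant = the_inv of_int (galois_norm different)"

lemma lagrange_poly_polys: "lagrange_poly g \<in> polys"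
  unfolding lagrange_poly_def by (rule polys_prod, rule polys_linear, rule act_generator_mem) simp

lemma interpolation_polys: "x \<in> A \<Longrightarrow> interpolation x \<in> polys"
  unfolding interpolation_def by (rule polys_sum) (simp add: polys_smult lagrange_poly_polys act_mem)

lemma map_poly_lagrange_poly:
  assumes g: "g \<in> G" and h: "h \<in> G" shows "map_poly g (lagrange_poly h) = lagrange_poly (g \<circ> h)"
proof -
  have "map_poly g (lagrange_poly h) = (\<Prod>k\<in>G - {h}. [:- (g \<circ> k) generator, 1:])"
    unfolding lagrange_poly_def using g generator(1) by (rule map_poly_act_prod_linear) auto
  also have "\<dots> = lagrange_poly (g \<circ> h)"
    unfolding lagrange_poly_def
  proof (rule prod.reindex_bij_betw[of "\<lambda>k. g \<circ> k"])
    show "bij_betw ((\<circ>) g) (G - {h}) (G - {g \<circ> h})"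
      by (rule bij_betw_DiffI[OF bij_betw_comp[OF g]]) (use g h in \<open>auto simp: bij_betw_def comp_mem\<close>)
  qed
  finally show ?thesis .
qed

lemma map_poly_interpolation:
  assumes g: "g \<in> G" and x: "x \<in> A" shows "map_poly g (interpolation x) = interpolation x"
proof -
  have "map_poly g (interpolation x) = (\<Sum>h\<in>G. smult ((g \<circ> h) x) (lagrange_poly (g \<circ> h)))"
    unfolding interpolation_def using g x
    by (subst map_poly_act_sum) (auto intro!: sum.cong polys_smult lagrange_poly_polys
        simp: map_poly_act_smult map_poly_lagrange_poly lagrange_poly_polys act_mem)
  also have "\<dots> = interpolation x"
    unfolding interpolation_def
    by (rule sum.reindex_bij_betw[OF bij_betw_comp[OF g], of "\<lambda>h. smult (h x) (lagrange_poly h)"])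
  finally show ?thesis .
qed

lemma coeff_interpolation_Ints: "x \<in> A \<Longrightarrow> coeff (interpolation x) i \<in> \<int>"
  by (intro coeff_Ints_if_fixed interpolation_polys map_poly_interpolation)

lemma coeff_interpolation_eq_trace:
  assumes x: "x \<in> A" shows "coeff (interpolation x) i = (\<Sum>g\<in>G. g (x * coeff (lagrange_poly id) i))"
  unfolding interpolation_def coeff_sum
proof (rule sum.cong[OF refl])
  fix g assume g: "g \<in> G"
  have "coeff (lagrange_poly g) i = g (coeff (lagrange_poly id) i)"
    using map_poly_lagrange_poly[OF g id_mem] act_zero[OF g] by (metis coeff_map_poly comp_id)
  then show "coeff (smult (g x) (lagrange_poly g)) i = g (x * coeff (lagrange_poly id) i)"
    using act_mult[OF g x] coeff_mem[OF lagrange_poly_polys] by simp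
qed

lemma coeff_interpolation_diff:
  "x \<in> A \<Longrightarrow> y \<in> A \<Longrightarrow> coeff (interpolation (x - y)) i = coeff (interpolation x) i - coeff (interpolation y) i"
  by (auto simp: interpolation_def coeff_sum act_diff left_diff_distrib sum_subtractf intro!: sum.cong)

lemma degree_interpolation_le: "degree (interpolation x) \<le> card G"
proof -
  have "degree (lagrange_poly g) \<le> card G" for g
  proof -
    have "degree (lagrange_poly g) \<le> (\<Sum>h\<in>G - {g}. degree [:- h generator, 1:])"
      unfolding lagrange_poly_def by (rule degree_prod_sum_le[unfolded comp_def]) (use finite_G in auto)
    also have "\<dots> \<le> card G" using finite_G by (simp add: card_mono)
    finally show ?thesis .
  qed
  then show ?thesis
    unfolding interpolation_def by (intro degree_sum_le finite_G order.trans[OF degree_smult_le])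
qed

lemma poly_interpolation:
  assumes x: "x \<in> A" and g: "g \<in> G" shows "poly (interpolation x) (g generator) = g (x * different)"
proof -
  have "poly (smult (h x) (lagrange_poly h)) generator = (if h = id then x * different else 0)"
    if h: "h \<in> G" for h
  proof (cases "h = id")
    case False
    have "(\<Prod>k\<in>G - {h}. generator - k generator) = 0"
      using finite_G id_mem False by (intro prod_zero) (auto intro!: bexI[of _ id])
    then show ?thesis using False by (simp add: lagrange_poly_def poly_prod)
  qed (simp add: lagrange_poly_def poly_prod different_def)
  then have "poly (interpolation x) generator = x * different"
    using finite_G id_mem by (simp add: interpolation_def poly_sum sum.delta cong: sum.cong)
  then show ?thesis
    using act_poly[OF g interpolation_polys[OF x] generator(1)] map_poly_interpolation[OF g x] by simp
qed

lemma different_mem: "different \<in> A"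
  unfolding different_def using generator by (intro prod_mem) (simp add: diff_mem act_mem)

lemma of_int_discriminant: "of_int discriminant = galois_norm different"
  unfolding discriminant_def by (intro of_int_the_inv galois_norm_Ints different_mem)

lemma discriminant_nonzero: "discriminant \<noteq> 0"
proof
  assume "discriminant = 0"
  then have "different = 0" using of_int_discriminant galois_norm_eq_0_iff by (metis of_int_0)
  then show False unfolding different_def using finite_G generator(2) by (auto dest: sym)
qed

text \<open>As \<open>x * different\<close> is an integer polynomial in the generator for all \<open>x \<in> A\<close>, the generator determines
  everything modulo a prime that does not divide the discriminant.\<close>

definition unramified_prime :: "nat \<Rightarrow> bool" where
  "unramified_prime p \<longleftrightarrow> prime p \<and> \<not> int p dvd discriminant"

lemma unramified_primeD: "unramified_prime p \<Longrightarrow> prime p"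
  by (simp add: unramified_prime_def)

lemma unramified_primeI: "prime p \<Longrightarrow> nat \<bar>discriminant\<bar> < p \<Longrightarrow> unramified_prime p"
  using discriminant_nonzero dvd_imp_le_int[of discriminant "int p"] by (auto simp: unramified_prime_def)

lemma act_different_not_mem:
  assumes p: "unramified_prime p" and Q: "is_prime_ideal Q" "of_nat p \<in> Q" and g: "g \<in> G"
  shows "g different \<notin> Q"
proof
  assume mem: "g different \<in> Q"
  obtain e where e: "e \<in> A" "of_int discriminant = different * e"
    using galois_norm_eq_mult[OF different_mem] of_int_discriminant by metis
  have "of_int discriminant = g different * g e"
    using act_of_int[OF g, of discriminant] e act_mult[OF g different_mem e(1)] by simp
  then have "of_int discriminant \<in> Q"
    using mem e ideal_mult_right[OF prime_ideal_ideal[OF Q(1)]] act_mem[OF g] by simp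
  then show False using prime_ideal_of_int_iff[OF Q unramified_primeD[OF p]] p by (simp add: unramified_prime_def)
qed

lemma multiples_cancel_different:
  assumes p: "unramified_prime p" and z: "z \<in> A" "z * different \<in> multiples p"
  shows "z \<in> multiples p"
proof -
  obtain e where e: "e \<in> A" "of_int discriminant = different * e"
    using galois_norm_eq_mult[OF different_mem] of_int_discriminant by metis
  have z_discriminant: "z * of_int discriminant \<in> multiples p"
    using ideal_mult_right[OF is_ideal_multiples z(2) e(1)] e(2) by (simp add: mult.assoc)
  have "coprime (int p) discriminant" using p by (simp add: unramified_prime_def prime_imp_coprime)
  then obtain u v where "u * int p + v * discriminant = 1" by (metis bezout_int coprime_iff_gcd_eq_1)
  then have "of_int u * of_nat p + of_int v * of_int discriminant = (1::'a)"
    by (metis of_int_1 of_int_add of_int_mult of_int_of_nat_eq)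
  then have "z = z * (of_int u * of_nat p + of_int v * of_int discriminant)" by simp
  also have "\<dots> = of_nat p * (z * of_int u) + of_int v * (z * of_int discriminant)" by (simp add: algebra_simps)
  also have "\<dots> \<in> multiples p"
    by (intro ideal_add[OF is_ideal_multiples] ideal_mult_left[OF is_ideal_multiples] z_discriminant multiplesI mem_simps z)
  finally show ?thesis .
qed

lemma multiples_if_coeff_interpolation:
  assumes p: "unramified_prime p" and z: "z \<in> A" and coeffs: "\<And>i. coeff (interpolation z) i \<in> multiples p"
  shows "z \<in> multiples p"
proof -
  have "poly (interpolation z) generator \<in> multiples p"
    using coeffs generator by (intro ideal_poly[OF is_ideal_multiples]) auto
  then show ?thesis using poly_interpolation[OF z id_mem] multiples_cancel_different[OF p z] by simp
qed

lemma multiples_radical: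
  assumes p: "unramified_prime p" and z: "z \<in> A" and n: "z ^ n \<in> multiples p"
  shows "z \<in> multiples p"
proof (rule multiples_if_coeff_interpolation[OF p z])
  fix i
  have prime_p: "prime p" by (rule unramified_primeD[OF p])
  let ?e = "coeff (lagrange_poly id) i" and ?c = "coeff (interpolation z) i"
  have e: "?e \<in> A" by (rule coeff_mem[OF lagrange_poly_polys])
  have "n < p ^ n" using prime_gt_1_nat[OF prime_p] power_gt_expt[of p n] by simp
  then have z_power: "z ^ (p ^ n) \<in> multiples p"
    using ideal_mult_right[OF is_ideal_multiples n, of "z ^ (p ^ n - n)"] z
    by (simp add: power_add[symmetric] power_mem)
  have "(\<Sum>g\<in>G. (g (z * ?e)) ^ (p ^ n)) \<in> multiples p"
  proof (rule ideal_sum[OF is_ideal_multiples])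
    fix g assume g: "g \<in> G"
    have "(g (z * ?e)) ^ (p ^ n) = g (z ^ (p ^ n) * ?e ^ (p ^ n))"
      using act_power[OF g mult_mem[OF z e], of "p ^ n"] by (simp add: power_mult_distrib)
    then show "(g (z * ?e)) ^ (p ^ n) \<in> multiples p"
      using act_multiples[OF g ideal_mult_right[OF is_ideal_multiples z_power power_mem[OF e]]] by simp
  qed
  moreover have "?c ^ (p ^ n) - (\<Sum>g\<in>G. (g (z * ?e)) ^ (p ^ n)) \<in> multiples p"
    unfolding coeff_interpolation_eq_trace[OF z] using e z
    by (intro power_prime_power_sum_cong[OF prime_p]) (simp add: act_mem mult_mem)
  ultimately have c_power: "?c ^ (p ^ n) \<in> multiples p" using ideal_cong_mem[OF is_ideal_multiples] by blast
  obtain m where m: "?c = of_int m" using coeff_interpolation_Ints[OF z, of i] by (auto elim: Ints_cases)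
  have "int p dvd m ^ (p ^ n)"
    using c_power m of_int_multiples_iff[of p "m ^ (p ^ n)"] prime_gt_0_nat[OF prime_p] by simp
  then have "int p dvd m" using prime_p by (meson prime_dvd_power prime_nat_int_transfer)
  then show "?c \<in> multiples p" using m of_int_multiples by simp
qed

lemma finite_representatives:
  assumes p: "unramified_prime p"
  shows "\<exists>R. finite R \<and> R \<subseteq> A \<and> (\<forall>x\<in>A. \<exists>r\<in>R. x - r \<in> multiples p)"
proof -
  define coeffs_mod where
    "coeffs_mod x = (\<lambda>i\<in>{..card G}. the_inv of_int (coeff (interpolation x) i) mod int p)" for x
  have p_pos: "p > 0" using unramified_primeD[OF p] prime_gt_0_nat by blast
  have of_int_coeff: "of_int (the_inv of_int (coeff (interpolation x) i)) = coeff (interpolation x) i" if "x \<in> A" for x i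
    using coeff_interpolation_Ints[OF that] by (rule of_int_the_inv)
  have "coeffs_mod ` A \<subseteq> {..card G} \<rightarrow>\<^sub>E {0..<int p}" using p_pos by (auto simp: coeffs_mod_def)
  then have finite: "finite (coeffs_mod ` A)" by (rule finite_subset) (intro finite_PiE, auto)
  have "x - y \<in> multiples p" if xy: "x \<in> A" "y \<in> A" "coeffs_mod x = coeffs_mod y" for x y
  proof (rule multiples_if_coeff_interpolation[OF p])
    fix i
    let ?m = "the_inv of_int (coeff (interpolation x) i) :: int"
    let ?n = "the_inv of_int (coeff (interpolation y) i) :: int"
    have "int p dvd ?m - ?n"
    proof (cases "i \<le> card G")
      case True
      then have "?m mod int p = ?n mod int p" using fun_cong[OF xy(3), of i] by (simp add: coeffs_mod_def)
      then show ?thesis by (simp add: mod_eq_dvd_iff)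
    next
      case False
      then have "coeff (interpolation u) i = 0" for u using degree_interpolation_le[of u] by (intro coeff_eq_0) simp
      then show ?thesis by simp
    qed
    then have "of_int (?m - ?n) \<in> multiples p" by (rule of_int_multiples)
    then show "coeff (interpolation (x - y)) i \<in> multiples p"
      using xy by (simp add: coeff_interpolation_diff of_int_coeff)
  qed (use xy diff_mem in simp)
  then have "x - inv_into A coeffs_mod (coeffs_mod x) \<in> multiples p" if "x \<in> A" for x
    using that inv_into_into[of "coeffs_mod x" coeffs_mod A] f_inv_into_f[of "coeffs_mod x" coeffs_mod A] by simp
  then show ?thesis
    using finite inv_into_into[of _ coeffs_mod A]
    by (intro exI[of _ "inv_into A coeffs_mod ` (coeffs_mod ` A)"]) auto
qed

lemma exists_annihilator:
  assumes p: "unramified_prime p" and x: "x \<in> A"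
  shows "\<exists>n>0. x * (x ^ n - 1) \<in> multiples p"
proof -
  obtain R where R: "finite R" "\<forall>y\<in>A. \<exists>r\<in>R. y - r \<in> multiples p" using finite_representatives[OF p] by blast
  have "\<forall>i. \<exists>r\<in>R. x ^ i - r \<in> multiples p" using R(2) power_mem[OF x] by blast
  then obtain \<rho> :: "nat \<Rightarrow> 'a" where \<rho>: "\<And>i. \<rho> i \<in> R" "\<And>i. x ^ i - \<rho> i \<in> multiples p" by metis
  have "\<not> inj \<rho>" using \<rho>(1) R(1) by (metis finite_subset image_subsetI infinite_UNIV_nat finite_imageD)
  then obtain i j where ij: "i < j" "\<rho> i = \<rho> j" unfolding inj_def by (metis linorder_neqE_nat)
  define n where "n = j - i"
  have n: "n > 0" "j = i + n" using ij by (auto simp: n_def)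
  have cong: "x ^ j - x ^ i \<in> multiples p"
    using ideal_cong_trans[OF is_ideal_multiples \<rho>(2)[of j]
        ideal_cong_sym[OF is_ideal_multiples \<rho>(2)[of i, unfolded ij(2)]]] .
  have "x ^ j - x ^ i = x ^ i * (x ^ n - 1)" by (simp add: n power_add algebra_simps)
  then have "(x * (x ^ n - 1)) ^ Suc i = (x ^ j - x ^ i) * (x * (x ^ n - 1) ^ i)"
    by (simp only: power_mult_distrib power_Suc mult.assoc mult.commute mult.left_commute)
  also have "\<dots> \<in> multiples p" using x by (intro ideal_mult_right[OF is_ideal_multiples cong] mem_simps)
  finally have "(x * (x ^ n - 1)) ^ Suc i \<in> multiples p" .
  then have "x * (x ^ n - 1) \<in> multiples p" by (rule multiples_radical[OF p, rotated]) (intro mem_simps x)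
  then show ?thesis using n by blast
qed

lemma prime_ideal_subset_local_multiples:
  assumes p: "unramified_prime p" and Q: "is_prime_ideal Q"
  shows "Q \<subseteq> local_multiples Q p"
proof
  fix x assume x: "x \<in> Q"
  then obtain n where "n > 0" "x * (x ^ n - 1) \<in> multiples p"
    using exists_annihilator[OF p ideal_mem[OF prime_ideal_ideal[OF Q]]] by blast
  then show "x \<in> local_multiples Q p" by (rule local_multiplesI_annihilator[OF Q x])
qed

lemma prod_mem_local_multiples:
  assumes p: "unramified_prime p" and Q: "is_prime_ideal Q" "of_nat p \<in> Q"
    and S: "finite S" "\<And>i. i \<in> S \<Longrightarrow> f i \<in> A" and J: "J \<subseteq> S" "\<And>i. i \<in> J \<Longrightarrow> f i \<in> Q"
  shows "prod f S \<in> local_multiples Q (p ^ card J)"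
proof -
  have "finite J" using J(1) S(1) by (rule finite_subset)
  then have "prod f J \<in> local_multiples Q (p ^ card J)"
    using J(2)
  proof (induction J rule: finite_induct)
    case empty
    show ?case
      using prime_ideal_one[OF Q(1)] one_mem multiplesI[OF one_mem, of 1] by (auto simp: local_multiples_def)
  next
    case (insert i J)
    then show ?case
      using local_multiples_mult[OF Q(1), of "f i" p "prod f J" "p ^ card J"]
        prime_ideal_subset_local_multiples[OF p Q(1)] by auto
  qed
  moreover have "prod f S = prod f (S - J) * prod f J" by (rule prod.subset_diff[OF J(1) S(1)])
  moreover have "prod f (S - J) \<in> A" using S(2) by (intro prod_mem) auto
  ultimately show ?thesis using local_multiples_mult_left by simp
qed

subsection \<open>Frobenius elements\<close>

definition is_frobenius :: "nat \<Rightarrow> 'a set \<Rightarrow> ('a \<Rightarrow> 'a) \<Rightarrow> bool" where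
  "is_frobenius p Q \<phi> \<longleftrightarrow>
    prime p \<and> is_prime_ideal Q \<and> of_nat p \<in> Q \<and> \<phi> \<in> G \<and> (\<forall>x\<in>A. x ^ p - \<phi> x \<in> Q)"

lemma exists_conjugate_cong_power:
  assumes p: "prime p" and Q: "is_prime_ideal Q" "of_nat p \<in> Q"
  shows "\<exists>\<phi>\<in>G. generator ^ p - \<phi> generator \<in> Q"
proof -
  define m where "m = (\<Prod>g\<in>G. [:- g generator, 1:])"
  have "map_poly g m = m" if g: "g \<in> G" for g
    unfolding m_def map_poly_act_prod_linear[OF g generator(1) subset_refl]
    by (rule prod.reindex_bij_betw[OF bij_betw_comp[OF g], of "\<lambda>h. [:- h generator, 1:]"])
  moreover have "m \<in> polys" unfolding m_def by (rule polys_prod, rule polys_linear, rule act_generator_mem)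
  ultimately have m_Ints: "coeff m i \<in> \<int>" for i by (intro coeff_Ints_if_fixed)
  have "poly m generator = 0"
    unfolding m_def poly_prod using finite_G id_mem by (intro prod_zero) (auto intro!: bexI[of _ id])
  then have "- poly m (generator ^ p) \<in> Q"
    using power_prime_poly_cong[OF p m_Ints generator(1)] multiples_subset[OF Q] prime_gt_0_nat[OF p]
    by (auto simp: power_0_left)
  then have "(\<Prod>g\<in>G. generator ^ p - g generator) \<in> Q"
    using ideal_minus[OF prime_ideal_ideal[OF Q(1)], of "- poly m (generator ^ p)"] by (simp add: m_def poly_prod)
  then show ?thesis
    using generator act_generator_mem by (intro prime_ideal_prodD[OF Q(1)]) (auto simp: mem_simps)
qed

lemma exists_frobenius:
  assumes p: "unramified_prime p" and Q: "is_prime_ideal Q" "of_nat p \<in> Q"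
  shows "\<exists>\<phi>. is_frobenius p Q \<phi>"
proof -
  have prime_p: "prime p" by (rule unramified_primeD[OF p])
  have ideal_Q: "is_ideal Q" by (rule prime_ideal_ideal[OF Q(1)])
  obtain \<phi> where \<phi>: "\<phi> \<in> G" "generator ^ p - \<phi> generator \<in> Q"
    using exists_conjugate_cong_power[OF prime_p Q] by blast
  have cong: "(x * different) ^ p - \<phi> (x * different) \<in> Q" if x: "x \<in> A" for x
  proof -
    have "poly (interpolation x) generator ^ p - poly (interpolation x) (generator ^ p) \<in> Q"
      using power_prime_poly_cong[OF prime_p coeff_interpolation_Ints[OF x] generator(1)] multiples_subset[OF Q] by auto
    moreover have "poly (interpolation x) (generator ^ p) - poly (interpolation x) (\<phi> generator) \<in> Q"
      using generator act_generator_mem \<phi>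
      by (intro ideal_cong_poly[OF ideal_Q interpolation_polys[OF x]]) (auto simp: mem_simps)
    ultimately have "poly (interpolation x) generator ^ p - poly (interpolation x) (\<phi> generator) \<in> Q"
      by (rule ideal_cong_trans[OF ideal_Q])
    then show ?thesis using poly_interpolation[OF x id_mem] poly_interpolation[OF x \<phi>(1)] by simp
  qed
  have different_cong: "different ^ p - \<phi> different \<in> Q" using cong[OF one_mem] by simp
  have different_nonzero: "different ^ p \<notin> Q"
    using prime_ideal_powerD[OF Q(1) different_mem] act_different_not_mem[OF p Q id_mem] by auto
  have "x ^ p - \<phi> x \<in> Q" if x: "x \<in> A" for x
  proof -
    have mem: "\<phi> x \<in> A" "\<phi> different \<in> A" "different ^ p \<in> A"
      using act_mem[OF \<phi>(1)] x different_mem power_mem by auto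
    have "x ^ p * different ^ p - \<phi> x * \<phi> different \<in> Q"
      using cong[OF x] act_mult[OF \<phi>(1) x different_mem] by (simp add: power_mult_distrib)
    moreover have "\<phi> x * \<phi> different - \<phi> x * different ^ p \<in> Q"
      using ideal_mult_left[OF ideal_Q mem(1) ideal_cong_sym[OF ideal_Q different_cong]]
      by (simp add: right_diff_distrib)
    ultimately have "(x ^ p - \<phi> x) * different ^ p \<in> Q"
      using ideal_cong_trans[OF ideal_Q] by (simp add: left_diff_distrib)
    then show ?thesis
      using prime_ideal_multD[OF Q(1)] different_nonzero mem diff_mem power_mem[OF x] by blast
  qed
  then show ?thesis using \<phi>(1) prime_p Q by (auto simp: is_frobenius_def)
qed

definition prime_over :: "nat \<Rightarrow> 'a set" where
  "prime_over p = (SOME Q. is_prime_ideal Q \<and> of_nat p \<in> Q)"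

definition frobenius :: "nat \<Rightarrow> 'a \<Rightarrow> 'a" where
  "frobenius p = (SOME \<phi>. is_frobenius p (prime_over p) \<phi>)"

lemma prime_over:
  assumes p: "prime p" shows "is_prime_ideal (prime_over p)" "of_nat p \<in> prime_over p"
proof -
  have "1 \<notin> multiples p"
    using of_int_multiples_iff[of p 1] prime_gt_1_nat[OF p] by auto
  then obtain Q where "is_prime_ideal Q" "multiples p \<subseteq> Q" using exists_prime_ideal[OF is_ideal_multiples] by blast
  then have "\<exists>Q. is_prime_ideal Q \<and> of_nat p \<in> Q" using multiplesI[OF one_mem, of p] by auto
  then show "is_prime_ideal (prime_over p)" "of_nat p \<in> prime_over p"
    unfolding prime_over_def by (metis (mono_tags, lifting) someI_ex)+
qed

lemma prime_over_ideal: "prime p \<Longrightarrow> is_ideal (prime_over p)"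
  by (intro prime_ideal_ideal prime_over)

lemma is_frobenius_frobenius:
  assumes p: "unramified_prime p" shows "is_frobenius p (prime_over p) (frobenius p)"
  unfolding frobenius_def using exists_frobenius[OF p prime_over[OF unramified_primeD[OF p]]] by (rule someI_ex)

lemma frobenius:
  assumes "unramified_prime p" shows "frobenius p \<in> G" "x \<in> A \<Longrightarrow> x ^ p - frobenius p x \<in> prime_over p"
  using is_frobenius_frobenius[OF assms] by (auto simp: is_frobenius_def)

lemma exists_moved_fixed_by_subgroup:
  assumes C: "C \<subseteq> G" "id \<in> C" "\<And>g h. g \<in> C \<Longrightarrow> h \<in> C \<Longrightarrow> g \<circ> h \<in> C" and \<tau>: "\<tau> \<in> G - C"
  shows "\<exists>v\<in>{x \<in> A. \<forall>c\<in>C. c x = x}. \<tau> v \<noteq> v"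
proof (rule ccontr)
  assume neg: "\<not> ?thesis"
  define P where "P = (\<Prod>c\<in>C. [:- c generator, 1:])"
  have P_polys: "P \<in> polys"
    unfolding P_def using C(1) by (intro polys_prod polys_linear) (auto intro: act_generator_mem)
  have finite_C: "finite C" using C(1) finite_G by (rule finite_subset)
  have "map_poly g P = P" if g: "g \<in> C" for g
  proof -
    have g_mem: "g \<in> G" using g C(1) by auto
    have inj: "inj_on (\<lambda>h. g \<circ> h) C"
      using bij_betw_imp_inj_on[OF bij_betw_comp[OF g_mem]] C(1) by (rule inj_on_subset)
    then have "(\<lambda>h. g \<circ> h) ` C = C" using C(3)[OF g] by (intro endo_inj_surj[OF finite_C]) auto
    then have "bij_betw (\<lambda>h. g \<circ> h) C C" using inj by (simp add: bij_betw_def)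
    then show ?thesis
      unfolding P_def map_poly_act_prod_linear[OF g_mem generator(1) C(1)]
      by (rule prod.reindex_bij_betw[of _ _ _ "\<lambda>h. [:- h generator, 1:]"])
  qed
  then have "coeff P i \<in> {x \<in> A. \<forall>c\<in>C. c x = x}" for i
    using coeff_mem[OF P_polys] C(1) act_zero by (auto simp: subset_iff) (metis coeff_map_poly)
  then have "\<tau> (coeff P i) = coeff P i" for i using neg by blast
  then have "map_poly \<tau> P = P" using \<tau> act_zero by (intro poly_eqI) (simp add: coeff_map_poly)
  moreover have "poly P generator = 0"
    unfolding P_def poly_prod using finite_C C(2) by (intro prod_zero) (auto intro!: bexI[of _ id])
  ultimately have "poly P (\<tau> generator) = 0"
    using act_poly[of \<tau> P generator] \<tau> P_polys generator(1) act_zero[of \<tau>] by simp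
  then obtain c where "c \<in> C" "\<tau> generator = c generator" unfolding P_def poly_prod using finite_C by auto
  then show False using act_generator_inj[of \<tau> c] \<tau> C(1) by auto
qed

lemma exists_element_with_stabilizer:
  assumes C: "C \<subseteq> G" "id \<in> C" "\<And>g h. g \<in> C \<Longrightarrow> h \<in> C \<Longrightarrow> g \<circ> h \<in> C"
  shows "\<exists>\<eta>\<in>A. \<forall>g\<in>G. g \<eta> = \<eta> \<longleftrightarrow> g \<in> C"
proof -
  let ?V = "{x \<in> A. \<forall>c\<in>C. c x = x}"
  have "\<exists>v\<in>?V. \<forall>\<tau>\<in>G - C. \<tau> v \<noteq> v"
  proof (rule exists_moved_by_all)
    show "finite (G - C)" using finite_G by simp
    show "?V \<noteq> {}" using C(1) act_zero zero_mem by blast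
    show "x + of_nat n * y \<in> ?V" if "x \<in> ?V" "y \<in> ?V" for x y n
      using that C(1) by (auto simp: mem_simps act_add act_mult act_of_nat subset_iff)
    show "\<tau> (x + of_nat n * y) = \<tau> x + of_nat n * \<tau> y" if "\<tau> \<in> G - C" "x \<in> ?V" "y \<in> ?V" for \<tau> x y n
      using that by (auto simp: mem_simps act_add act_mult act_of_nat)
  qed (rule exists_moved_fixed_by_subgroup[OF C])
  then show ?thesis by blast
qed

end

section \<open>Sums of inverse norms\<close>

definition harmonic_sum :: "'a set \<Rightarrow> ('a \<Rightarrow> nat) \<Rightarrow> nat \<Rightarrow> real" where
  "harmonic_sum S N x = (\<Sum>a\<in>{a \<in> S. N a \<le> x}. 1 / real (N a))"

lemma harmonic_sum_mono:
  assumes "finite {a \<in> S. N a \<le> y}" "x \<le> y" shows "harmonic_sum S N x \<le> harmonic_sum S N y"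
  unfolding harmonic_sum_def using assms by (intro sum_mono2) auto

lemma harmonic_sum_power_two_le:
  assumes pos: "\<And>a. a \<in> S \<Longrightarrow> N a > 0"
    and count: "\<And>x. x > 0 \<Longrightarrow> finite {a \<in> S. N a \<le> x}" "\<And>x. x > 0 \<Longrightarrow> card {a \<in> S. N a \<le> x} \<le> K * x"
  shows "harmonic_sum S N (2 ^ m) \<le> real K * (2 * real m + 1)"
proof (induction m)
  case 0
  have "harmonic_sum S N 1 \<le> (\<Sum>a\<in>{a \<in> S. N a \<le> 1}. 1)"
    unfolding harmonic_sum_def
  proof (rule sum_mono)
    fix a assume "a \<in> {a \<in> S. N a \<le> 1}"
    then show "1 / real (N a) \<le> 1" using pos[of a] by simp
  qed
  also have "\<dots> \<le> real K" using count(2)[of 1] by simp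
  finally show ?case by simp
next
  case (Suc m)
  let ?S = "\<lambda>x. {a \<in> S. N a \<le> x}"
  have "harmonic_sum S N (2 ^ Suc m) = (\<Sum>a\<in>?S (2 ^ Suc m) - ?S (2 ^ m). 1 / real (N a)) + harmonic_sum S N (2 ^ m)"
    unfolding harmonic_sum_def by (rule sum.subset_diff[OF _ count(1)]) auto
  also have "(\<Sum>a\<in>?S (2 ^ Suc m) - ?S (2 ^ m). 1 / real (N a)) \<le> (\<Sum>a\<in>?S (2 ^ Suc m) - ?S (2 ^ m). 1 / 2 ^ m)"
  proof (rule sum_mono)
    fix a assume "a \<in> ?S (2 ^ Suc m) - ?S (2 ^ m)"
    then have "real (2 ^ m) \<le> real (N a)" unfolding of_nat_le_iff by auto
    then show "1 / real (N a) \<le> 1 / 2 ^ m" by (intro frac_le) auto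
  qed
  also have "\<dots> \<le> real (card (?S (2 ^ Suc m))) / 2 ^ m"
    using count(1)[of "2 ^ Suc m"] by (simp add: divide_right_mono card_mono)
  also have "\<dots> \<le> real (K * 2 ^ Suc m) / 2 ^ m"
    using count(2)[of "2 ^ Suc m"] by (intro divide_right_mono) (auto simp del: of_nat_mult of_nat_power power_Suc)
  also have "\<dots> = 2 * real K" by simp
  finally show ?case using Suc by (simp add: algebra_simps)
qed

lemma harmonic_sum_ge_if_blocks_ge:
  assumes finite: "\<And>x. x > 0 \<Longrightarrow> finite {a \<in> S. N a \<le> x}"
    and constants: "x\<^sub>0 > 0" "C > 0" "C < M"
    and block: "\<And>j. c \<le> (\<Sum>a\<in>{a \<in> S. x\<^sub>0 * M ^ j \<le> N a \<and> N a \<le> C * (x\<^sub>0 * M ^ j)}. 1 / real (N a))"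
  shows "c * real (Suc j) \<le> harmonic_sum S N (C * (x\<^sub>0 * M ^ j))"
proof (induction j)
  case 0
  have "{a \<in> S. x\<^sub>0 \<le> N a \<and> N a \<le> C * x\<^sub>0} \<subseteq> {a \<in> S. N a \<le> C * x\<^sub>0}" by auto
  then have "(\<Sum>a\<in>{a \<in> S. x\<^sub>0 \<le> N a \<and> N a \<le> C * x\<^sub>0}. 1 / real (N a)) \<le> harmonic_sum S N (C * x\<^sub>0)"
    unfolding harmonic_sum_def using finite constants by (intro sum_mono2) auto
  then show ?case using block[of 0] by simp
next
  case (Suc j)
  let ?x = "x\<^sub>0 * M ^ j" and ?x' = "x\<^sub>0 * M ^ Suc j"
  let ?block = "{a \<in> S. ?x' \<le> N a \<and> N a \<le> C * ?x'}"
  have x_pos: "?x > 0" using constants by simp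
  have "?x \<le> ?x'" using constants by (simp add: Suc_leI)
  have "C * ?x < M * ?x" using constants(3) x_pos by simp
  also have "\<dots> = ?x'" by simp
  finally have gap: "C * ?x < ?x'" .
  have "c * real (Suc (Suc j)) \<le> harmonic_sum S N (C * ?x) + (\<Sum>a\<in>?block. 1 / real (N a))"
    using Suc block[of "Suc j"] by (simp add: distrib_left)
  also have "\<dots> = (\<Sum>a\<in>{a \<in> S. N a \<le> C * ?x} \<union> ?block. 1 / real (N a))"
    unfolding harmonic_sum_def
  proof (rule sum.union_disjoint[symmetric])
    show "finite {a \<in> S. N a \<le> C * ?x}" using finite x_pos constants by simp
    show "finite ?block" by (rule finite_subset[OF _ finite[of "C * ?x'"]]) (use constants in auto)
    have False if "?x' \<le> N a" "N a \<le> C * ?x" for a using that gap by linarith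
    then show "{a \<in> S. N a \<le> C * ?x} \<inter> ?block = {}" by blast
  qed
  also have "\<dots> \<le> harmonic_sum S N (C * ?x')"
    unfolding harmonic_sum_def
  proof (intro sum_mono2 finite)
    have "C * ?x \<le> C * ?x'" using \<open>?x \<le> ?x'\<close> by (rule mult_le_mono2)
    then have "N a \<le> C * ?x'" if "N a \<le> C * ?x" for a using that by (rule order_trans[rotated])
    then show "{a \<in> S. N a \<le> C * ?x} \<union> ?block \<subseteq> {a \<in> S. N a \<le> C * ?x'}" by blast
  qed (use constants in auto)
  finally show ?case .
qed

lemma geometric_le_power_two: "\<exists>e. \<forall>j. (a::nat) * b ^ j \<le> 2 ^ (e * Suc j)"
proof (intro exI allI)
  fix j
  have "n \<le> 2 ^ (a + b)" if "n \<le> a + b" for n :: nat using order_trans[OF that less_imp_le[OF less_exp]] .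
  then have "a * b ^ j \<le> 2 ^ (a + b) * (2 ^ (a + b)) ^ j" by (intro mult_mono power_mono) auto
  then show "a * b ^ j \<le> 2 ^ ((a + b) * Suc j)" by (simp add: power_mult[symmetric] power_add[symmetric])
qed

lemma prod_image_Un_image:
  assumes f: "inj_on f P" "\<And>a. a \<in> P \<Longrightarrow> n' (f a) = n a" and g: "inj_on g P" "\<And>a. a \<in> P \<Longrightarrow> n' (g a) = n a"
    and disjoint: "f ` P \<inter> g ` P = {}" and U: "finite U" "U \<subseteq> P" and V: "finite V" "V \<subseteq> P"
  shows "prod n' (f ` U \<union> g ` V) = prod n U * prod n V"
proof -
  have "prod n' (f ` U \<union> g ` V) = prod n' (f ` U) * prod n' (g ` V)"
    using U V disjoint by (intro prod.union_disjoint) auto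
  also have "prod n' (f ` U) = prod n U"
    using U f(2) by (subst prod.reindex[OF inj_on_subset[OF f(1)]]) (auto intro!: prod.cong)
  also have "prod n' (g ` V) = prod n V"
    using V g(2) by (subst prod.reindex[OF inj_on_subset[OF g(1)]]) (auto intro!: prod.cong)
  finally show ?thesis .
qed

lemma inj_on_image_Un_image:
  assumes f: "inj_on f P" and g: "inj_on g P" and disjoint: "f ` P \<inter> g ` P = {}"
  shows "inj_on (\<lambda>(U, V). f ` U \<union> g ` V) (Pow P \<times> Pow P)"
proof (rule inj_on_inverseI)
  fix u assume "u \<in> Pow P \<times> Pow P"
  then obtain U V where u: "u = (U, V)" "U \<subseteq> P" "V \<subseteq> P" by auto
  let ?Z = "f ` U \<union> g ` V"
  have "f a \<in> ?Z \<longleftrightarrow> a \<in> U" "g a \<in> ?Z \<longleftrightarrow> a \<in> V" if a: "a \<in> P" for a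
    using inj_on_image_mem_iff[OF f a u(2)] inj_on_image_mem_iff[OF g a u(3)] disjoint a u by blast+
  then have "{a \<in> P. f a \<in> ?Z} = U" "{a \<in> P. g a \<in> ?Z} = V" using u(2,3) by blast+
  then show "(\<lambda>Z. ({a \<in> P. f a \<in> Z}, {a \<in> P. g a \<in> Z})) (case u of (U, V) \<Rightarrow> f ` U \<union> g ` V) = u"
    using u(1) by simp
qed

lemma harmonic_sum_Fpow_square_le:
  fixes n :: "'a \<Rightarrow> nat" and n' :: "'b \<Rightarrow> nat"
  assumes f: "inj_on f P" "f ` P \<subseteq> P'" "\<And>a. a \<in> P \<Longrightarrow> n' (f a) = n a"
    and g: "inj_on g P" "g ` P \<subseteq> P'" "\<And>a. a \<in> P \<Longrightarrow> n' (g a) = n a"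
    and disjoint: "f ` P \<inter> g ` P = {}"
    and finite: "finite {U \<in> Fpow P'. prod n' U \<le> x * x}"
  shows "(harmonic_sum (Fpow P) (prod n) x)\<^sup>2 \<le> harmonic_sum (Fpow P') (prod n') (x * x)"
proof -
  let ?S = "{U \<in> Fpow P. prod n U \<le> x}" and ?S' = "{U \<in> Fpow P'. prod n' U \<le> x * x}"
  define h where "h = (\<lambda>(U, V). f ` U \<union> g ` V)"
  have prod_h: "prod n' (h (U, V)) = prod n U * prod n V" if "U \<in> Fpow P" "V \<in> Fpow P" for U V
    using that prod_image_Un_image[OF f(1,3) g(1,3) disjoint] by (simp add: h_def Fpow_def)
  have h_image: "h ` (?S \<times> ?S) \<subseteq> ?S'"
  proof
    fix Z assume "Z \<in> h ` (?S \<times> ?S)"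
    then obtain U V where Z: "Z = h (U, V)" "U \<in> ?S" "V \<in> ?S" by auto
    then have "prod n' Z \<le> x * x" using prod_h by (auto intro: mult_le_mono)
    moreover have "Z \<in> Fpow P'" using Z f(2) g(2) by (auto simp: h_def Fpow_def image_subset_iff subset_iff)
    ultimately show "Z \<in> ?S'" by simp
  qed
  have h_inj: "inj_on h (?S \<times> ?S)"
    unfolding h_def by (rule inj_on_subset[OF inj_on_image_Un_image[OF f(1) g(1) disjoint]]) (auto simp: Fpow_def)
  have "(harmonic_sum (Fpow P) (prod n) x)\<^sup>2 = (\<Sum>(U, V)\<in>?S \<times> ?S. 1 / real (prod n U) * (1 / real (prod n V)))"
    unfolding harmonic_sum_def power2_eq_square sum_product sum.cartesian_product ..
  also have "\<dots> = (\<Sum>u\<in>?S \<times> ?S. 1 / real (prod n' (h u)))"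
    by (rule sum.cong) (auto simp: prod_h simp del: of_nat_prod)
  also have "\<dots> = (\<Sum>Z\<in>h ` (?S \<times> ?S). 1 / real (prod n' Z))"
    by (simp add: sum.reindex[OF h_inj])
  also have "\<dots> \<le> harmonic_sum (Fpow P') (prod n') (x * x)"
    unfolding harmonic_sum_def using h_image finite by (intro sum_mono2) (auto simp del: of_nat_prod)
  finally show ?thesis .
qed

lemma exists_square_greater_if_log_growth:
  fixes H H' :: "nat \<Rightarrow> real"
  assumes lower: "c > 0" "\<And>j. c * real (Suc j) \<le> H (2 ^ (e * Suc j))"
    and upper: "C \<ge> 0" "\<And>m. H' (2 ^ m) \<le> C * (2 * real m + 1)"
  shows "\<exists>x>0. H' (x * x) < (H x)\<^sup>2"
proof (rule ccontr)
  assume neg: "\<not> ?thesis"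
  define K where "K = C * (4 * real e + 1)"
  have bound: "c\<^sup>2 * real (Suc j) \<le> K" for j
  proof -
    let ?x = "2 ^ (e * Suc j) :: nat"
    have "(c * real (Suc j))\<^sup>2 \<le> (H ?x)\<^sup>2" using lower(2)[of j] lower(1) by (intro power_mono) auto
    also have "\<dots> \<le> H' (?x * ?x)" using neg by (meson not_less zero_less_numeral zero_less_power)
    also have "\<dots> = H' (2 ^ (2 * (e * Suc j)))" by (simp only: mult_2 power_add)
    also have "\<dots> \<le> C * (2 * real (2 * (e * Suc j)) + 1)" by (rule upper(2))
    also have "\<dots> \<le> C * ((4 * real e + 1) * real (Suc j))"
      using upper(1) by (intro mult_left_mono) (auto simp: algebra_simps)
    finally have "c\<^sup>2 * real (Suc j) * real (Suc j) \<le> K * real (Suc j)"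
      by (simp only: K_def power_mult_distrib power2_eq_square mult_ac)
    then show ?thesis by (rule mult_right_le_imp_le) simp
  qed
  obtain n where "K / c\<^sup>2 < real n" using reals_Archimedean2 by blast
  then have "K < c\<^sup>2 * real n" using lower(1) by (simp add: field_simps)
  also have "\<dots> \<le> c\<^sup>2 * real (Suc n)" by (intro mult_left_mono) auto
  finally show False using bound[of n] by linarith
qed

lemma sum_inverse_squares_le:
  assumes "a > 0" shows "(\<Sum>n\<in>{a<..b}. 1 / (real n)\<^sup>2) \<le> 1 / real a"
proof (cases "a \<le> b")
  case True
  then have "(\<Sum>n\<in>{a<..b}. 1 / (real n)\<^sup>2) \<le> 1 / real a - 1 / real b"
  proof (induction b rule: dec_induct)
    case (step n)
    have n: "n > 0" "{a<..Suc n} = insert (Suc n) {a<..n}" using step assms by auto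
    have "1 / (real (Suc n))\<^sup>2 \<le> 1 / (real n * real (Suc n))"
      using n unfolding power2_eq_square by (intro divide_left_mono mult_right_mono mult_pos_pos) auto
    also have "\<dots> = 1 / real n - 1 / real (Suc n)" using n by (simp add: field_simps)
    finally show ?case using step n(2) by simp
  qed (use assms in auto)
  also have "\<dots> \<le> 1 / real a" by simp
  finally show ?thesis .
qed simp

lemma card_separated_box_le:
  fixes L :: "(nat \<Rightarrow> int) set"
  assumes L: "L \<subseteq> {..<d} \<rightarrow>\<^sub>E {0..<int Y}" and t: "t > 0"
    and separated: "\<And>c c'. c \<in> L \<Longrightarrow> c' \<in> L \<Longrightarrow> (\<And>i. i < d \<Longrightarrow> \<bar>c i - c' i\<bar> \<le> int (t - 1)) \<Longrightarrow> c = c'"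
  shows "card L \<le> (Y div t + 1) ^ d"
proof -
  define cell where "cell c = (\<lambda>i\<in>{..<d}. c i div int t)" for c :: "nat \<Rightarrow> int"
  have "inj_on cell L"
  proof (rule inj_onI)
    fix c c' assume c: "c \<in> L" "c' \<in> L" "cell c = cell c'"
    show "c = c'"
    proof (rule separated[OF c(1,2)])
      fix i assume i: "i < d"
      have eq: "c i div int t = c' i div int t" using fun_cong[OF c(3), of i] i by (simp add: cell_def)
      have "c i = int t * (c i div int t) + c i mod int t" "c' i = int t * (c' i div int t) + c' i mod int t"
        by simp_all
      moreover have "0 \<le> c i mod int t" "c i mod int t < int t" "0 \<le> c' i mod int t" "c' i mod int t < int t"
        using t by auto
      ultimately have "\<bar>c i - c' i\<bar> < int t" unfolding eq by linarith
      then show "\<bar>c i - c' i\<bar> \<le> int (t - 1)" using t by (simp add: of_nat_diff)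
    qed
  qed
  moreover have "cell ` L \<subseteq> {..<d} \<rightarrow>\<^sub>E {0..int (Y div t)}"
  proof (rule image_subsetI)
    fix c assume c: "c \<in> L"
    have "0 \<le> c i div int t \<and> c i div int t \<le> int (Y div t)" if i: "i < d" for i
    proof -
      have "c i \<in> {0..<int Y}" using L c i by (auto simp: PiE_iff subset_iff)
      then show ?thesis using t by (simp add: zdiv_int pos_imp_zdiv_nonneg_iff zdiv_mono1)
    qed
    then show "cell c \<in> {..<d} \<rightarrow>\<^sub>E {0..int (Y div t)}" unfolding cell_def by auto
  qed
  moreover have "card ({..<d} \<rightarrow>\<^sub>E {0..int (Y div t)}) = (Y div t + 1) ^ d"
    by (simp add: card_PiE nat_add_distrib del: of_nat_div zdiv_int)
  moreover have "finite ({..<d} \<rightarrow>\<^sub>E {0..int (Y div t)})" by (intro finite_PiE) auto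
  ultimately show ?thesis by (metis card_inj_on_le)
qed

lemma prod_prime_powers_dvd:
  fixes n :: int and k :: "nat \<Rightarrow> nat"
  assumes "finite P" "\<And>p. p \<in> P \<Longrightarrow> prime p" "\<And>p. p \<in> P \<Longrightarrow> int p ^ k p dvd n"
  shows "(\<Prod>p\<in>P. int p ^ k p) dvd n"
  using assms
proof (induction P rule: finite_induct)
  case (insert q P)
  have "coprime (int q ^ k q) (\<Prod>p\<in>P. int p ^ k p)"
  proof (rule prod_coprime_right)
    fix p assume p: "p \<in> P"
    then have "coprime q p" using insert by (intro primes_coprime) auto
    then show "coprime (int q ^ k q) (int p ^ k p)" by simp
  qed
  then show ?case using insert by (auto intro: divides_mult)
qed auto

lemma prod_fst_dvd:
  fixes n :: int and U :: "(nat \<times> 'a) set"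
  assumes U: "finite U" and prime: "\<And>p. p \<in> fst ` U \<Longrightarrow> prime p"
    and dvd: "\<And>p. p \<in> fst ` U \<Longrightarrow> int p ^ card {\<xi>. (p, \<xi>) \<in> U} dvd n"
  shows "int (prod fst U) dvd n"
proof -
  have fin: "finite {\<xi>. (p, \<xi>) \<in> U}" for p
    by (rule finite_subset[of _ "snd ` U"]) (use U in force)+
  have "U = (SIGMA p:fst ` U. {\<xi>. (p, \<xi>) \<in> U})" by force
  then have "prod fst U = (\<Prod>(p, \<xi>)\<in>(SIGMA p:fst ` U. {\<xi>. (p, \<xi>) \<in> U}). p)"
    by (auto intro: prod.cong)
  also have "\<dots> = (\<Prod>p\<in>fst ` U. p ^ card {\<xi>. (p, \<xi>) \<in> U})"
    using U fin by (subst prod.Sigma[symmetric]) auto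
  finally show ?thesis using prod_prime_powers_dvd[OF finite_imageI[OF U] prime dvd] by simp
qed

section \<open>Integer polynomials in an algebraic integer\<close>

locale normed_galois_ring = galois_ring A G
  for A :: "'a::real_normed_field set" and G :: "('a \<Rightarrow> 'a) set"

locale galois_element = normed_galois_ring +
  fixes \<eta> :: 'a
  assumes \<eta>_mem: "\<eta> \<in> A"
begin

definition deg :: nat where
  "deg = card (conjugates \<eta>)"

definition eval_at :: "(nat \<Rightarrow> int) \<Rightarrow> 'a \<Rightarrow> 'a" where
  "eval_at b \<xi> = (\<Sum>i<deg. of_int (b i) * \<xi> ^ i)"

definition coeff_norm :: "(nat \<Rightarrow> int) \<Rightarrow> int" where
  "coeff_norm b = the_inv of_int (\<Prod>\<xi>\<in>conjugates \<eta>. eval_at b \<xi>)"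

definition size_bound :: nat where
  "size_bound = nat \<lceil>1 + (\<Sum>\<xi>\<in>conjugates \<eta>. \<Sum>i<deg. norm \<xi> ^ i)\<rceil>"

definition norm_bound :: nat where
  "norm_bound = size_bound ^ deg"

lemma conjugate_mem: "\<xi> \<in> conjugates \<eta> \<Longrightarrow> \<xi> \<in> A"
  using conjugates_mem[OF \<eta>_mem] .

lemma deg_pos: "deg > 0"
  unfolding deg_def by (rule perm.card_orbit_pos) simp

lemma eval_at_mem: "\<xi> \<in> conjugates \<eta> \<Longrightarrow> eval_at b \<xi> \<in> A"
  unfolding eval_at_def by (intro sum_mem mult_mem of_int_mem power_mem conjugate_mem)

lemma act_eval_at:
  assumes g: "g \<in> G" and \<xi>: "\<xi> \<in> conjugates \<eta>" shows "g (eval_at b \<xi>) = eval_at b (g \<xi>)"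
proof -
  have \<xi>A: "\<xi> \<in> A" by (rule conjugate_mem[OF \<xi>])
  have "g (eval_at b \<xi>) = (\<Sum>i<deg. g (of_int (b i) * \<xi> ^ i))"
    unfolding eval_at_def by (rule act_sum[OF g]) (intro mem_simps \<xi>A)
  also have "\<dots> = eval_at b (g \<xi>)"
    unfolding eval_at_def by (simp add: act_mult[OF g] act_of_int[OF g] act_power[OF g \<xi>A] mem_simps \<xi>A)
  finally show ?thesis .
qed

lemma eval_at_diff: "eval_at (\<lambda>i. b i - c i) \<xi> = eval_at b \<xi> - eval_at c \<xi>"
  by (simp add: eval_at_def left_diff_distrib sum_subtractf)

lemma eval_at_scale: "eval_at (\<lambda>i. k * b i) \<xi> = of_int k * eval_at b \<xi>"
  by (simp add: eval_at_def sum_distrib_left mult.assoc)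

lemma eval_at_cong: "(\<And>i. i < deg \<Longrightarrow> b i = c i) \<Longrightarrow> eval_at b \<xi> = eval_at c \<xi>"
  by (simp add: eval_at_def)

lemma of_int_coeff_norm: "of_int (coeff_norm b) = (\<Prod>\<xi>\<in>conjugates \<eta>. eval_at b \<xi>)"
  unfolding coeff_norm_def
proof (intro of_int_the_inv fixed_in_Ints)
  show "(\<Prod>\<xi>\<in>conjugates \<eta>. eval_at b \<xi>) \<in> A" by (intro prod_mem eval_at_mem)
  fix g assume g: "g \<in> G"
  have "g (\<Prod>\<xi>\<in>conjugates \<eta>. eval_at b \<xi>) = (\<Prod>\<xi>\<in>conjugates \<eta>. eval_at b (g \<xi>))"
    using g by (simp add: act_prod eval_at_mem act_eval_at)
  also have "\<dots> = (\<Prod>\<xi>\<in>conjugates \<eta>. eval_at b \<xi>)"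
    by (rule prod.reindex_bij_betw[OF bij_betw_conjugates[OF g]])
  finally show "g (\<Prod>\<xi>\<in>conjugates \<eta>. eval_at b \<xi>) = (\<Prod>\<xi>\<in>conjugates \<eta>. eval_at b \<xi>)" .
qed

lemma abs_coeff_norm: "real_of_int \<bar>coeff_norm b\<bar> = (\<Prod>\<xi>\<in>conjugates \<eta>. norm (eval_at b \<xi>))"
  using arg_cong[OF of_int_coeff_norm[of b], of norm] by (simp add: prod_norm)

lemma coeff_norm_nonzero:
  assumes i: "i < deg" "b i \<noteq> 0" shows "coeff_norm b \<noteq> 0"
proof
  assume "coeff_norm b = 0"
  then obtain \<xi> where \<xi>: "\<xi> \<in> conjugates \<eta>" "eval_at b \<xi> = 0"
    using of_int_coeff_norm[of b] finite_conjugates by auto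
  have zero: "eval_at b \<xi>' = 0" if \<xi>': "\<xi>' \<in> conjugates \<eta>" for \<xi>'
  proof -
    obtain g where "g \<in> G" "g \<xi> = \<xi>'" using perm.orbit_transitive[of \<eta> \<xi> \<xi>'] \<xi>(1) \<xi>' by auto
    then show ?thesis using act_eval_at[of g \<xi> b] \<xi> act_zero[of g] by auto
  qed
  define q :: "'a poly" where "q = (\<Sum>i<deg. monom (of_int (b i)) i)"
  have poly_q: "poly q x = eval_at b x" for x by (simp add: q_def eval_at_def poly_sum poly_monom)
  have "coeff q i = of_int (b i)" using i by (simp add: q_def coeff_sum)
  then have q0: "q \<noteq> 0" using i by auto
  have "degree q < deg"
    unfolding q_def using deg_pos by (intro degree_sum_less) (auto intro: le_less_trans[OF degree_monom_le])
  moreover have "deg \<le> card {x. poly q x = 0}"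
    unfolding deg_def using q0 zero poly_q by (intro card_mono poly_roots_finite) auto
  ultimately show False using card_poly_roots_bound[OF q0] by simp
qed

lemma size_bound_pos: "size_bound > 0"
  and sum_norm_power_le: "\<xi> \<in> conjugates \<eta> \<Longrightarrow> (\<Sum>i<deg. norm \<xi> ^ i) \<le> real size_bound"
proof -
  have nonneg: "(\<Sum>\<xi>\<in>conjugates \<eta>. \<Sum>i<deg. norm \<xi> ^ i) \<ge> 0" by (intro sum_nonneg) auto
  have le: "1 + (\<Sum>\<xi>\<in>conjugates \<eta>. \<Sum>i<deg. norm \<xi> ^ i) \<le> real size_bound" unfolding size_bound_def by linarith
  then have "real size_bound > 0" using nonneg by linarith
  then show "size_bound > 0" by simp
  assume "\<xi> \<in> conjugates \<eta>"
  then have "(\<Sum>i<deg. norm \<xi> ^ i) \<le> (\<Sum>\<xi>\<in>conjugates \<eta>. \<Sum>i<deg. norm \<xi> ^ i)"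
    using finite_conjugates by (intro member_le_sum) (auto intro!: sum_nonneg)
  then show "(\<Sum>i<deg. norm \<xi> ^ i) \<le> real size_bound" using le by simp
qed

lemma norm_bound_pos: "norm_bound > 0"
  using size_bound_pos by (simp add: norm_bound_def)

lemma norm_eval_at_le:
  assumes \<xi>: "\<xi> \<in> conjugates \<eta>" and b: "\<And>i. i < deg \<Longrightarrow> \<bar>b i\<bar> \<le> int t"
  shows "norm (eval_at b \<xi>) \<le> real t * real size_bound"
proof -
  have "norm (eval_at b \<xi>) \<le> (\<Sum>i<deg. norm (of_int (b i) * \<xi> ^ i))" unfolding eval_at_def by (rule norm_sum)
  also have "\<dots> \<le> (\<Sum>i<deg. real t * norm \<xi> ^ i)"
  proof (rule sum_mono)
    fix i assume "i \<in> {..<deg}"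
    then have "\<bar>real_of_int (b i)\<bar> \<le> real t" using b[of i] by auto
    then show "norm (of_int (b i) * \<xi> ^ i) \<le> real t * norm \<xi> ^ i"
      by (simp add: norm_mult norm_power mult_right_mono)
  qed
  also have "\<dots> = real t * (\<Sum>i<deg. norm \<xi> ^ i)" by (simp add: sum_distrib_left)
  also have "\<dots> \<le> real t * real size_bound" using sum_norm_power_le[OF \<xi>] by (intro mult_left_mono) auto
  finally show ?thesis .
qed

lemma abs_coeff_norm_le:
  assumes "\<And>i. i < deg \<Longrightarrow> \<bar>b i\<bar> \<le> int t" shows "nat \<bar>coeff_norm b\<bar> \<le> norm_bound * t ^ deg"
proof -
  have "real_of_int \<bar>coeff_norm b\<bar> \<le> (\<Prod>\<xi>\<in>conjugates \<eta>. real t * real size_bound)"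
    unfolding abs_coeff_norm using assms by (intro prod_mono conjI norm_eval_at_le) auto
  also have "\<dots> = real_of_int (int (norm_bound * t ^ deg))"
    by (simp add: norm_bound_def deg_def[symmetric] power_mult_distrib mult.commute)
  finally show ?thesis unfolding of_int_le_iff by linarith
qed

lemma prime_dvd_coeff_norm:
  assumes p: "prime p" "int p dvd coeff_norm b" shows "\<exists>\<xi>\<in>conjugates \<eta>. eval_at b \<xi> \<in> prime_over p"
proof -
  have "of_int (coeff_norm b) \<in> prime_over p" using prime_ideal_of_int_iff[OF prime_over[OF p(1)] p(1)] p(2) by simp
  then show ?thesis
    unfolding of_int_coeff_norm by (intro prime_ideal_prodD[OF prime_over(1)[OF p(1)]] eval_at_mem)
qed

lemma power_card_dvd_coeff_norm:
  assumes p: "unramified_prime p" and J: "J \<subseteq> conjugates \<eta>" "\<And>\<xi>. \<xi> \<in> J \<Longrightarrow> eval_at b \<xi> \<in> prime_over p"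
  shows "int p ^ card J dvd coeff_norm b"
proof -
  have prime: "prime p" by (rule unramified_primeD[OF p])
  have "(\<Prod>\<xi>\<in>conjugates \<eta>. eval_at b \<xi>) \<in> local_multiples (prime_over p) (p ^ card J)"
    using J by (intro prod_mem_local_multiples p prime_over[OF prime] finite_conjugates eval_at_mem)
  then show ?thesis
    unfolding of_int_coeff_norm[symmetric] by (rule dvd_if_of_int_local_multiples[OF prime prime_over[OF prime]])
qed

text \<open>Two zeros of \<open>b\<close> among the conjugates modulo the prime over \<open>p\<close>, counted with multiplicity.\<close>

definition double_zero :: "nat \<Rightarrow> 'a \<Rightarrow> 'a \<Rightarrow> (nat \<Rightarrow> int) \<Rightarrow> bool" where
  "double_zero p \<xi> \<xi>' b \<longleftrightarrow>
    (if \<xi> = \<xi>' then eval_at b \<xi> \<in> local_multiples (prime_over p) (p\<^sup>2)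
     else eval_at b \<xi> \<in> prime_over p \<and> eval_at b \<xi>' \<in> prime_over p)"

lemma square_dvd_coeff_norm_if_double_zero:
  assumes p: "unramified_prime p" and \<xi>: "\<xi> \<in> conjugates \<eta>" "\<xi>' \<in> conjugates \<eta>" and b: "double_zero p \<xi> \<xi>' b"
  shows "int p ^ 2 dvd coeff_norm b"
proof (cases "\<xi> = \<xi>'")
  case True
  have prime: "prime p" by (rule unramified_primeD[OF p])
  have "(\<Prod>\<zeta>\<in>conjugates \<eta>. eval_at b \<zeta>) = (\<Prod>\<zeta>\<in>conjugates \<eta> - {\<xi>}. eval_at b \<zeta>) * eval_at b \<xi>"
    using prod.remove[OF finite_conjugates \<xi>(1)] by (simp add: mult.commute)
  also have "\<dots> \<in> local_multiples (prime_over p) (p\<^sup>2)"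
    using True b by (intro local_multiples_mult_left prod_mem eval_at_mem) (auto simp: double_zero_def)
  finally show ?thesis
    unfolding of_int_coeff_norm[symmetric] by (rule dvd_if_of_int_local_multiples[OF prime prime_over[OF prime]])
next
  case False
  then have "int p ^ card {\<xi>, \<xi>'} dvd coeff_norm b"
    using \<xi> b by (intro power_card_dvd_coeff_norm[OF p]) (auto simp: double_zero_def)
  then show ?thesis using False by (simp add: power2_eq_square)
qed

lemma double_zero_if_square_dvd_coeff_norm:
  assumes p: "prime p" and dvd: "int p ^ 2 dvd coeff_norm b"
  shows "\<exists>\<xi>\<in>conjugates \<eta>. \<exists>\<xi>'\<in>conjugates \<eta>. double_zero p \<xi> \<xi>' b"
proof -
  have "int p dvd coeff_norm b" using dvd by (metis dvd_trans dvd_triv_left power2_eq_square)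
  then obtain \<xi> where \<xi>: "\<xi> \<in> conjugates \<eta>" "eval_at b \<xi> \<in> prime_over p" using prime_dvd_coeff_norm[OF p] by blast
  show ?thesis
  proof (cases "\<exists>\<xi>'\<in>conjugates \<eta> - {\<xi>}. eval_at b \<xi>' \<in> prime_over p")
    case True
    then show ?thesis using \<xi> unfolding double_zero_def by (metis DiffE singletonI)
  next
    case False
    define s where "s = (\<Prod>\<zeta>\<in>conjugates \<eta> - {\<xi>}. eval_at b \<zeta>)"
    have "s \<in> A" unfolding s_def by (intro prod_mem eval_at_mem) auto
    moreover have "s \<notin> prime_over p"
    proof
      assume "s \<in> prime_over p"
      then have "\<exists>\<xi>'\<in>conjugates \<eta> - {\<xi>}. eval_at b \<xi>' \<in> prime_over p"
        unfolding s_def by (rule prime_ideal_prodD[OF prime_over(1)[OF p], rotated]) (intro eval_at_mem, auto)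
      then show False using False by contradiction
    qed
    moreover have "s * eval_at b \<xi> = of_int (coeff_norm b)"
      unfolding of_int_coeff_norm s_def
      using prod.remove[OF finite_conjugates \<xi>(1), of "eval_at b"] by (simp add: mult.commute)
    moreover have "of_int (coeff_norm b) \<in> multiples (p\<^sup>2)" using dvd by (intro of_int_multiples) simp
    ultimately have "double_zero p \<xi> \<xi> b"
      using eval_at_mem[OF \<xi>(1)] by (auto simp: double_zero_def local_multiples_def intro!: bexI[of _ s])
    then show ?thesis using \<xi>(1) by blast
  qed
qed

lemma double_zero_diff:
  assumes p: "prime p" and "double_zero p \<xi> \<xi>' b" "double_zero p \<xi> \<xi>' c" shows "double_zero p \<xi> \<xi>' (\<lambda>i. b i - c i)"
  using assms local_multiples_diff[OF prime_over(1)[OF p]] ideal_diff[OF prime_over_ideal[OF p]]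
  by (auto simp: double_zero_def eval_at_diff split: if_splits)

lemma double_zero_cancel:
  assumes p: "prime p" "\<not> int p dvd k" and \<xi>: "\<xi> \<in> conjugates \<eta>" "\<xi>' \<in> conjugates \<eta>"
    and b: "double_zero p \<xi> \<xi>' (\<lambda>i. k * b i)"
  shows "double_zero p \<xi> \<xi>' b"
proof -
  have k: "of_int k \<in> A - prime_over p"
    using prime_ideal_of_int_iff[OF prime_over[OF p(1)] p(1)] p(2) of_int_mem by simp
  then show ?thesis
    using b prime_ideal_multD[OF prime_over(1)[OF p(1)], of "of_int k"] eval_at_mem[OF \<xi>(1)] eval_at_mem[OF \<xi>(2)]
      local_multiples_cancel[OF prime_over(1)[OF p(1)] k]
    by (auto simp: double_zero_def eval_at_scale split: if_splits)
qed

end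

section \<open>Products of degree-one primes\<close>

lemma Suc_power_le: "(u + 1) ^ d \<le> 2 ^ d * (u ^ d + (1::nat))"
proof (cases "u = 0")
  case False
  then have "(u + 1) ^ d \<le> (2 * u) ^ d" by (intro power_mono) auto
  then show ?thesis by (simp add: power_mult_distrib)
qed (simp add: trans_le_add1)

locale galois_element_bound = galois_element +
  fixes B :: nat
  assumes discriminant_le: "nat \<bar>discriminant\<bar> \<le> B"
    and norm_bound_le: "4 * deg\<^sup>2 * 2 ^ deg * norm_bound \<le> B"
begin

text \<open>A pair \<open>(p, \<xi>)\<close> stands for the degree-one prime above \<open>p\<close> of the field generated by \<open>\<eta>\<close> that is the
  preimage of \<open>prime_over p\<close> under \<open>\<eta> \<mapsto> \<xi>\<close>; a finite set of pairs stands for a squarefree ideal.\<close>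

definition degree_one_primes :: "(nat \<times> 'a) set" where
  "degree_one_primes = {(p, \<xi>). prime p \<and> B < p \<and> \<xi> \<in> conjugates \<eta> \<and> frobenius p \<xi> = \<xi>}"

definition factors :: "(nat \<Rightarrow> int) \<Rightarrow> (nat \<times> 'a) set" where
  "factors b = {(p, \<xi>) \<in> degree_one_primes. eval_at b \<xi> \<in> prime_over p}"

lemma unramified_prime_if_large: "prime p \<Longrightarrow> B < p \<Longrightarrow> unramified_prime p"
  using discriminant_le by (intro unramified_primeI) auto

lemma norm_bound_less: "norm_bound < B"
proof -
  have "2 \<le> 4 * deg\<^sup>2 * 2 ^ deg" using deg_pos by (simp add: Suc_le_eq)
  then have "2 * norm_bound \<le> 4 * deg\<^sup>2 * 2 ^ deg * norm_bound" by (rule mult_right_mono) simp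
  then show ?thesis using norm_bound_pos norm_bound_le by linarith
qed

lemma factors_subset: "factors b \<subseteq> degree_one_primes"
  by (auto simp: factors_def)

lemma prod_fst_pos: "U \<subseteq> degree_one_primes \<Longrightarrow> prod fst U > 0"
  by (intro prod_pos) (auto simp: degree_one_primes_def prime_gt_0_nat)

lemma prod_fst_dvd_coeff_norm:
  assumes U: "finite U" "U \<subseteq> factors b" shows "prod fst U dvd nat \<bar>coeff_norm b\<bar>"
  unfolding dvd_nat_abs_iff
proof (rule prod_fst_dvd[OF U(1)])
  fix p assume "p \<in> fst ` U"
  then have p: "prime p" "B < p" using U(2) by (auto simp: factors_def degree_one_primes_def)
  then show "prime p" by simp
  show "int p ^ card {\<xi>. (p, \<xi>) \<in> U} dvd coeff_norm b"
    using U(2)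
    by (intro power_card_dvd_coeff_norm unramified_prime_if_large p) (auto simp: factors_def degree_one_primes_def)
qed

lemma prod_fst_le_coeff_norm:
  "finite U \<Longrightarrow> U \<subseteq> factors b \<Longrightarrow> coeff_norm b \<noteq> 0 \<Longrightarrow> prod fst U \<le> nat \<bar>coeff_norm b\<bar>"
  by (intro dvd_imp_le prod_fst_dvd_coeff_norm) auto

lemma finite_factors: assumes "coeff_norm b \<noteq> 0" shows "finite (factors b)"
proof (rule finite_subset)
  show "factors b \<subseteq> {..nat \<bar>coeff_norm b\<bar>} \<times> conjugates \<eta>"
  proof
    fix u assume u: "u \<in> factors b"
    then have "fst u \<le> nat \<bar>coeff_norm b\<bar>" using prod_fst_le_coeff_norm[of "{u}" b] assms by simp
    then show "u \<in> {..nat \<bar>coeff_norm b\<bar>} \<times> conjugates \<eta>"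
      using u by (cases u) (auto simp: factors_def degree_one_primes_def)
  qed
qed (simp add: finite_conjugates)

lemma exists_residue:
  assumes u: "u \<in> degree_one_primes"
  shows "\<exists>r. r < fst u \<and> eval_at b (snd u) - of_nat r \<in> prime_over (fst u)"
proof -
  obtain p \<xi> where p: "u = (p, \<xi>)" "prime p" "B < p" and \<xi>: "\<xi> \<in> conjugates \<eta>" "frobenius p \<xi> = \<xi>"
    using u by (auto simp: degree_one_primes_def)
  note unramified = unramified_prime_if_large[OF p(2,3)]
  have "eval_at b \<xi> ^ p - eval_at b \<xi> \<in> prime_over p"
    using frobenius(2)[OF unramified eval_at_mem[OF \<xi>(1)], of b] act_eval_at[OF frobenius(1)[OF unramified] \<xi>(1)] \<xi>(2)
    by simp
  then show ?thesis using exists_of_nat_residue[OF p(2) prime_over[OF p(2)] eval_at_mem[OF \<xi>(1)]] p(1) by auto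
qed

subsection \<open>Upper bound for their number\<close>

lemma exists_small_multiple:
  assumes U: "finite U" "U \<subseteq> degree_one_primes" and s: "prod fst U < (s + 1) ^ deg"
  shows "\<exists>b\<in>{..<deg} \<rightarrow>\<^sub>E {- int s..int s}. coeff_norm b \<noteq> 0 \<and> U \<subseteq> factors b"
proof -
  let ?box = "{..<deg} \<rightarrow>\<^sub>E {0..int s}"
  define residues where
    "residues b = (\<lambda>u\<in>U. SOME r. r < fst u \<and> eval_at b (snd u) - of_nat r \<in> prime_over (fst u))" for b
  have residues: "residues b u < fst u" "eval_at b (snd u) - of_nat (residues b u) \<in> prime_over (fst u)"
    if "u \<in> U" for b u
    using someI_ex[OF exists_residue[of u b]] that U(2) by (auto simp: residues_def)
  have "residues ` ?box \<subseteq> (\<Pi>\<^sub>E u\<in>U. {..<fst u})" using residues(1) by (auto simp: residues_def)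
  then have "card (residues ` ?box) \<le> card (\<Pi>\<^sub>E u\<in>U. {..<fst u})" using U(1) by (intro card_mono finite_PiE) auto
  also have "\<dots> < card ?box" using s U(1) by (simp add: card_PiE nat_add_distrib)
  finally obtain b b' where b: "b \<in> ?box" "b' \<in> ?box" "b \<noteq> b'" "residues b = residues b'"
    using pigeonhole[of residues ?box] by (auto simp: inj_on_def)
  define c where "c = (\<lambda>i\<in>{..<deg}. b i - b' i)"
  have "b i - b' i \<in> {- int s..int s}" if "i < deg" for i
  proof -
    have "b i \<in> {0..int s}" "b' i \<in> {0..int s}" using PiE_mem[OF b(1)] PiE_mem[OF b(2)] that by auto
    then show ?thesis by auto
  qed
  then have "c \<in> {..<deg} \<rightarrow>\<^sub>E {- int s..int s}" unfolding c_def by (intro restrict_PiE_iff[THEN iffD2]) auto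
  moreover obtain i where "i < deg" "b i \<noteq> b' i" using b by (metis PiE_ext lessThan_iff)
  then have "coeff_norm c \<noteq> 0" by (intro coeff_norm_nonzero[of i]) (auto simp: c_def)
  moreover have "U \<subseteq> factors c"
  proof
    fix u assume u: "u \<in> U"
    then have "prime (fst u)" using U(2) by (auto simp: degree_one_primes_def)
    then have "eval_at b (snd u) - eval_at b' (snd u) \<in> prime_over (fst u)"
      using ideal_diff[OF prime_over_ideal residues(2)[OF u, of b] residues(2)[OF u, of b']] b(4) by simp
    also have "eval_at b (snd u) - eval_at b' (snd u) = eval_at c (snd u)"
      unfolding eval_at_diff[symmetric] by (rule eval_at_cong) (simp add: c_def)
    finally show "u \<in> factors c" using u U(2) by (cases u) (auto simp: factors_def)
  qed
  ultimately show ?thesis by blast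
qed

lemma eq_if_prod_fst_le:
  assumes "U \<subseteq> V" and V: "finite V" "V \<subseteq> degree_one_primes" and le: "prod fst V \<le> norm_bound * prod fst U"
  shows "U = V"
proof (rule ccontr)
  assume "U \<noteq> V"
  then obtain u where u: "u \<in> V - U" using assms(1) by blast
  have "fst u dvd prod fst (V - U)" using u V(1) by (intro dvd_prodI) auto
  then have "fst u \<le> prod fst (V - U)" using V(2) by (intro dvd_imp_le prod_fst_pos) auto
  moreover have "B < fst u" using u V(2) by (auto simp: degree_one_primes_def)
  ultimately have "norm_bound < prod fst (V - U)" using norm_bound_less by linarith
  moreover have "prod fst U > 0" using assms(1) V(2) by (intro prod_fst_pos) auto
  ultimately show False using le prod.subset_diff[OF assms(1) V(1), of fst] by simp
qed

lemma exists_factors_eq: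
  assumes U: "U \<in> Fpow degree_one_primes" "prod fst U \<le> x"
  defines "r \<equiv> int (nth_root_nat deg x)"
  shows "\<exists>b\<in>{..<deg} \<rightarrow>\<^sub>E {- r..r}. factors b = U"
proof -
  define s where "s = nth_root_nat deg (prod fst U)"
  have s: "prod fst U < (s + 1) ^ deg" "s ^ deg \<le> prod fst U"
    using nth_root_nat_ge[OF deg_pos, of "s + 1" "prod fst U"] nth_root_nat_power_le[OF deg_pos]
    by (auto simp: s_def not_le[symmetric])
  obtain b where b: "b \<in> {..<deg} \<rightarrow>\<^sub>E {- int s..int s}" "coeff_norm b \<noteq> 0" "U \<subseteq> factors b"
    using exists_small_multiple[OF _ _ s(1)] U(1) by (auto simp: Fpow_def)
  have "prod fst (factors b) \<le> nat \<bar>coeff_norm b\<bar>" by (intro prod_fst_le_coeff_norm finite_factors b(2) subset_refl)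
  also have "\<dots> \<le> norm_bound * s ^ deg"
  proof (rule abs_coeff_norm_le)
    show "\<bar>b i\<bar> \<le> int s" if "i < deg" for i using PiE_mem[OF b(1), of i] that by auto
  qed
  also have "\<dots> \<le> norm_bound * prod fst U" using s(2) by simp
  finally have "U = factors b" by (rule eq_if_prod_fst_le[OF b(3) finite_factors[OF b(2)] factors_subset])
  moreover have "s \<le> nth_root_nat deg x" unfolding s_def using U(2) by (intro nth_root_nat_mono)
  then have "{- int s..int s} \<subseteq> {- r..r}" by (auto simp: r_def)
  then have "b \<in> {..<deg} \<rightarrow>\<^sub>E {- r..r}" using b(1) PiE_mono[of "{..<deg}" "\<lambda>_. {- int s..int s}"] by blast
  ultimately show ?thesis by blast
qed

lemma card_small_products_le:
  assumes "x > 0"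
  shows "finite {U \<in> Fpow degree_one_primes. prod fst U \<le> x}"
    and "card {U \<in> Fpow degree_one_primes. prod fst U \<le> x} \<le> 3 ^ deg * x"
proof -
  let ?S = "{U \<in> Fpow degree_one_primes. prod fst U \<le> x}"
  define s where "s = nth_root_nat deg x"
  let ?box = "{..<deg} \<rightarrow>\<^sub>E {- int s..int s}"
  have subset: "?S \<subseteq> factors ` ?box" using exists_factors_eq unfolding s_def by blast
  have finite_box: "finite ?box" by (intro finite_PiE) auto
  show "finite ?S" using subset finite_box by (rule finite_subset[OF _ finite_imageI])
  have "s \<ge> 1" using nth_root_nat_mono[of 1 x deg] assms nth_root_nat_1[OF deg_pos] by (simp add: s_def)
  have "card ?S \<le> card ?box"
    using subset finite_box by (meson card_image_le card_mono finite_imageI order_trans)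
  also have "\<dots> = (2 * s + 1) ^ deg"
    using nat_add_distrib[of "2 * int s" 1] by (simp add: card_PiE nat_mult_distrib)
  also have "\<dots> \<le> (3 * s) ^ deg" using \<open>s \<ge> 1\<close> by (intro power_mono) auto
  also have "\<dots> \<le> 3 ^ deg * x" using nth_root_nat_power_le[OF deg_pos, of x] by (simp add: power_mult_distrib s_def)
  finally show "card ?S \<le> 3 ^ deg * x" .
qed

lemma harmonic_sum_upper: "harmonic_sum (Fpow degree_one_primes) (prod fst) (2 ^ m) \<le> 3 ^ deg * (2 * real m + 1)"
proof -
  have "prod fst U > 0" if "U \<in> Fpow degree_one_primes" for U using that by (intro prod_fst_pos) (simp add: Fpow_def)
  then have "harmonic_sum (Fpow degree_one_primes) (prod fst) (2 ^ m) \<le> real (3 ^ deg) * (2 * real m + 1)"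
    using card_small_products_le by (rule harmonic_sum_power_two_le)
  then show ?thesis by simp
qed

subsection \<open>Lower bound for their number\<close>

definition box :: "nat \<Rightarrow> (nat \<Rightarrow> int) set" where
  "box Y = {..<deg} \<rightarrow>\<^sub>E {0..<int Y}"

definition modulus :: nat where
  "modulus = fact B"

definition norm_ratio :: nat where
  "norm_ratio = (1 + 2 * Suc size_bound) ^ deg"

text \<open>The constant term of \<open>shift Y c\<close> dominates, which bounds the norm from both sides, and all values are
  congruent to 1 modulo every prime up to \<open>B\<close>.\<close>

definition shift :: "nat \<Rightarrow> (nat \<Rightarrow> int) \<Rightarrow> nat \<Rightarrow> int" where
  "shift Y c i = (if i = 0 then 1 + int (modulus * Suc size_bound * Y) else 0) + int modulus * c i"

lemma modulus_pos: "modulus > 0"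
  by (simp add: modulus_def)

lemma norm_ratio_pos: "norm_ratio > 0"
  by (simp add: norm_ratio_def)

lemma finite_box: "finite (box Y)"
  and card_box: "card (box Y) = Y ^ deg"
  and boxD: "c \<in> box Y \<Longrightarrow> i < deg \<Longrightarrow> 0 \<le> c i \<and> c i < int Y"
  unfolding box_def by (auto intro!: finite_PiE simp: card_PiE PiE_iff)

lemma not_dvd_modulus: "prime p \<Longrightarrow> B < p \<Longrightarrow> \<not> int p dvd int modulus"
  unfolding modulus_def int_dvd_int_iff by (simp add: prime_dvd_fact_iff)

lemma eval_at_shift: "eval_at (shift Y c) \<xi> = of_nat (1 + modulus * Suc size_bound * Y) + of_nat modulus * eval_at c \<xi>"
proof -
  have "eval_at (shift Y c) \<xi> =
      (\<Sum>i<deg. (if i = 0 then of_nat (1 + modulus * Suc size_bound * Y) else 0) + of_nat modulus * (of_int (c i) * \<xi> ^ i))"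
    unfolding eval_at_def by (rule sum.cong) (auto simp: shift_def algebra_simps)
  then show ?thesis using deg_pos by (simp add: sum.distrib sum_distrib_left eval_at_def)
qed

lemma eval_at_shift_diff: "eval_at (shift Y c) \<xi> - eval_at (shift Y c') \<xi> = of_int (int modulus) * eval_at (\<lambda>i. c i - c' i) \<xi>"
  by (simp add: eval_at_shift eval_at_diff right_diff_distrib)

lemma norm_eval_at_shift:
  assumes c: "c \<in> box Y" and Y: "Y > 0" and \<xi>: "\<xi> \<in> conjugates \<eta>"
  shows "real (modulus * Y) \<le> norm (eval_at (shift Y c) \<xi>)"
    and "norm (eval_at (shift Y c) \<xi>) \<le> real (1 + 2 * Suc size_bound) * real (modulus * Y)"
proof -
  let ?k = "of_nat (1 + modulus * Suc size_bound * Y) :: 'a" and ?v = "of_nat modulus * eval_at c \<xi>"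
  have "norm (eval_at c \<xi>) \<le> real Y * real size_bound" using boxD[OF c] by (intro norm_eval_at_le[OF \<xi>]) force
  then have "norm ?v \<le> real modulus * (real Y * real size_bound)" by (simp add: norm_mult mult_left_mono)
  then have v: "norm ?v \<le> real (modulus * Y) * real size_bound" by (simp add: mult.assoc)
  have "norm ?k = real (1 + modulus * Suc size_bound * Y)" by (rule norm_of_nat)
  then have k: "norm ?k = 1 + real (modulus * Y) + real (modulus * Y) * real size_bound" by (simp add: algebra_simps)
  have "norm ?k \<le> norm (?k + ?v) + norm ?v" using norm_triangle_ineq4[of "?k + ?v" ?v] by simp
  then show "real (modulus * Y) \<le> norm (eval_at (shift Y c) \<xi>)" unfolding eval_at_shift k using v by linarith
  have "real (modulus * Y) \<ge> 1" using modulus_pos Y by (simp add: Suc_leI flip: of_nat_mult)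
  then have "1 + real (modulus * Y) + 2 * (real (modulus * Y) * real size_bound)
      \<le> real (1 + 2 * Suc size_bound) * real (modulus * Y)"
    by (simp add: algebra_simps)
  moreover have "norm (eval_at (shift Y c) \<xi>) \<le> norm ?k + norm ?v" unfolding eval_at_shift by (rule norm_triangle_ineq)
  ultimately show "norm (eval_at (shift Y c) \<xi>) \<le> real (1 + 2 * Suc size_bound) * real (modulus * Y)"
    unfolding k using v by linarith
qed

lemma coeff_norm_shift_ge:
  assumes "c \<in> box Y" "Y > 0" shows "(modulus * Y) ^ deg \<le> nat \<bar>coeff_norm (shift Y c)\<bar>"
proof -
  have "(\<Prod>\<xi>\<in>conjugates \<eta>. real (modulus * Y)) \<le> real_of_int \<bar>coeff_norm (shift Y c)\<bar>"
    unfolding abs_coeff_norm using norm_eval_at_shift(1)[OF assms] by (intro prod_mono) auto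
  then have "real_of_int (int ((modulus * Y) ^ deg)) \<le> real_of_int \<bar>coeff_norm (shift Y c)\<bar>" by (simp add: deg_def)
  then show ?thesis unfolding of_int_le_iff by linarith
qed

lemma coeff_norm_shift_le:
  assumes "c \<in> box Y" "Y > 0" shows "nat \<bar>coeff_norm (shift Y c)\<bar> \<le> norm_ratio * (modulus * Y) ^ deg"
proof -
  have "real_of_int \<bar>coeff_norm (shift Y c)\<bar> \<le> (\<Prod>\<xi>\<in>conjugates \<eta>. real (1 + 2 * Suc size_bound) * real (modulus * Y))"
    unfolding abs_coeff_norm using norm_eval_at_shift(2)[OF assms] by (intro prod_mono) auto
  also have "\<dots> = real_of_int (int (norm_ratio * (modulus * Y) ^ deg))"
    by (simp add: norm_ratio_def deg_def power_mult_distrib)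
  finally show ?thesis unfolding of_int_le_iff by linarith
qed

lemma coeff_norm_shift_nonzero: "c \<in> box Y \<Longrightarrow> Y > 0 \<Longrightarrow> coeff_norm (shift Y c) \<noteq> 0"
  using coeff_norm_shift_ge[of c Y] modulus_pos by auto

lemma coeff_norm_shift_cong_1: "int modulus dvd coeff_norm (shift Y c) - 1"
proof -
  have "(\<Prod>\<xi>\<in>conjugates \<eta>. eval_at (shift Y c) \<xi>) - 1 \<in> multiples modulus"
  proof (rule ideal_prod_cong_1[OF is_ideal_multiples])
    fix \<xi> assume \<xi>: "\<xi> \<in> conjugates \<eta>"
    have "eval_at (shift Y c) \<xi> - 1 = of_nat modulus * (of_nat (Suc size_bound * Y) + eval_at c \<xi>)"
      by (simp add: eval_at_shift algebra_simps)
    then show "eval_at (shift Y c) \<xi> \<in> A \<and> eval_at (shift Y c) \<xi> - 1 \<in> multiples modulus"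
      using eval_at_mem[OF \<xi>] by (simp add: multiplesI add_mem of_nat_mem del: of_nat_mult)
  qed
  then have "of_int (coeff_norm (shift Y c) - 1) \<in> multiples modulus" by (simp add: of_int_coeff_norm)
  then show ?thesis using of_int_multiples_iff[OF modulus_pos] by blast
qed

lemma large_if_prime_dvd_coeff_norm_shift:
  assumes p: "prime p" "int p dvd coeff_norm (shift Y c)" shows "B < p"
proof (rule ccontr)
  assume "\<not> B < p"
  then have "int p dvd int modulus" using p(1) unfolding modulus_def int_dvd_int_iff by (simp add: prime_dvd_fact_iff)
  then have "int p dvd coeff_norm (shift Y c) - 1" using coeff_norm_shift_cong_1 by (rule dvd_trans)
  then have "int p dvd 1" using dvd_diff[OF p(2)] by fastforce
  then show False using p(1) by auto
qed

lemma exists_least_power: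
  assumes "x > 0" obtains t where "t > 0" "x \<le> norm_bound * t ^ deg" "norm_bound * (t - 1) ^ deg < x"
proof -
  let ?P = "\<lambda>t. x \<le> norm_bound * t ^ deg"
  have "x \<le> x ^ deg" using deg_pos assms by (intro self_le_power) auto
  also have "\<dots> \<le> norm_bound * x ^ deg" using norm_bound_pos by simp
  finally have P: "?P (Least ?P)" by (rule LeastI)
  then have "Least ?P > 0" using assms deg_pos by (cases "Least ?P") (auto simp: power_0_left)
  then have "\<not> ?P (Least ?P - 1)" by (intro not_less_Least) simp
  then show ?thesis using that \<open>Least ?P > 0\<close> P by (meson not_le)
qed

lemma double_zero_separated:
  assumes p: "prime p" "B < p" and \<xi>: "\<xi> \<in> conjugates \<eta>" "\<xi>' \<in> conjugates \<eta>"
    and c: "c \<in> box Y" "double_zero p \<xi> \<xi>' (shift Y c)" and c': "c' \<in> box Y" "double_zero p \<xi> \<xi>' (shift Y c')"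
    and close: "\<And>i. i < deg \<Longrightarrow> \<bar>c i - c' i\<bar> \<le> int t" "norm_bound * t ^ deg < p\<^sup>2"
  shows "c = c'"
proof (rule ccontr)
  assume "c \<noteq> c'"
  then obtain i where "i < deg" "c i \<noteq> c' i" using c(1) c'(1) unfolding box_def by (metis PiE_ext lessThan_iff)
  then have nonzero: "coeff_norm (\<lambda>i. c i - c' i) \<noteq> 0" by (intro coeff_norm_nonzero[of i]) auto
  have "(\<lambda>i. shift Y c i - shift Y c' i) = (\<lambda>i. int modulus * (c i - c' i))"
    by (simp add: shift_def right_diff_distrib)
  then have "double_zero p \<xi> \<xi>' (\<lambda>i. int modulus * (c i - c' i))"
    using double_zero_diff[OF p(1) c(2) c'(2)] by simp
  then have "double_zero p \<xi> \<xi>' (\<lambda>i. c i - c' i)" by (rule double_zero_cancel[OF p(1) not_dvd_modulus[OF p] \<xi>])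
  then have "int (p\<^sup>2) dvd coeff_norm (\<lambda>i. c i - c' i)"
    using square_dvd_coeff_norm_if_double_zero[OF unramified_prime_if_large[OF p] \<xi>] by simp
  then have "p\<^sup>2 \<le> nat \<bar>coeff_norm (\<lambda>i. c i - c' i)\<bar>"
    using nonzero by (intro dvd_imp_le) (auto simp: dvd_nat_abs_iff)
  then show False using abs_coeff_norm_le[of "\<lambda>i. c i - c' i", OF close(1)] close(2) by linarith
qed

lemma card_double_zero_le:
  assumes p: "prime p" "B < p" and \<xi>: "\<xi> \<in> conjugates \<eta>" "\<xi>' \<in> conjugates \<eta>"
  shows "real (card {c \<in> box Y. double_zero p \<xi> \<xi>' (shift Y c)})
    \<le> 2 ^ deg * (real norm_bound * real Y ^ deg * (1 / (real p)\<^sup>2) + 1)"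
proof -
  let ?L = "{c \<in> box Y. double_zero p \<xi> \<xi>' (shift Y c)}"
  have p_pos: "p > 0" using p(1) by (rule prime_gt_0_nat)
  obtain t where t: "t > 0" "p\<^sup>2 \<le> norm_bound * t ^ deg" "norm_bound * (t - 1) ^ deg < p\<^sup>2"
    using exists_least_power[of "p\<^sup>2"] p_pos by auto
  have "card ?L \<le> (Y div t + 1) ^ deg"
    using double_zero_separated[OF p \<xi> _ _ _ _ _ t(3)] t(1) by (intro card_separated_box_le) (auto simp: box_def)
  also have "\<dots> \<le> 2 ^ deg * ((Y div t) ^ deg + 1)" by (rule Suc_power_le)
  finally have "real (card ?L) \<le> real (2 ^ deg * ((Y div t) ^ deg + 1))" unfolding of_nat_le_iff .
  also have "\<dots> = 2 ^ deg * (real ((Y div t) ^ deg) + 1)" by (simp add: distrib_left)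
  also have "\<dots> \<le> 2 ^ deg * (real norm_bound * real Y ^ deg * (1 / (real p)\<^sup>2) + 1)"
  proof (intro mult_left_mono add_right_mono)
    have "(Y div t) ^ deg * p\<^sup>2 \<le> (Y div t) ^ deg * (norm_bound * t ^ deg)" using t(2) by simp
    also have "\<dots> = norm_bound * (Y div t * t) ^ deg" by (simp add: power_mult_distrib)
    also have "\<dots> \<le> norm_bound * Y ^ deg" by (intro mult_left_mono power_mono) auto
    finally have "real ((Y div t) ^ deg * p\<^sup>2) \<le> real (norm_bound * Y ^ deg)" unfolding of_nat_le_iff .
    then show "real ((Y div t) ^ deg) \<le> real norm_bound * real Y ^ deg * (1 / (real p)\<^sup>2)"
      using p_pos by (simp add: field_simps)
  qed simp
  finally show ?thesis .
qed

definition squarefree_vectors :: "nat \<Rightarrow> (nat \<Rightarrow> int) set" where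
  "squarefree_vectors Y = {c \<in> box Y. \<forall>p. prime p \<longrightarrow> B < p \<longrightarrow> \<not> int p ^ 2 dvd coeff_norm (shift Y c)}"

lemma squarefree_vectors_subset: "squarefree_vectors Y \<subseteq> box Y"
  by (auto simp: squarefree_vectors_def)

lemma double_zero_if_not_squarefree:
  assumes c: "c \<in> box Y - squarefree_vectors Y" and Y: "Y > 0" and z: "norm_ratio * (modulus * Y) ^ deg < (z + 1)\<^sup>2"
  shows "\<exists>p\<in>{B<..z}. prime p \<and> (\<exists>\<xi>\<in>conjugates \<eta>. \<exists>\<xi>'\<in>conjugates \<eta>. double_zero p \<xi> \<xi>' (shift Y c))"
proof -
  obtain p where p: "prime p" "B < p" "int p ^ 2 dvd coeff_norm (shift Y c)"
    using c by (auto simp: squarefree_vectors_def)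
  have "p\<^sup>2 dvd nat \<bar>coeff_norm (shift Y c)\<bar>" using p(3) by (simp add: dvd_nat_abs_iff)
  then have "p\<^sup>2 \<le> nat \<bar>coeff_norm (shift Y c)\<bar>"
    using coeff_norm_shift_nonzero[of c Y] c Y by (intro dvd_imp_le) auto
  also have "\<dots> < (z + 1)\<^sup>2" using coeff_norm_shift_le[of c Y] c Y z by simp
  finally have "p < z + 1" by (rule power_less_imp_less_base) simp
  then show ?thesis using p double_zero_if_square_dvd_coeff_norm[OF p(1,3)] by (intro bexI[of _ p]) auto
qed

lemma card_not_squarefree_le:
  assumes Y: "Y > 0" and z: "norm_ratio * (modulus * Y) ^ deg < (z + 1)\<^sup>2"
  shows "real (card (box Y - squarefree_vectors Y))
    \<le> real deg ^ 2 * 2 ^ deg * (real norm_bound * real Y ^ deg / real B + real z)"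
proof -
  define P where "P = {p \<in> {B<..z}. prime p}"
  let ?L = "\<lambda>p \<xi> \<xi>'. {c \<in> box Y. double_zero p \<xi> \<xi>' (shift Y c)}"
  let ?U = "\<Union>p\<in>P. \<Union>\<xi>\<in>conjugates \<eta>. \<Union>\<xi>'\<in>conjugates \<eta>. ?L p \<xi> \<xi>'"
  let ?t = "\<lambda>p. real norm_bound * real Y ^ deg * (1 / (real p)\<^sup>2) + 1"
  have finite_P: "finite P" by (simp add: P_def)
  have "box Y - squarefree_vectors Y \<subseteq> ?U"
  proof
    fix c assume c: "c \<in> box Y - squarefree_vectors Y"
    obtain p \<xi> \<xi>' where "p \<in> P" "\<xi> \<in> conjugates \<eta>" "\<xi>' \<in> conjugates \<eta>" "double_zero p \<xi> \<xi>' (shift Y c)"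
      using double_zero_if_not_squarefree[OF c assms] by (auto simp: P_def)
    then show "c \<in> ?U" using c by (intro UN_I[of p] UN_I[of \<xi>] UN_I[of \<xi>']) simp_all
  qed
  moreover have "finite ?U"
    by (intro finite_UN_I finite_P finite_conjugates finite_subset[OF _ finite_box[of Y]]) auto
  ultimately have "card (box Y - squarefree_vectors Y) \<le> card ?U" by (simp add: card_mono)
  also have "\<dots> \<le> (\<Sum>p\<in>P. \<Sum>\<xi>\<in>conjugates \<eta>. \<Sum>\<xi>'\<in>conjugates \<eta>. card (?L p \<xi> \<xi>'))"
    by (intro order_trans[OF card_UN_le] sum_mono card_UN_le finite_P finite_conjugates)
  finally have "real (card (box Y - squarefree_vectors Y))
      \<le> (\<Sum>p\<in>P. \<Sum>\<xi>\<in>conjugates \<eta>. \<Sum>\<xi>'\<in>conjugates \<eta>. real (card (?L p \<xi> \<xi>')))"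
    by (simp flip: of_nat_sum)
  also have "\<dots> \<le> (\<Sum>p\<in>P. \<Sum>\<xi>\<in>conjugates \<eta>. \<Sum>\<xi>'\<in>conjugates \<eta>. 2 ^ deg * ?t p)"
    by (intro sum_mono card_double_zero_le) (auto simp: P_def)
  also have "\<dots> = real deg ^ 2 * 2 ^ deg * (\<Sum>p\<in>P. ?t p)"
    by (simp add: deg_def[symmetric] power2_eq_square mult.assoc flip: sum_distrib_left)
  also have "(\<Sum>p\<in>P. ?t p) = real norm_bound * real Y ^ deg * (\<Sum>p\<in>P. 1 / (real p)\<^sup>2) + real (card P)"
    by (simp add: sum.distrib sum_distrib_left)
  also have "real deg ^ 2 * 2 ^ deg * \<dots> \<le> real deg ^ 2 * 2 ^ deg * (real norm_bound * real Y ^ deg * (1 / real B) + real z)"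
  proof (intro mult_left_mono add_mono)
    have "(\<Sum>p\<in>P. 1 / (real p)\<^sup>2) \<le> (\<Sum>p\<in>{B<..z}. 1 / (real p)\<^sup>2)" by (rule sum_mono2) (auto simp: P_def)
    also have "\<dots> \<le> 1 / real B" using norm_bound_less by (intro sum_inverse_squares_le) simp
    finally show "(\<Sum>p\<in>P. 1 / (real p)\<^sup>2) \<le> 1 / real B" .
    have "card P \<le> card {B<..z}" by (intro card_mono) (auto simp: P_def)
    then show "real (card P) \<le> real z" by simp
  qed auto
  finally show ?thesis by simp
qed

definition least_size :: nat where
  "least_size = (4 * deg\<^sup>2 * 2 ^ deg)\<^sup>2 * (norm_ratio * modulus ^ deg)"

lemma least_size_pos: "least_size > 0"
  using deg_pos norm_ratio_pos modulus_pos by (simp add: least_size_def)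

lemma card_squarefree_ge:
  assumes Y: "least_size \<le> Y" shows "real Y ^ deg / 2 \<le> real (card (squarefree_vectors Y))"
proof -
  let ?k = "deg\<^sup>2 * 2 ^ deg"
  define n where "n = norm_ratio * (modulus * Y) ^ deg"
  define z where "z = nth_root_nat 2 n"
  have Y_pos: "Y > 0" and B_pos: "B > 0" using least_size_pos Y norm_bound_less by auto
  have z: "n < (z + 1)\<^sup>2" "z\<^sup>2 \<le> n"
    using nth_root_nat_ge[of 2 "z + 1" n] nth_root_nat_power_le[of 2 n] by (auto simp: z_def not_le[symmetric])
  have "(4 * ?k * z)\<^sup>2 = (4 * ?k)\<^sup>2 * z\<^sup>2" by (simp add: power_mult_distrib)
  also have "\<dots> \<le> (4 * ?k)\<^sup>2 * n" using z(2) by simp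
  also have "\<dots> = least_size * Y ^ deg" by (simp add: n_def least_size_def power_mult_distrib)
  also have "\<dots> \<le> Y ^ deg * Y ^ deg"
    using Y self_le_power[of Y deg] Y_pos deg_pos by (intro mult_right_mono) auto
  also have "\<dots> = (Y ^ deg)\<^sup>2" by (simp add: power2_eq_square)
  finally have "4 * ?k * z \<le> Y ^ deg" by (rule power2_le_imp_le) simp
  then have root: "real (4 * ?k * z) \<le> real Y ^ deg" by (simp only: of_nat_power[symmetric] of_nat_le_iff)
  have "real (4 * ?k * norm_bound) \<le> real B" unfolding of_nat_le_iff using norm_bound_le by (simp add: mult.assoc)
  then have "real (4 * ?k * norm_bound) * (real Y ^ deg / real B) \<le> real B * (real Y ^ deg / real B)"
    by (rule mult_right_mono) simp
  then have bound: "real (4 * ?k * norm_bound) * (real Y ^ deg / real B) \<le> real Y ^ deg" using B_pos by simp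
  have "real (card (box Y - squarefree_vectors Y)) \<le> real ?k * (real norm_bound * real Y ^ deg / real B + real z)"
    using card_not_squarefree_le[OF Y_pos, of z] z(1) by (simp add: n_def)
  also have "\<dots> = (real (4 * ?k * norm_bound) * (real Y ^ deg / real B)) / 4 + real (4 * ?k * z) / 4"
    by (simp add: distrib_left)
  also have "\<dots> \<le> real Y ^ deg / 4 + real Y ^ deg / 4" by (intro add_mono divide_right_mono root bound) auto
  finally have "real (card (box Y - squarefree_vectors Y)) \<le> real Y ^ deg / 2" by simp
  moreover have "card (box Y) = card (box Y - squarefree_vectors Y) + card (squarefree_vectors Y)"
    using squarefree_vectors_subset finite_box
    by (metis Diff_partition Un_commute card_Un_disjoint Diff_disjoint Int_commute finite_Diff finite_subset)
  ultimately show ?thesis by (simp add: card_box flip: of_nat_power)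
qed

lemma degree_one_prime_if_simple_factor:
  assumes p: "prime p" "B < p" and \<xi>: "\<xi> \<in> conjugates \<eta>" "eval_at b \<xi> \<in> prime_over p"
    and simple: "\<not> int p ^ 2 dvd coeff_norm b"
  shows "(p, \<xi>) \<in> factors b"
proof -
  note unramified = unramified_prime_if_large[OF p] and ideal = prime_over_ideal[OF p(1)]
  note \<phi> = frobenius(1)[OF unramified]
  have "eval_at b \<xi> ^ p - eval_at b (frobenius p \<xi>) \<in> prime_over p"
    using frobenius(2)[OF unramified eval_at_mem[OF \<xi>(1)]] act_eval_at[OF \<phi> \<xi>(1)] by simp
  then have "eval_at b (frobenius p \<xi>) \<in> prime_over p"
    using ideal_cong_mem[OF ideal] ideal_power[OF ideal \<xi>(2) prime_gt_0_nat[OF p(1)]] by blast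
  then have "double_zero p \<xi> (frobenius p \<xi>) b" if "frobenius p \<xi> \<noteq> \<xi>" using that \<xi>(2) by (auto simp: double_zero_def)
  then have "frobenius p \<xi> = \<xi>"
    using square_dvd_coeff_norm_if_double_zero[OF unramified \<xi>(1) conjugates_closed[OF \<phi> \<xi>(1)]] simple by blast
  then show ?thesis using p \<xi> by (simp add: factors_def degree_one_primes_def)
qed

lemma prod_factors_squarefree:
  assumes Y: "Y > 0" and c: "c \<in> squarefree_vectors Y"
  shows "prod fst (factors (shift Y c)) = nat \<bar>coeff_norm (shift Y c)\<bar>"
proof -
  let ?a = "shift Y c"
  have "coeff_norm ?a \<noteq> 0" using c Y squarefree_vectors_subset by (intro coeff_norm_shift_nonzero) auto
  then have finite: "finite (factors ?a)" by (rule finite_factors)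
  obtain k where k: "nat \<bar>coeff_norm ?a\<bar> = prod fst (factors ?a) * k"
    using prod_fst_dvd_coeff_norm[OF finite subset_refl] by (elim dvdE)
  have "\<not> p dvd k" if p: "prime p" for p
  proof
    assume "p dvd k"
    then have dvd: "int p dvd coeff_norm ?a" using k by (simp flip: dvd_nat_abs_iff)
    then have "B < p" by (rule large_if_prime_dvd_coeff_norm_shift[OF p])
    then have squarefree: "\<not> int p ^ 2 dvd coeff_norm ?a" using c p by (auto simp: squarefree_vectors_def)
    obtain \<xi> where "\<xi> \<in> conjugates \<eta>" "eval_at ?a \<xi> \<in> prime_over p" using prime_dvd_coeff_norm[OF p dvd] by blast
    then have "(p, \<xi>) \<in> factors ?a" using degree_one_prime_if_simple_factor[OF p \<open>B < p\<close>] squarefree by blast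
    then have "p dvd prod fst (factors ?a)" using finite by (metis dvd_prodI fst_conv)
    then have "p * p dvd nat \<bar>coeff_norm ?a\<bar>" unfolding k using \<open>p dvd k\<close> by (rule mult_dvd_mono)
    then show False using squarefree by (simp add: dvd_nat_abs_iff power2_eq_square)
  qed
  then have "k = 1" using prime_factor_nat by blast
  then show ?thesis using k by simp
qed

lemma inj_on_factors_squarefree:
  assumes Y: "Y > 0" shows "inj_on (\<lambda>c. factors (shift Y c)) (squarefree_vectors Y)"
proof (rule inj_onI, rule ccontr)
  fix c c' assume c: "c \<in> squarefree_vectors Y" "c' \<in> squarefree_vectors Y"
    and eq: "factors (shift Y c) = factors (shift Y c')" and "c \<noteq> c'"
  let ?d = "\<lambda>i. c i - c' i"
  have box: "c \<in> box Y" "c' \<in> box Y" using c squarefree_vectors_subset by auto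
  then obtain i where "i < deg" "c i \<noteq> c' i" using \<open>c \<noteq> c'\<close> unfolding box_def by (metis PiE_ext lessThan_iff)
  then have nonzero: "coeff_norm ?d \<noteq> 0" by (intro coeff_norm_nonzero[of i]) auto
  have "factors (shift Y c) \<subseteq> factors ?d"
  proof
    fix u assume u: "u \<in> factors (shift Y c)"
    then obtain p \<xi> where p: "u = (p, \<xi>)" "prime p" "B < p" "\<xi> \<in> conjugates \<eta>" "u \<in> degree_one_primes"
      by (auto simp: factors_def degree_one_primes_def)
    have "eval_at (shift Y c) \<xi> \<in> prime_over p" "eval_at (shift Y c') \<xi> \<in> prime_over p"
      using u eq p(1) by (auto simp: factors_def)
    then have "of_int (int modulus) * eval_at ?d \<xi> \<in> prime_over p"
      unfolding eval_at_shift_diff[of Y, symmetric] by (rule ideal_diff[OF prime_over_ideal[OF p(2)]])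
    moreover have "of_int (int modulus) \<notin> prime_over p"
      using prime_ideal_of_int_iff[OF prime_over[OF p(2)] p(2)] not_dvd_modulus[OF p(2,3)] by blast
    ultimately have "eval_at ?d \<xi> \<in> prime_over p"
      using prime_ideal_multD[OF prime_over(1)[OF p(2)] _ of_int_mem eval_at_mem[OF p(4)]] by metis
    then show "u \<in> factors ?d" using p by (simp add: factors_def)
  qed
  then have "prod fst (factors (shift Y c)) \<le> nat \<bar>coeff_norm ?d\<bar>"
    using nonzero finite_subset[OF _ finite_factors] by (intro prod_fst_le_coeff_norm) auto
  also have "\<dots> \<le> norm_bound * Y ^ deg"
  proof (rule abs_coeff_norm_le)
    show "\<bar>?d i\<bar> \<le> int Y" if "i < deg" for i using boxD[OF box(1) that] boxD[OF box(2) that] by auto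
  qed
  also have "\<dots> < (modulus * Y) ^ deg"
  proof -
    have "norm_bound < modulus" using norm_bound_less fact_ge_self[of B] by (simp add: modulus_def)
    also have "\<dots> \<le> modulus ^ deg" using modulus_pos deg_pos by (intro self_le_power) auto
    finally show ?thesis using Y by (simp add: power_mult_distrib)
  qed
  also have "\<dots> \<le> nat \<bar>coeff_norm (shift Y c)\<bar>" by (rule coeff_norm_shift_ge[OF box(1) Y])
  finally show False using prod_factors_squarefree[OF Y c(1)] by simp
qed

lemma block_sum_ge:
  assumes Y: "least_size \<le> Y"
  defines "x \<equiv> (modulus * Y) ^ deg"
  shows "1 / (2 * real (norm_ratio * modulus ^ deg))
    \<le> (\<Sum>U\<in>{U \<in> Fpow degree_one_primes. x \<le> prod fst U \<and> prod fst U \<le> norm_ratio * x}. 1 / real (prod fst U))"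
proof -
  let ?S = "{U \<in> Fpow degree_one_primes. x \<le> prod fst U \<and> prod fst U \<le> norm_ratio * x}"
  have Y_pos: "Y > 0" using least_size_pos Y by simp
  have x_pos: "norm_ratio * x > 0" using Y_pos modulus_pos norm_ratio_pos by (simp add: x_def)
  have finite_S: "finite ?S" by (rule finite_subset[OF _ card_small_products_le(1)[OF x_pos]]) auto
  have "(\<lambda>c. factors (shift Y c)) ` squarefree_vectors Y \<subseteq> ?S"
  proof (rule image_subsetI)
    fix c assume c: "c \<in> squarefree_vectors Y"
    then have box: "c \<in> box Y" using squarefree_vectors_subset by blast
    then show "factors (shift Y c) \<in> ?S"
      using factors_subset finite_factors[OF coeff_norm_shift_nonzero[OF box Y_pos]] prod_factors_squarefree[OF Y_pos c]
        coeff_norm_shift_ge[OF box Y_pos] coeff_norm_shift_le[OF box Y_pos]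
      by (auto simp: Fpow_def x_def)
  qed
  then have "card (squarefree_vectors Y) \<le> card ?S"
    by (rule card_inj_on_le[OF inj_on_factors_squarefree[OF Y_pos] _ finite_S])
  then have "real Y ^ deg / 2 \<le> real (card ?S)" using card_squarefree_ge[OF Y] by linarith
  then have "real Y ^ deg / 2 * (1 / real (norm_ratio * x)) \<le> real (card ?S) * (1 / real (norm_ratio * x))"
    by (rule mult_right_mono) simp
  also have "\<dots> = (\<Sum>U\<in>?S. 1 / real (norm_ratio * x))" by simp
  also have "\<dots> \<le> (\<Sum>U\<in>?S. 1 / real (prod fst U))"
  proof (rule sum_mono)
    fix U assume "U \<in> ?S"
    then have "real (prod fst U) > 0" "real (prod fst U) \<le> real (norm_ratio * x)"
      using prod_fst_pos[of U] unfolding Fpow_def of_nat_0_less_iff of_nat_le_iff by auto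
    then show "1 / real (norm_ratio * x) \<le> 1 / real (prod fst U)" by (intro frac_le) auto
  qed
  also have "real Y ^ deg / 2 * (1 / real (norm_ratio * x)) = 1 / (2 * real (norm_ratio * modulus ^ deg))"
    using Y_pos by (simp add: x_def power_mult_distrib)
  finally show ?thesis .
qed

lemma harmonic_sum_lower:
  "\<exists>e c. c > 0 \<and> (\<forall>j. c * real (Suc j) \<le> harmonic_sum (Fpow degree_one_primes) (prod fst) (2 ^ (e * Suc j)))"
proof -
  let ?H = "harmonic_sum (Fpow degree_one_primes) (prod fst)"
  define c where "c = 1 / (2 * real (norm_ratio * modulus ^ deg))"
  define x\<^sub>0 where "x\<^sub>0 = (modulus * least_size) ^ deg"
  define M where "M = Suc norm_ratio ^ deg"
  obtain e where e: "norm_ratio * x\<^sub>0 * M ^ j \<le> 2 ^ (e * Suc j)" for j using geometric_le_power_two by blast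
  have "c * real (Suc j) \<le> ?H (2 ^ (e * Suc j))" for j
  proof -
    have "c * real (Suc j) \<le> ?H (norm_ratio * (x\<^sub>0 * M ^ j))"
    proof (rule harmonic_sum_ge_if_blocks_ge[OF card_small_products_le(1)])
      show "x\<^sub>0 > 0" using modulus_pos least_size_pos by (simp add: x\<^sub>0_def)
      show "norm_ratio < M" using self_le_power[of "Suc norm_ratio" deg] deg_pos by (simp add: M_def)
      fix j
      have "x\<^sub>0 * M ^ j = (modulus * (least_size * Suc norm_ratio ^ j)) ^ deg"
        by (simp add: x\<^sub>0_def M_def power_mult_distrib power_mult[symmetric] mult.commute mult.assoc)
      then show "c \<le> (\<Sum>U\<in>{U \<in> Fpow degree_one_primes. x\<^sub>0 * M ^ j \<le> prod fst U \<and> prod fst U \<le> norm_ratio * (x\<^sub>0 * M ^ j)}.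
          1 / real (prod fst U))"
        using block_sum_ge[of "least_size * Suc norm_ratio ^ j"] by (simp add: c_def)
    qed (use norm_ratio_pos in auto)
    also have "\<dots> \<le> ?H (2 ^ (e * Suc j))"
      using e[of j] by (intro harmonic_sum_mono card_small_products_le(1)) (auto simp: mult.assoc)
    finally show ?thesis .
  qed
  moreover have "c > 0" using norm_ratio_pos modulus_pos by (simp add: c_def)
  ultimately show ?thesis by blast
qed

end

section \<open>Frobenius elements of prime power order\<close>

lemma (in galois_ring) is_frobenius_conjugate:
  assumes Q: "is_frobenius p Q \<phi>" and g: "g \<in> G" and h: "h \<in> G" "\<And>x. g (h x) = x"
  shows "is_frobenius p {x \<in> A. g x \<in> Q} (h \<circ> \<phi> \<circ> g)"
proof -
  have prime: "prime p" "is_prime_ideal Q" "of_nat p \<in> Q" and \<phi>: "\<phi> \<in> G" "\<And>x. x \<in> A \<Longrightarrow> x ^ p - \<phi> x \<in> Q"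
    using Q by (auto simp: is_frobenius_def)
  note ideal = prime_ideal_ideal[OF prime(2)]
  have "is_ideal {x \<in> A. g x \<in> Q}"
    unfolding is_ideal_def
    by (auto simp: mem_simps act_zero[OF g] act_add[OF g] act_mult[OF g] act_mem[OF g]
        ideal_zero[OF ideal] ideal_add[OF ideal] ideal_mult_left[OF ideal])
  then have "is_prime_ideal {x \<in> A. g x \<in> Q}"
    using prime_ideal_one[OF prime(2)] prime_ideal_multD[OF prime(2)]
    by (auto simp: is_prime_ideal_def act_one[OF g] act_mult[OF g] act_mem[OF g])
  moreover have "x ^ p - h (\<phi> (g x)) \<in> {x \<in> A. g x \<in> Q}" if x: "x \<in> A" for x
  proof -
    have mem: "g x \<in> A" "h (\<phi> (g x)) \<in> A" using x g \<phi>(1) h(1) by (simp_all add: act_mem)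
    then have "g (x ^ p - h (\<phi> (g x))) = g x ^ p - \<phi> (g x)"
      using x h(2) by (simp add: act_diff[OF g] act_power[OF g] power_mem)
    then show ?thesis using \<phi>(2)[OF mem(1)] mem(2) x by (simp add: diff_mem power_mem)
  qed
  ultimately show ?thesis
    using prime(1,3) g h(1) \<phi>(1) by (simp add: is_frobenius_def of_nat_mem act_of_nat comp_mem)
qed

lemma (in galois_ring) exists_element_with_stabilizer_powers:
  assumes \<sigma>: "\<sigma> \<in> G" shows "\<exists>\<eta>\<in>A. \<forall>g\<in>G. g \<eta> = \<eta> \<longleftrightarrow> g \<in> range (\<lambda>k. \<sigma> ^^ (n * k))"
proof (rule exists_element_with_stabilizer)
  show "range (\<lambda>k. \<sigma> ^^ (n * k)) \<subseteq> G" using funpow_mem[OF \<sigma>] by auto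
  show "id \<in> range (\<lambda>k. \<sigma> ^^ (n * k))" by (auto intro!: image_eqI[of _ _ 0] simp flip: id_def)
  show "g \<circ> h \<in> range (\<lambda>k. \<sigma> ^^ (n * k))" if "g \<in> range (\<lambda>k. \<sigma> ^^ (n * k))" "h \<in> range (\<lambda>k. \<sigma> ^^ (n * k))" for g h
    using that by (auto simp: funpow_add[symmetric] distrib_left[symmetric])
qed

lemma (in finite_perm_group) disjoint_transversal_images:
  assumes stabilizers: "\<forall>g\<in>G. g y = y \<longrightarrow> g x = x"
    and \<sigma>: "\<sigma> \<in> G" "\<sigma> x = x" "\<sigma> y \<noteq> y"
    and t: "\<And>z. z \<in> conjugates x \<Longrightarrow> t z \<in> G" "\<And>z. z \<in> conjugates x \<Longrightarrow> t z x = z"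
  shows "inj_on (\<lambda>z. t z y) (conjugates x)" "(\<lambda>z. t z y) ` conjugates x \<subseteq> conjugates y"
    and "inj_on (\<lambda>z. t z (\<sigma> y)) (conjugates x)" "(\<lambda>z. t z (\<sigma> y)) ` conjugates x \<subseteq> conjugates y"
    and "(\<lambda>z. t z y) ` conjugates x \<inter> (\<lambda>z. t z (\<sigma> y)) ` conjugates x = {}"
proof -
  have transfer: "u x = v x" if uv: "u \<in> G" "v \<in> G" "u y = v y" for u v
  proof -
    obtain h where h: "h \<in> G" "\<And>x. h (v x) = x" "\<And>x. v (h x) = x" using exists_inverse[OF uv(2)] by blast
    have "(h \<circ> u) y = y" using uv(3) h(2) by simp
    then have "(h \<circ> u) x = x" using stabilizers comp_mem[OF h(1) uv(1)] by blast
    then show ?thesis using h(3) by (metis comp_apply)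
  qed
  have t\<sigma>: "t z \<circ> \<sigma> \<in> G" "(t z \<circ> \<sigma>) x = z" if "z \<in> conjugates x" for z
    using t[OF that] \<sigma> by (simp_all add: comp_mem)
  show "inj_on (\<lambda>z. t z y) (conjugates x)" by (rule inj_onI) (metis t transfer)
  show "inj_on (\<lambda>z. t z (\<sigma> y)) (conjugates x)" by (rule inj_onI) (metis t\<sigma> transfer comp_apply)
  show "(\<lambda>z. t z y) ` conjugates x \<subseteq> conjugates y" using t(1) by (force simp: conjugates_eq)
  show "(\<lambda>z. t z (\<sigma> y)) ` conjugates x \<subseteq> conjugates y"
  proof (rule image_subsetI)
    fix z assume "z \<in> conjugates x"
    then show "t z (\<sigma> y) \<in> conjugates y" using imageI[OF t\<sigma>(1), of z "\<lambda>g. g y"] by (simp add: conjugates_eq)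
  qed
  have "t z y \<noteq> t w (\<sigma> y)" if "z \<in> conjugates x" "w \<in> conjugates x" for z w
    using t[OF that(1)] t[OF that(2)] t\<sigma>[OF that(2)] transfer[of "t z" "t w \<circ> \<sigma>"] inj_mem[of "t z" y "\<sigma> y"] \<sigma>(3)
    by force
  then show "(\<lambda>z. t z y) ` conjugates x \<inter> (\<lambda>z. t z (\<sigma> y)) ` conjugates x = {}" by blast
qed

lemma eq_id_if_prime_power_order:
  fixes \<sigma> :: "'a \<Rightarrow> 'a"
  assumes "\<sigma> ^^ (l ^ a) = id" "\<sigma> = \<sigma> ^^ (l * k)" shows "\<sigma> = id"
proof -
  have "\<sigma> = \<sigma> ^^ ((l * k) ^ n)" for n
  proof (induction n)
    case (Suc n)
    have "\<sigma> ^^ ((l * k) ^ Suc n) = (\<sigma> ^^ (l * k)) ^^ ((l * k) ^ n)" by (simp add: funpow_mult mult.commute)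
    then show ?case using assms(2) Suc by simp
  qed simp
  from this[of a] have "\<sigma> = (\<sigma> ^^ (l ^ a)) ^^ (k ^ a)" by (simp add: funpow_mult power_mult_distrib mult.commute)
  then show ?thesis using assms(1) by (simp add: id_funpow)
qed

context normed_galois_ring
begin

text \<open>Two disjoint embeddings of the degree-one primes for \<open>\<eta>\<close> into those for \<open>\<eta>'\<close> combine two squarefree
  ideals of norms \<open>m\<close> and \<open>n\<close> into one of norm \<open>mn\<close>. So the sum of inverse norms up to \<open>x\<^sup>2\<close> for \<open>\<eta>'\<close> is at
  least the square of the sum up to \<open>x\<close> for \<open>\<eta>\<close>, but both are of order \<open>log x\<close>.\<close>

lemma no_double_cover:
  fixes f g :: "'a \<Rightarrow> 'a"
  assumes \<eta>: "\<eta> \<in> A" "\<eta>' \<in> A"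
    and f: "inj_on f (conjugates \<eta>)" "f ` conjugates \<eta> \<subseteq> conjugates \<eta>'"
    and g: "inj_on g (conjugates \<eta>)" "g ` conjugates \<eta> \<subseteq> conjugates \<eta>'"
    and disjoint: "f ` conjugates \<eta> \<inter> g ` conjugates \<eta> = {}"
  shows "\<exists>p \<xi>. prime p \<and> B < p \<and> \<xi> \<in> conjugates \<eta> \<and> frobenius p \<xi> = \<xi> \<and>
    \<not> (frobenius p (f \<xi>) = f \<xi> \<and> frobenius p (g \<xi>) = g \<xi>)"
proof (rule ccontr)
  assume neg: "\<not> ?thesis"
  interpret E: galois_element A G \<eta> by unfold_locales (rule \<eta>(1))
  interpret E': galois_element A G \<eta>' by unfold_locales (rule \<eta>(2))
  define C where "C = B + nat \<bar>discriminant\<bar> + 4 * E.deg\<^sup>2 * 2 ^ E.deg * E.norm_bound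
    + 4 * E'.deg\<^sup>2 * 2 ^ E'.deg * E'.norm_bound"
  interpret E: galois_element_bound A G \<eta> C by unfold_locales (auto simp: C_def)
  interpret E': galois_element_bound A G \<eta>' C by unfold_locales (auto simp: C_def)
  let ?H = "harmonic_sum (Fpow E.degree_one_primes) (prod fst)"
    and ?H' = "harmonic_sum (Fpow E'.degree_one_primes) (prod fst)"
  have square: "(?H x)\<^sup>2 \<le> ?H' (x * x)" if "x > 0" for x
  proof (rule harmonic_sum_Fpow_square_le)
    show "inj_on (map_prod id f) E.degree_one_primes" "inj_on (map_prod id g) E.degree_one_primes"
      using f(1) g(1) by (auto simp: E.degree_one_primes_def inj_on_def)
    have "map_prod id f u \<in> E'.degree_one_primes \<and> map_prod id g u \<in> E'.degree_one_primes"
      if u: "u \<in> E.degree_one_primes" for u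
    proof -
      obtain p \<xi> where "u = (p, \<xi>)" "prime p" "C < p" "\<xi> \<in> conjugates \<eta>" "frobenius p \<xi> = \<xi>"
        using u by (auto simp: E.degree_one_primes_def)
      moreover from this have "B < p" by (simp add: C_def)
      ultimately show ?thesis using neg f(2) g(2) by (auto simp: E'.degree_one_primes_def)
    qed
    then show "map_prod id f ` E.degree_one_primes \<subseteq> E'.degree_one_primes"
      "map_prod id g ` E.degree_one_primes \<subseteq> E'.degree_one_primes" by auto
    show "map_prod id f ` E.degree_one_primes \<inter> map_prod id g ` E.degree_one_primes = {}"
      using disjoint by (auto simp: E.degree_one_primes_def)
    show "finite {U \<in> Fpow E'.degree_one_primes. prod fst U \<le> x * x}"
      using that by (intro E'.card_small_products_le(1)) simp
  qed auto
  obtain e c where "c > 0" "\<And>j. c * real (Suc j) \<le> ?H (2 ^ (e * Suc j))" using E.harmonic_sum_lower by blast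
  then have "\<exists>x>0. ?H' (x * x) < (?H x)\<^sup>2"
    by (rule exists_square_greater_if_log_growth[where C = "3 ^ E'.deg"]) (auto intro: E'.harmonic_sum_upper)
  then show False using square by (meson not_less)
qed

lemma frobenius_conjugate_fixes:
  assumes p: "unramified_prime p" and no_frobenius: "\<And>Q k. is_frobenius p Q (\<sigma> ^^ k) \<Longrightarrow> l dvd k"
    and stabilizer: "\<And>g. g \<in> G \<Longrightarrow> g \<eta> = \<eta> \<Longrightarrow> g \<in> range (\<lambda>k. \<sigma> ^^ k)"
    and \<eta>': "\<And>k. (\<sigma> ^^ (l * k)) \<eta>' = \<eta>'"
    and t: "t \<in> G" "frobenius p (t \<eta>) = t \<eta>"
  shows "frobenius p (t \<eta>') = t \<eta>'" and "frobenius p (t (\<sigma> \<eta>')) = t (\<sigma> \<eta>')"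
proof -
  obtain h where h: "h \<in> G" "\<And>x. h (t x) = x" "\<And>x. t (h x) = x" using exists_inverse[OF t(1)] by blast
  let ?\<psi> = "h \<circ> frobenius p \<circ> t"
  have "?\<psi> \<in> G" using comp_mem h(1) t(1) frobenius(1)[OF p] by simp
  moreover have "?\<psi> \<eta> = \<eta>" using t(2) h(2) by simp
  ultimately obtain k where k: "?\<psi> = \<sigma> ^^ k" using stabilizer by blast
  have "is_frobenius p {x \<in> A. t x \<in> prime_over p} ?\<psi>"
    by (rule is_frobenius_conjugate[OF is_frobenius_frobenius[OF p] t(1) h(1,3)])
  then have "l dvd k" unfolding k by (rule no_frobenius)
  then obtain m where m: "k = l * m" by (elim dvdE)
  have frobenius_t: "frobenius p (t x) = t ((\<sigma> ^^ (l * m)) x)" for x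
    using fun_cong[OF k[unfolded m], of x] h(3)[of "frobenius p (t x)"] by simp
  then show "frobenius p (t \<eta>') = t \<eta>'" using \<eta>' by simp
  have "(\<sigma> ^^ (l * m)) (\<sigma> \<eta>') = \<sigma> ((\<sigma> ^^ (l * m)) \<eta>')" by (rule funpow_swap1[symmetric])
  then show "frobenius p (t (\<sigma> \<eta>')) = t (\<sigma> \<eta>')" using frobenius_t \<eta>' by simp
qed

text \<open>Otherwise a Frobenius element that fixes a conjugate of \<open>\<eta>\<close>, whose stabilizer is generated by \<open>\<sigma>\<close>, fixes two
  conjugates of an element \<open>\<eta>'\<close> with stabilizer generated by \<open>\<sigma> ^^ l\<close>.\<close>

theorem exists_frobenius_power:
  assumes \<sigma>: "\<sigma> \<in> G" "\<sigma> \<noteq> id" "\<sigma> ^^ (l ^ a) = id"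
  shows "\<exists>p Q k. B < p \<and> \<not> l dvd k \<and> is_frobenius p Q (\<sigma> ^^ k)"
proof (rule ccontr)
  assume neg: "\<not> ?thesis"
  obtain \<eta> where \<eta>: "\<eta> \<in> A" "\<And>g. g \<in> G \<Longrightarrow> g \<eta> = \<eta> \<longleftrightarrow> g \<in> range (\<lambda>k. \<sigma> ^^ k)"
    using exists_element_with_stabilizer_powers[OF \<sigma>(1), of 1] by auto
  obtain \<eta>' where \<eta>': "\<eta>' \<in> A" "\<And>g. g \<in> G \<Longrightarrow> g \<eta>' = \<eta>' \<longleftrightarrow> g \<in> range (\<lambda>k. \<sigma> ^^ (l * k))"
    using exists_element_with_stabilizer_powers[OF \<sigma>(1), of l] by auto
  have \<sigma>_\<eta>: "\<sigma> \<eta> = \<eta>" using \<eta>(2)[OF \<sigma>(1)] range_eqI[of \<sigma> "\<lambda>k. \<sigma> ^^ k" 1] by simp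
  have \<sigma>_\<eta>': "\<sigma> \<eta>' \<noteq> \<eta>'" using \<eta>'(2)[OF \<sigma>(1)] eq_id_if_prime_power_order[OF \<sigma>(3)] \<sigma>(2) by auto
  have stabilizers: "\<forall>g\<in>G. g \<eta>' = \<eta>' \<longrightarrow> g \<eta> = \<eta>" using \<eta>(2) \<eta>'(2) by blast
  define t where "t \<xi> = (SOME g. g \<in> G \<and> g \<eta> = \<xi>)" for \<xi>
  have t: "t \<xi> \<in> G" "t \<xi> \<eta> = \<xi>" if "\<xi> \<in> conjugates \<eta>" for \<xi>
    using that someI_ex[of "\<lambda>g. g \<in> G \<and> g \<eta> = \<xi>"] by (auto simp: conjugates_eq t_def)
  obtain p \<xi> where p: "prime p" "B + nat \<bar>discriminant\<bar> < p" and \<xi>: "\<xi> \<in> conjugates \<eta>" "frobenius p \<xi> = \<xi>"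
    and moved: "\<not> (frobenius p (t \<xi> \<eta>') = t \<xi> \<eta>' \<and> frobenius p (t \<xi> (\<sigma> \<eta>')) = t \<xi> (\<sigma> \<eta>'))"
    using no_double_cover[OF \<eta>(1) \<eta>'(1) disjoint_transversal_images[of \<eta>' \<eta> \<sigma> t, OF stabilizers \<sigma>(1) \<sigma>_\<eta> \<sigma>_\<eta>' t]]
    by blast
  then have "B < p" "unramified_prime p" by (auto intro: unramified_primeI)
  moreover from this have "l dvd k" if "is_frobenius p Q (\<sigma> ^^ k)" for Q k using that neg by blast
  moreover have "(\<sigma> ^^ (l * k)) \<eta>' = \<eta>'" for k using \<eta>'(2)[OF funpow_mem[OF \<sigma>(1)]] by blast
  ultimately show False
    using frobenius_conjugate_fixes[of p \<sigma> l \<eta> \<eta>' "t \<xi>"] \<eta>(2) t[OF \<xi>(1)] \<xi>(2) moved by auto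
qed

end

section \<open>Algebraic integers\<close>

interpretation int_module: Modules.module "\<lambda>(n::int) (x::'a::comm_ring_1). of_int n * x"
  by unfold_locales (simp_all add: algebra_simps)

lemma algebraic_int_if_stable:
  fixes z :: "'a::field_char_0"
  assumes B: "finite B" "b \<in> B" "b \<noteq> 0" and stable: "\<And>v. v \<in> B \<Longrightarrow> z * v \<in> int_module.span B"
  shows "algebraic_int z"
proof -
  define n where "n = card B"
  obtain e where e: "bij_betw e {..<n} B"
    using ex_bij_betw_nat_finite[OF B(1)] by (auto simp: n_def atLeast0LessThan)
  have "\<exists>c. z * e i = (\<Sum>j<n. of_int (c j) * e j)" if "i < n" for i
  proof -
    have "z * e i \<in> int_module.span B" using stable bij_betwE[OF e] that by simp
    then obtain u where "z * e i = (\<Sum>v\<in>B. of_int (u v) * v)"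
      unfolding int_module.span_finite[OF B(1)] by (elim rangeE)
    also have "\<dots> = (\<Sum>j<n. of_int (u (e j)) * e j)"
      by (rule sum.reindex_bij_betw[OF e, symmetric])
    finally show ?thesis by (intro exI[of _ "\<lambda>j. u (e j)"])
  qed
  then obtain c where c: "\<And>i. i < n \<Longrightarrow> z * e i = (\<Sum>j<n. of_int (c i j) * e j)" by metis
  define M where "M = mat n n (\<lambda>(i, j). c i j)"
  have M: "M \<in> carrier_mat n n" by (simp add: M_def)
  obtain i where "i < n" "e i = b" using e B(2) by (auto simp: bij_betw_def)
  then have "vec n e \<noteq> 0\<^sub>v n" using B(3) by (metis index_vec index_zero_vec(1))
  moreover have "map_mat of_int M *\<^sub>v vec n e = z \<cdot>\<^sub>v vec n e"
    using c by (intro eq_vecI) (auto simp: M_def scalar_prod_def lessThan_atLeast0)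
  ultimately have "eigenvalue (map_mat of_int M) z"
    using M unfolding eigenvalue_def eigenvector_def by (intro exI[of _ "vec n e"]) auto
  then have "poly (map_poly of_int (char_poly M)) z = 0"
    using eigenvalue_root_char_poly[of "map_mat of_int M" n z] M by (simp add: of_int_hom.char_poly_hom[OF M])
  then show ?thesis using degree_monic_char_poly[OF M] unfolding algebraic_int_altdef_ipoly by auto
qed

lemma algebraic_int_iff_power_mem_span:
  fixes z :: "'a::field_char_0"
  shows "algebraic_int z \<longleftrightarrow> (\<exists>n>0. z ^ n \<in> int_module.span ((\<lambda>i. z ^ i) ` {..<n}))"
proof
  assume "algebraic_int z"
  then obtain p where p: "poly (map_poly of_int p) z = 0" "lead_coeff p = 1"
    unfolding algebraic_int_altdef_ipoly by blast
  let ?n = "degree p"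
  have "?n > 0"
  proof (rule ccontr)
    assume "\<not> ?n > 0"
    then have "p = [:1:]" using p(2) by (metis degree_0_id neq0_conv)
    then show False using p(1) by simp
  qed
  have "poly (map_poly of_int p) z = (\<Sum>i<?n. of_int (coeff p i) * z ^ i) + z ^ ?n"
    using p(2) by (simp add: poly_altdef coeff_map_poly lessThan_Suc_atMost[symmetric])
  then have "z ^ ?n = - (\<Sum>i<?n. of_int (coeff p i) * z ^ i)"
    using p(1) by (simp add: eq_neg_iff_add_eq_0 add.commute)
  also have "\<dots> \<in> int_module.span ((\<lambda>i. z ^ i) ` {..<?n})"
    by (intro int_module.span_neg int_module.span_sum int_module.span_scale int_module.span_base) auto
  finally show "\<exists>n>0. z ^ n \<in> int_module.span ((\<lambda>i. z ^ i) ` {..<n})" using \<open>?n > 0\<close> by blast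
next
  assume "\<exists>n>0. z ^ n \<in> int_module.span ((\<lambda>i. z ^ i) ` {..<n})"
  then obtain n where n: "n > 0" "z ^ n \<in> int_module.span ((\<lambda>i. z ^ i) ` {..<n})" by blast
  show "algebraic_int z"
  proof (rule algebraic_int_if_stable[of "(\<lambda>i. z ^ i) ` {..<n}" 1])
    show "1 \<in> (\<lambda>i. z ^ i) ` {..<n}" using n(1) by (intro image_eqI[of _ _ 0]) auto
    fix v assume "v \<in> (\<lambda>i. z ^ i) ` {..<n}"
    then obtain i where "i < n" "z * v = z ^ Suc i" by auto
    then show "z * v \<in> int_module.span ((\<lambda>i. z ^ i) ` {..<n})"
      using n(2) by (cases "Suc i = n") (auto intro!: int_module.span_base simp del: power_Suc)
  qed auto
qed

lemma int_span_mult_left: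
  assumes "\<And>v. v \<in> B \<Longrightarrow> c * v \<in> int_module.span C" "w \<in> int_module.span B"
  shows "c * w \<in> int_module.span C"
  using assms(2)
proof (induction rule: int_module.span_induct_alt)
  case (step n v w)
  have "c * (of_int n * v + w) = of_int n * (c * v) + c * w" by (simp add: algebra_simps)
  then show ?case using assms(1) step by (auto intro: int_module.span_add int_module.span_scale)
qed (simp add: int_module.span_zero)

lemma
  fixes x y :: "'a::field_char_0"
  assumes "algebraic_int x" "algebraic_int y"
  shows algebraic_int_add: "algebraic_int (x + y)" and algebraic_int_mult: "algebraic_int (x * y)"
proof -
  obtain n where n: "n > 0" "x ^ n \<in> int_module.span ((\<lambda>i. x ^ i) ` {..<n})"
    using assms(1) unfolding algebraic_int_iff_power_mem_span by blast
  obtain m where m: "m > 0" "y ^ m \<in> int_module.span ((\<lambda>j. y ^ j) ` {..<m})"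
    using assms(2) unfolding algebraic_int_iff_power_mem_span by blast
  define B where "B = (\<lambda>(i, j). x ^ i * y ^ j) ` ({..<n} \<times> {..<m})"
  have B: "x ^ i * y ^ j \<in> int_module.span B" if "i < n" "j < m" for i j
    using that by (intro int_module.span_base) (force simp: B_def)
  have x: "x * v \<in> int_module.span B" if "v \<in> B" for v
  proof -
    obtain i j where v: "v = x ^ i * y ^ j" "i < n" "j < m" using \<open>v \<in> B\<close> by (auto simp: B_def)
    have "y ^ j * x ^ n \<in> int_module.span B"
      using B v by (intro int_span_mult_left[OF _ n(2)]) (auto simp: mult.commute)
    then have "x ^ Suc i * y ^ j \<in> int_module.span B"
      using B[of "Suc i" j] v by (cases "Suc i = n") (auto simp: mult.commute simp del: power_Suc)
    then show ?thesis by (simp add: v(1) mult.assoc)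
  qed
  have y: "y * v \<in> int_module.span B" if "v \<in> B" for v
  proof -
    obtain i j where v: "v = x ^ i * y ^ j" "i < n" "j < m" using \<open>v \<in> B\<close> by (auto simp: B_def)
    have "x ^ i * y ^ m \<in> int_module.span B" using B v by (intro int_span_mult_left[OF _ m(2)]) auto
    then have "x ^ i * y ^ Suc j \<in> int_module.span B"
      using B[of i "Suc j"] v by (cases "Suc j = m") (auto simp del: power_Suc)
    then show ?thesis by (simp add: v(1) mult.left_commute)
  qed
  have "finite B" "1 \<in> B" using n(1) m(1) by (auto simp: B_def intro!: image_eqI[of _ _ "(0, 0)"])
  then show "algebraic_int (x + y)" "algebraic_int (x * y)"
    using x y int_span_mult_left[OF x]
    by (auto intro!: algebraic_int_if_stable[of B 1] int_module.span_add simp: distrib_right mult.assoc)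
qed

lemma algebraic_imp_int_multiple:
  fixes x :: "'a::field_char_0"
  assumes "algebraic x" shows "\<exists>n::int. n \<noteq> 0 \<and> algebraic_int (of_int n * x)"
proof -
  obtain p where p: "\<And>i. coeff p i \<in> \<int>" "p \<noteq> 0" "poly p x = 0" using assms by (auto simp: algebraic_def)
  define a where "a i = (the_inv of_int (coeff p i) :: int)" for i
  have coeff: "coeff p i = of_int (a i)" for i using of_int_the_inv[OF p(1)[of i]] by (simp add: a_def)
  define n where "n = degree p"
  define c where "c = a n"
  let ?z = "of_int c * x"
  have "n > 0"
  proof (rule ccontr)
    assume "\<not> n > 0"
    then obtain b where "p = [:b:]" unfolding n_def by (metis degree_eq_zeroE neq0_conv)
    then show False using p by simp
  qed
  have "poly p x = (\<Sum>i<n. of_int (a i) * x ^ i) + of_int c * x ^ n"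
    by (simp add: poly_altdef lessThan_Suc_atMost[symmetric] coeff n_def c_def)
  then have root: "of_int c * x ^ n = - (\<Sum>i<n. of_int (a i) * x ^ i)"
    using p(3) by (simp add: eq_neg_iff_add_eq_0 add.commute)
  have "?z ^ n = of_int (c ^ (n - 1)) * (of_int c * x ^ n)"
    using \<open>n > 0\<close> by (cases n) (auto simp: power_mult_distrib)
  also have "\<dots> = - (\<Sum>i<n. of_int (c ^ (n - 1)) * (of_int (a i) * x ^ i))" unfolding root by (simp add: sum_distrib_left)
  also have "\<dots> = - (\<Sum>i<n. of_int (c ^ (n - 1 - i) * a i) * ?z ^ i)"
  proof (intro arg_cong[of _ _ uminus] sum.cong refl)
    fix i assume "i \<in> {..<n}"
    then have "c ^ (n - 1) = c ^ (n - 1 - i) * c ^ i" by (simp flip: power_add)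
    then show "of_int (c ^ (n - 1)) * (of_int (a i) * x ^ i) = of_int (c ^ (n - 1 - i) * a i) * ?z ^ i"
      by (simp add: power_mult_distrib)
  qed
  also have "\<dots> \<in> int_module.span ((\<lambda>i. ?z ^ i) ` {..<n})"
    by (intro int_module.span_neg int_module.span_sum int_module.span_scale int_module.span_base) auto
  finally have "algebraic_int ?z" using \<open>n > 0\<close> unfolding algebraic_int_iff_power_mem_span by blast
  moreover have "c \<noteq> 0" using p(2) coeff[of n] by (auto simp: c_def n_def)
  ultimately show ?thesis by blast
qed

section \<open>Embeddings of fields\<close>

lemma ring_of_type_algebra_simps [simp]:
  "carrier ring_of_type_algebra = UNIV" "x \<otimes>\<^bsub>ring_of_type_algebra\<^esub> y = x * y" "\<one>\<^bsub>ring_of_type_algebra\<^esub> = 1"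
  "\<zero>\<^bsub>ring_of_type_algebra\<^esub> = 0" "x \<oplus>\<^bsub>ring_of_type_algebra\<^esub> y = x + y"
  by (simp_all add: ring_of_type_algebra_def)

interpretation type_field: Ring.domain "ring_of_type_algebra :: 'a::field ring"
  using field_from_type_algebra by (rule Ring.field.axioms)

lemma ring_of_type_algebra_minus [simp]: "\<ominus>\<^bsub>ring_of_type_algebra\<^esub> x = - (x::'a::field)"
  by (rule type_field.minus_equality) auto

lemma ring_of_type_algebra_inv [simp]: "x \<noteq> 0 \<Longrightarrow> inv\<^bsub>ring_of_type_algebra\<^esub> x = inverse (x::'a::field)"
  by (rule type_field.inv_unique'[symmetric]) auto

lemma ring_of_type_algebra_pow [simp]: "x [^]\<^bsub>ring_of_type_algebra\<^esub> (n::nat) = (x::'a::field) ^ n"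
  by (induction n) auto

text \<open>The library's \<open>univ_poly\<close> lists the coefficients from the leading one downwards.\<close>

definition hom_poly :: "('a \<Rightarrow> 'c::zero) \<Rightarrow> 'a list \<Rightarrow> 'c poly" where
  "hom_poly j p = Poly (rev (map j p))"

lemma eval_ring_of_type_algebra: "type_field.eval p z = poly (hom_poly id p) z"
  by (induction p) (auto simp: hom_poly_def Poly_append poly_monom)

lemma lead_coeff_hom_poly:
  assumes "p \<noteq> []" "j (hd p) \<noteq> 0"
  shows "degree (hom_poly j p) = length p - 1" and "lead_coeff (hom_poly j p) = j (hd p)"
proof -
  have top: "coeff (hom_poly j p) (length p - 1) = j (hd p)"
    using assms(1) by (simp add: hom_poly_def nth_default_def rev_nth hd_conv_nth)
  have "degree (hom_poly j p) \<le> length p - 1"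
    by (rule degree_le) (use assms(1) in \<open>auto simp: hom_poly_def nth_default_def\<close>)
  moreover have "length p - 1 \<le> degree (hom_poly j p)" by (rule le_degree) (use top assms(2) in simp)
  ultimately show "degree (hom_poly j p) = length p - 1" by simp
  then show "lead_coeff (hom_poly j p) = j (hd p)" using top by simp
qed

lemma coeff_hom_poly_mem: "j ` set p \<subseteq> T \<Longrightarrow> 0 \<in> T \<Longrightarrow> coeff (hom_poly j p) i \<in> T"
  by (auto simp: hom_poly_def nth_default_def rev_nth image_subset_iff)

abbreviation (in ring) int_elem :: "int \<Rightarrow> 'a" where
  "int_elem k \<equiv> [k] \<cdot> \<one>"

locale field_embedding = Ring.field R for R (structure) +
  fixes S and j :: "'a \<Rightarrow> 'c::field_char_0"
  assumes subfield: "subfield S R"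
    and map_one: "j \<one> = 1"
    and map_add: "x \<in> S \<Longrightarrow> y \<in> S \<Longrightarrow> j (x \<oplus> y) = j x + j y"
    and map_mult: "x \<in> S \<Longrightarrow> y \<in> S \<Longrightarrow> j (x \<otimes> y) = j x * j y"
begin

lemma subring: "subring S R"
  by (rule subfieldE(1)[OF subfield])

lemma subset_carrier: "S \<subseteq> carrier R"
  by (rule subfieldE(3)[OF subfield])

lemma restrict: "subfield T R \<Longrightarrow> T \<subseteq> S \<Longrightarrow> field_embedding R T j"
  using map_one map_add map_mult field_axioms by (auto simp: field_embedding_def field_embedding_axioms_def subset_iff)

lemma hom: "ring_hom_ring (R\<lparr>carrier := S\<rparr>) ring_of_type_algebra j"
proof (rule ring_hom_ringI2)
  show "ring (R\<lparr>carrier := S\<rparr>)" by (rule subring_is_ring[OF subring])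
  show "ring (ring_of_type_algebra :: 'c ring)" by (rule type_field.ring_axioms)
  show "j \<in> ring_hom (R\<lparr>carrier := S\<rparr>) ring_of_type_algebra"
    by (auto intro: ring_hom_memI simp: map_one map_add map_mult)
qed

lemma inj_on: "inj_on j S" and image_subfield: "subfield (j ` S) ring_of_type_algebra"
proof -
  interpret sub: Ring.field "R\<lparr>carrier := S\<rparr>" using subfield_iff(2)[OF subfield] .
  interpret hom: ring_hom_ring "R\<lparr>carrier := S\<rparr>" ring_of_type_algebra j by (rule hom)
  show "inj_on j S" "subfield (j ` S) ring_of_type_algebra"
    using hom.img_is_subfield[OF sub.carrier_is_subfield] by simp_all
qed

lemma map_eq_iff: "x \<in> S \<Longrightarrow> y \<in> S \<Longrightarrow> j x = j y \<longleftrightarrow> x = y"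
  using inj_on by (auto simp: inj_on_def)

lemma map_zero: "j \<zero> = 0"
  using ring_hom_zero[OF ring_hom_ring.homh[OF hom] subring_is_ring[OF subring] type_field.ring_axioms] by simp

lemma map_minus: assumes x: "x \<in> S" shows "j (\<ominus> x) = - j x"
proof -
  have "j (x \<oplus> \<ominus> x) = j x + j (\<ominus> x)" using map_add subringE(5)[OF subring] x by blast
  then show ?thesis using x subset_carrier map_zero by (auto simp: r_neg eq_neg_iff_add_eq_0 add.commute)
qed

lemma map_diff: "x \<in> S \<Longrightarrow> y \<in> S \<Longrightarrow> j (x \<ominus> y) = j x - j y"
  using map_add[of x "\<ominus> y"] map_minus[of y] subringE(5)[OF subring, of y] by (simp add: a_minus_def)

lemma pow_mem: "x \<in> S \<Longrightarrow> x [^] (n::nat) \<in> S"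
  using subringE(3,6)[OF subring] by (induction n) auto

lemma map_pow: "x \<in> S \<Longrightarrow> j (x [^] (n::nat)) = j x ^ n"
  by (induction n) (simp_all add: map_one map_mult pow_mem mult.commute)

lemma int_elem_mem: "int_elem k \<in> S" and map_int_elem: "j (int_elem k) = of_int k"
proof -
  have nat: "[n] \<cdot> \<one> \<in> S \<and> j ([n] \<cdot> \<one>) = of_nat n" for n :: nat
  proof (induction n)
    case (Suc n)
    then show ?case using subringE(3,7)[OF subring] by (simp add: add.nat_pow_Suc map_add map_one add.commute)
  qed (simp add: subringE(2)[OF subring] map_zero)
  have "int_elem k \<in> S \<and> j (int_elem k) = of_int k"
  proof (cases "k \<ge> 0")
    case True
    then show ?thesis using nat[of "nat k"] add_pow_int_ge[of k R \<one>] by simp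
  next
    case False
    then show ?thesis
      using nat[of "nat (- k)"] add_pow_int_lt[of k R \<one>] subringE(5)[OF subring] by (simp add: map_minus)
  qed
  then show "int_elem k \<in> S" "j (int_elem k) = of_int k" by auto
qed

lemma map_eval:
  assumes "x \<in> S" "set p \<subseteq> S" shows "poly (hom_poly j p) (j x) = j (eval p x)"
  using ring_hom_ring.eval_hom'[OF hom, of x p] assms eval_consistent[OF subring]
  by (simp add: eval_ring_of_type_algebra hom_poly_def)

lemma
  assumes "set p \<subseteq> S" "set q \<subseteq> S"
  shows poly_hom_poly_add: "poly (hom_poly j (poly_add p q)) z = poly (hom_poly j p) z + poly (hom_poly j q) z"
    and poly_hom_poly_mult: "poly (hom_poly j (poly_mult p q)) z = poly (hom_poly j p) z * poly (hom_poly j q) z"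
proof -
  interpret hom: ring_hom_ring "R\<lparr>carrier := S\<rparr>" ring_of_type_algebra j by (rule hom)
  have poly: "poly (hom_poly j p) z = type_field.eval (type_field.normalize (map j p)) z" for p
    using type_field.eval_normalize[of "map j p" z] by (simp add: eval_ring_of_type_algebra hom_poly_def)
  have "type_field.normalize (map j (poly_add p q)) = type_field.poly_add (map j p) (map j q)"
    using hom.poly_add_hom'[of p q] assms poly_add_consistent[OF subring] by simp
  then have "poly (hom_poly j (poly_add p q)) z = type_field.eval (type_field.poly_add (map j p) (map j q)) z"
    by (simp only: poly)
  then show "poly (hom_poly j (poly_add p q)) z = poly (hom_poly j p) z + poly (hom_poly j q) z"
    using type_field.eval_poly_add[of "map j p" "map j q" z] by (simp add: eval_ring_of_type_algebra hom_poly_def)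
  have "type_field.normalize (map j (poly_mult p q)) = type_field.poly_mult (map j p) (map j q)"
    using hom.poly_mult_hom'[of p q] assms poly_mult_consistent[OF subring] by simp
  then have "poly (hom_poly j (poly_mult p q)) z = type_field.eval (type_field.poly_mult (map j p) (map j q)) z"
    by (simp only: poly)
  then show "poly (hom_poly j (poly_mult p q)) z = poly (hom_poly j p) z * poly (hom_poly j q) z"
    using type_field.eval_poly_mult[of "map j p" "map j q" z] by (simp add: eval_ring_of_type_algebra hom_poly_def)
qed

subsection \<open>Extension of embeddings\<close>

lemma poly_hom_poly_cong:
  assumes x: "x \<in> carrier R" "(algebraic over S) x" and root: "poly (hom_poly j (Irr S x)) z = 0"
    and p: "p \<in> carrier (S[X])" and q: "q \<in> carrier (S[X])" and eq: "eval p x = eval q x"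
  shows "poly (hom_poly j p) z = poly (hom_poly j q) z"
proof -
  interpret univ_poly: Ring.domain "S[X]" by (rule univ_poly_is_domain[OF subring])
  have set: "set p \<subseteq> S" if "p \<in> carrier (S[X])" for p
    using that polynomial_incl by (simp add: univ_poly_carrier[symmetric])
  let ?r = "p \<ominus>\<^bsub>S[X]\<^esub> q"
  have r: "?r \<in> carrier (S[X])" and p_eq: "p = ?r \<oplus>\<^bsub>S[X]\<^esub> q"
    using p q by (simp_all add: a_minus_def univ_poly.a_assoc univ_poly.l_neg)
  note hom = eval_is_hom[OF subring x(1)]
  have closed: "eval p x \<in> carrier R" "eval ?r x \<in> carrier R" "eval q x \<in> carrier R"
    using ring_hom_memE(1)[OF hom] p q r by auto
  have "eval p x = eval ?r x \<oplus> eval q x" using p_eq ring_hom_memE(3)[OF hom r q] by simp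
  then have "eval ?r x = \<zero>" using eq closed by (metis add.r_cancel_one')
  then have "Irr S x pdivides ?r" by (rule Irr_minimal[OF subfield x r])
  then obtain s where s: "s \<in> carrier (S[X])" "?r = Irr S x \<otimes>\<^bsub>S[X]\<^esub> s"
    using pdivides_iff_shell[OF subfield IrrE(1)[OF subfield x] r] by (auto simp: factor_def)
  have "poly (hom_poly j ?r) z = 0"
    unfolding s(2) univ_poly_mult using poly_hom_poly_mult[OF set[OF IrrE(1)[OF subfield x]] set[OF s(1)]] root by simp
  then show ?thesis using poly_hom_poly_add[OF set[OF r] set[OF q], of z] p_eq by (simp add: univ_poly_add)
qed

lemma exists_embedding_simple_extension:
  assumes x: "x \<in> carrier R" "(algebraic over S) x" and root: "poly (hom_poly j (Irr S x)) z = 0"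
  shows "\<exists>j'. field_embedding R (simple_extension S x) j' \<and> (\<forall>y\<in>S. j' y = j y) \<and> j' x = z"
proof -
  note hom = eval_is_hom[OF subring x(1)]
  define j' where "j' u = poly (hom_poly j (SOME p. p \<in> carrier (S[X]) \<and> eval p x = u)) z" for u
  have j': "j' (eval p x) = poly (hom_poly j p) z" if p: "p \<in> carrier (S[X])" for p
    using someI[of "\<lambda>q. q \<in> carrier (S[X]) \<and> eval q x = eval p x" p] p
    unfolding j'_def by (intro poly_hom_poly_cong[OF x root _ p]) auto
  have image: "\<exists>p\<in>carrier (S[X]). u = eval p x" if "u \<in> simple_extension S x" for u
    using that simple_extension_as_eval_img[OF subset_carrier x(1)] by auto
  have j'_S: "j' y = j y" if y: "y \<in> S" for y
  proof -
    have "normalize [y] \<in> carrier (S[X])"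
      using normalize_gives_polynomial[of "[y]" S] y by (simp add: univ_poly_carrier)
    moreover have "eval (normalize [y]) x = y" using y subset_carrier x(1) by auto
    moreover have "poly (hom_poly j (normalize [y])) z = j y" by (simp add: hom_poly_def map_zero)
    ultimately show ?thesis using j' by metis
  qed
  have "j' x = z"
  proof -
    have "[\<one>, \<zero>] \<in> carrier (S[X])"
      using subringE(2,3)[OF subring] by (simp add: univ_poly_carrier[symmetric] polynomial_def)
    moreover have "eval [\<one>, \<zero>] x = x" using x(1) by simp
    moreover have "poly (hom_poly j [\<one>, \<zero>]) z = z" by (simp add: hom_poly_def map_zero map_one)
    ultimately show ?thesis using j' by metis
  qed
  moreover have "field_embedding R (simple_extension S x) j'"
  proof (intro field_embedding.intro field_embedding_axioms.intro field_axioms)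
    show "subfield (simple_extension S x) R" using simple_extension_is_subfield[OF subfield x(1)] x(2) by simp
    show "j' \<one> = 1" using j'_S[OF subringE(3)[OF subring]] map_one by simp
    fix u v assume "u \<in> simple_extension S x" "v \<in> simple_extension S x"
    then obtain p q where p: "p \<in> carrier (S[X])" "u = eval p x" and q: "q \<in> carrier (S[X])" "v = eval q x"
      using image by metis
    interpret univ_poly: Ring.domain "S[X]" by (rule univ_poly_is_domain[OF subring])
    have "set p \<subseteq> S" "set q \<subseteq> S" using p q polynomial_incl by (auto simp: univ_poly_carrier[symmetric])
    then show "j' (u \<oplus> v) = j' u + j' v" "j' (u \<otimes> v) = j' u * j' v"
      using j'[OF univ_poly.a_closed[OF p(1) q(1)]] j'[OF univ_poly.m_closed[OF p(1) q(1)]] j'[OF p(1)] j'[OF q(1)]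
        ring_hom_memE(2,3)[OF hom p(1) q(1)] p(2) q(2) poly_hom_poly_add poly_hom_poly_mult
      by (simp_all add: univ_poly_add univ_poly_mult)
  qed
  ultimately show ?thesis using j'_S by blast
qed

end

lemma (in Ring.field) length_Irr_ge_2:
  assumes S: "subfield S R" and x: "x \<in> carrier R" "(algebraic over S) x" shows "length (Irr S x) \<ge> 2"
proof -
  have "Irr S x \<noteq> []" using pirreducibleE(1)[OF subfieldE(1)[OF S] IrrE(1,2)[OF S x]] .
  moreover have "length (Irr S x) \<noteq> 1"
  proof
    assume "length (Irr S x) = 1"
    then have "Irr S x = [\<one>]" using IrrE(3)[OF S x] by (cases "Irr S x") auto
    then show False using IrrE(4)[OF S x] x(1) by simp
  qed
  ultimately show ?thesis by (cases "Irr S x"; cases "tl (Irr S x)") auto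
qed

lemma (in field_embedding)
  assumes x: "x \<in> carrier R" "(algebraic over S) x"
  shows degree_hom_poly_Irr: "Polynomial.degree (hom_poly j (Irr S x)) = length (Irr S x) - 1"
    and lead_coeff_hom_poly_Irr: "Polynomial.lead_coeff (hom_poly j (Irr S x)) = 1"
    and coeff_hom_poly_Irr_mem: "Polynomial.coeff (hom_poly j (Irr S x)) i \<in> j ` S"
proof -
  have "Irr S x \<noteq> []" using length_Irr_ge_2[OF subfield x] by auto
  then show "Polynomial.degree (hom_poly j (Irr S x)) = length (Irr S x) - 1"
    "Polynomial.lead_coeff (hom_poly j (Irr S x)) = 1"
    using lead_coeff_hom_poly[of "Irr S x" j] IrrE(3)[OF subfield x] map_one by simp_all
  have "set (Irr S x) \<subseteq> S" using IrrE(1)[OF subfield x] polynomial_incl by (simp add: univ_poly_carrier[symmetric])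
  then show "Polynomial.coeff (hom_poly j (Irr S x)) i \<in> j ` S"
    using map_zero subringE(2)[OF subring] by (intro coeff_hom_poly_mem) (auto intro: image_eqI[of _ _ \<zero>])
qed

lemma (in Ring.field) exists_embedding_finite_extension:
  fixes j :: "'a \<Rightarrow> 'c::{alg_closed_field, field_char_0}"
  assumes j: "field_embedding R S j" and xs: "set xs \<subseteq> carrier R" "\<And>x. x \<in> set xs \<Longrightarrow> (algebraic over S) x"
  shows "\<exists>j'. field_embedding R (finite_extension S xs) j' \<and> (\<forall>y\<in>S. j' y = j y)"
  using xs
proof (induction xs)
  case Nil
  then show ?case using j by auto
next
  case (Cons x xs)
  let ?T = "finite_extension S xs"
  obtain j\<^sub>T where j\<^sub>T: "field_embedding R ?T j\<^sub>T" "\<And>y. y \<in> S \<Longrightarrow> j\<^sub>T y = j y" using Cons by force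
  interpret j\<^sub>T: field_embedding R ?T j\<^sub>T by (rule j\<^sub>T(1))
  have subset: "S \<subseteq> ?T" using Cons.prems field_embedding.subset_carrier[OF j] by (intro finite_extension_incl) auto
  have x: "x \<in> carrier R" "(algebraic over ?T) x" using Cons.prems algebraic_mono[OF subset, of x] by auto
  have "Polynomial.degree (hom_poly j\<^sub>T (Irr ?T x)) > 0"
    using j\<^sub>T.degree_hom_poly_Irr[OF x] length_Irr_ge_2[OF j\<^sub>T.subfield x] by simp
  then obtain z where "poly (hom_poly j\<^sub>T (Irr ?T x)) z = 0" using alg_closed_imp_poly_has_root by blast
  then obtain j' where "field_embedding R (simple_extension ?T x) j'" "\<forall>y\<in>?T. j' y = j\<^sub>T y"
    using j\<^sub>T.exists_embedding_simple_extension[OF x] by blast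
  then show ?case using j\<^sub>T(2) subset by (intro exI[of _ j']) auto
qed

lemma (in Ring.field) finite_dimension_as_finite_extension:
  assumes S: "subfield S R" "subfield K R" "S \<subseteq> K" and finite: "finite_dimension S K"
  obtains us where "set us \<subseteq> K" "finite_extension S us = K" "\<And>x. x \<in> K \<Longrightarrow> (algebraic over S) x"
proof -
  obtain n where "dimension n S K" using finite by auto
  then obtain us where us: "set us \<subseteq> carrier R" "Span S us = K" using exists_base[OF S(1)] by metis
  have algebraic: "(algebraic over S) x" if "x \<in> K" for x
    using finite_dimension_imp_algebraic[OF S(1) subfieldE(1)[OF S(2)] finite that] .
  have us_K: "set us \<subseteq> K" using Span_base_incl[OF S(1) us(1)] us(2) by simp
  have sub: "subring (finite_extension S us) R" by (rule finite_extension_is_subring[OF subfieldE(1)[OF S(1)] us(1)])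
  have "subalgebra S (finite_extension S us) R"
    using sub subringE(6)[OF sub] finite_extension_incl[OF subfieldE(3)[OF S(1)] us(1)]
    by (auto simp: subalgebra_def subalgebra_axioms_def subring_def)
  then have "K \<subseteq> finite_extension S us"
    using subalgebra_Span_incl[OF S(1)] finite_extension_mem[OF subfieldE(1)[OF S(1)] us(1)] us(2) by blast
  moreover have "finite_extension S us \<subseteq> K" by (rule finite_extension_subring_incl[OF subfieldE(1)[OF S(2)] S(3) us_K])
  ultimately show ?thesis using that us_K algebraic by blast
qed

subsection \<open>Rational elements\<close>

context Ring.field
begin

lemma int_elem_add: "int_elem (a + b) = int_elem a \<oplus> int_elem b"
  by (simp add: add.int_pow_mult)

lemma int_elem_mult: "int_elem (a * b) = int_elem a \<otimes> int_elem b"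
proof -
  have "int_elem a \<otimes> int_elem b = [a] \<cdot> (\<one> \<otimes> int_elem b)" by (rule add_pow_ldistr_int) auto
  also have "\<dots> = int_elem (a * b)" by (simp add: add.int_pow_pow mult.commute)
  finally show ?thesis by simp
qed

lemma int_elem_inj:
  assumes char: "char_zero_field R" and eq: "int_elem a = int_elem b" shows "a = b"
proof (rule ccontr)
  assume "a \<noteq> b"
  have nonzero: "int_elem c \<noteq> \<zero>" if "c > 0" for c :: int
    using char that add_pow_int_ge[of c R \<one>] by (simp add: char_zero_field_def)
  have "int_elem (a - b) \<oplus> int_elem b = int_elem b" "int_elem (b - a) \<oplus> int_elem a = int_elem a"
    using int_elem_add[of "a - b" b] int_elem_add[of "b - a" a] eq by auto
  then have "int_elem (a - b) = \<zero>" "int_elem (b - a) = \<zero>" by (metis add.r_cancel_one add.int_pow_closed one_closed)+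
  then show False using nonzero[of "a - b"] nonzero[of "b - a"] \<open>a \<noteq> b\<close> by (cases "a > b") auto
qed

definition rat_embedding :: "'a \<Rightarrow> 'c::field_char_0" where
  "rat_embedding x = (SOME c. \<exists>(a::int) (b::int). b \<noteq> 0 \<and> x \<otimes> int_elem b = int_elem a \<and> c = of_int a / of_int b)"

lemma rat_embedding_eq:
  assumes char: "char_zero_field R" and x: "x \<in> carrier R" "b \<noteq> 0" "x \<otimes> int_elem b = int_elem a"
  shows "rat_embedding x = of_int a / of_int b"
proof -
  have "\<exists>c. \<exists>(a::int) (b::int). b \<noteq> 0 \<and> x \<otimes> int_elem b = int_elem a \<and> c = (of_int a / of_int b :: 'c)" using x by blast
  from someI_ex[OF this] obtain a' b' where ab': "b' \<noteq> 0" "x \<otimes> int_elem b' = int_elem a'"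
    and eq: "(rat_embedding x :: 'c) = of_int a' / of_int b'"
    unfolding rat_embedding_def by blast
  have "int_elem (a' * b) = (x \<otimes> int_elem b') \<otimes> int_elem b" by (simp add: ab'(2) int_elem_mult)
  also have "\<dots> = (x \<otimes> int_elem b) \<otimes> int_elem b'" using x(1) by (simp add: m_assoc m_comm[of "int_elem b"])
  also have "\<dots> = int_elem (a * b')" by (simp add: x(3) int_elem_mult)
  finally have "a' * b = a * b'" by (rule int_elem_inj[OF char])
  then have "(of_int a' * of_int b :: 'c) = of_int a * of_int b'" by (metis of_int_mult)
  then show ?thesis unfolding eq using ab'(1) x(2) by (simp add: field_simps)
qed

lemma field_embedding_rat_embedding:
  assumes char: "char_zero_field R" and subfield: "subfield (rat_img R) R"
  shows "field_embedding R (rat_img R) rat_embedding"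
proof (intro field_embedding.intro field_embedding_axioms.intro field_axioms subfield)
  show "rat_embedding \<one> = 1" using rat_embedding_eq[OF char, of \<one> 1 1] by simp
  fix x y assume "x \<in> rat_img R" "y \<in> rat_img R"
  then obtain a b c d where x: "x \<in> carrier R" "b \<noteq> 0" "x \<otimes> int_elem b = int_elem a"
    and y: "y \<in> carrier R" "d \<noteq> 0" "y \<otimes> int_elem d = int_elem c"
    unfolding rat_img_def by blast
  note eqs = rat_embedding_eq[OF char x] rat_embedding_eq[OF char y]
  have "(x \<oplus> y) \<otimes> int_elem (b * d) = (x \<otimes> int_elem b) \<otimes> int_elem d \<oplus> (y \<otimes> int_elem d) \<otimes> int_elem b"
    using x(1) y(1) by (simp add: int_elem_mult l_distr m_assoc m_comm[of "int_elem b"] m_lcomm)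
  also have "\<dots> = int_elem (a * d + c * b)" by (simp add: x y int_elem_mult int_elem_add)
  finally have "rat_embedding (x \<oplus> y) = of_int (a * d + c * b) / of_int (b * d)"
    using x y by (intro rat_embedding_eq[OF char]) auto
  then show "rat_embedding (x \<oplus> y) = rat_embedding x + rat_embedding y"
    unfolding eqs using x(2) y(2) by (simp add: add_frac_eq)
  have "(x \<otimes> y) \<otimes> int_elem (b * d) = (x \<otimes> int_elem b) \<otimes> (y \<otimes> int_elem d)"
    using x(1) y(1) by (simp add: int_elem_mult m_assoc m_lcomm)
  also have "\<dots> = int_elem (a * c)" by (simp add: x y int_elem_mult)
  finally have "rat_embedding (x \<otimes> y) = of_int (a * c) / of_int (b * d)"
    using x y by (intro rat_embedding_eq[OF char]) auto
  then show "rat_embedding (x \<otimes> y) = rat_embedding x * rat_embedding y" unfolding eqs by simp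
qed

end

context field_embedding
begin

lemma map_fraction:
  assumes "x \<in> S" "b \<noteq> 0" "x \<otimes> int_elem b = int_elem a" shows "j x = of_int a / of_int b"
  using map_mult[OF assms(1) int_elem_mem[of b]] assms by (simp add: map_int_elem field_simps)

lemma map_rat_img: assumes "x \<in> S" "x \<in> rat_img R" shows "j x \<in> \<rat>"
  using assms map_fraction[OF assms(1)] by (auto simp: rat_img_def)

lemma map_algebraic:
  assumes rat: "subfield (rat_img R) R" "rat_img R \<subseteq> S" and x: "x \<in> S" "(algebraic over (rat_img R)) x"
  shows "Polynomial.algebraic (j x)"
proof -
  obtain p where p: "p \<in> carrier ((rat_img R)[X])" "p \<noteq> []" "eval p x = \<zero>"
    using algebraicE[OF subfieldE(1)[OF rat(1)] _ x(2)] x(1) subset_carrier by blast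
  have coeffs: "set p \<subseteq> rat_img R" "hd p \<noteq> \<zero>" using p(1,2) by (auto simp: univ_poly_carrier[symmetric] polynomial_def)
  have "hd p \<in> S" using p(2) coeffs(1) rat(2) hd_in_set[of p] by blast
  then have "j (hd p) \<noteq> 0" using coeffs(2) map_eq_iff[of "hd p" \<zero>] map_zero subringE(2)[OF subring] by simp
  then have "hom_poly j p \<noteq> 0" using lead_coeff_hom_poly(2)[of p j] p(2) by auto
  moreover have "Polynomial.coeff (hom_poly j p) i \<in> \<rat>" for i
    using coeffs(1) rat(2) map_rat_img by (intro coeff_hom_poly_mem) auto
  moreover have "poly (hom_poly j p) (j x) = 0"
    using map_eval[OF x(1), of p] coeffs(1) rat(2) p(3) map_zero by auto
  ultimately show ?thesis unfolding algebraic_altdef by blast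
qed

lemma subring_preimage: assumes T: "subring T ring_of_type_algebra" shows "subring {x \<in> S. j x \<in> T} R"
proof (rule subringI)
  note closed = subringE[OF T, simplified] and S_closed = subringE[OF subring]
  show "{x \<in> S. j x \<in> T} \<subseteq> carrier R" using subset_carrier by blast
  show "\<one> \<in> {x \<in> S. j x \<in> T}" using S_closed(3) closed(3) map_one by simp
  fix x assume x: "x \<in> {x \<in> S. j x \<in> T}"
  then show "\<ominus> x \<in> {x \<in> S. j x \<in> T}" using S_closed(5) closed(5) map_minus by simp
  fix y assume "y \<in> {x \<in> S. j x \<in> T}"
  then show "x \<otimes> y \<in> {x \<in> S. j x \<in> T}" "x \<oplus> y \<in> {x \<in> S. j x \<in> T}"
    using x S_closed(6,7) closed(6,7) map_mult map_add by simp_all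
qed

lemma subring_equalizer: assumes k: "field_embedding R S k" shows "subring {x \<in> S. j x = k x} R"
proof (rule subringI)
  interpret k: field_embedding R S k by (rule k)
  note S_closed = subringE[OF subring]
  show "{x \<in> S. j x = k x} \<subseteq> carrier R" using subset_carrier by blast
  show "\<one> \<in> {x \<in> S. j x = k x}" using S_closed(3) map_one k.map_one by simp
  fix x assume x: "x \<in> {x \<in> S. j x = k x}"
  then show "\<ominus> x \<in> {x \<in> S. j x = k x}" using S_closed(5) map_minus k.map_minus by simp
  fix y assume "y \<in> {x \<in> S. j x = k x}"
  then show "x \<otimes> y \<in> {x \<in> S. j x = k x}" "x \<oplus> y \<in> {x \<in> S. j x = k x}"
    using x S_closed(6,7) map_mult map_add k.map_mult k.map_add by simp_all
qed

end

lemma type_subfield_closed: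
  fixes N :: "'a::field set"
  assumes N: "subfield N ring_of_type_algebra"
  shows "0 \<in> N" "1 \<in> N" "x \<in> N \<Longrightarrow> y \<in> N \<Longrightarrow> x + y \<in> N" "x \<in> N \<Longrightarrow> y \<in> N \<Longrightarrow> x * y \<in> N"
    "x \<in> N \<Longrightarrow> - x \<in> N" "x \<in> N \<Longrightarrow> y \<in> N \<Longrightarrow> x - y \<in> N" "x \<in> N \<Longrightarrow> inverse x \<in> N"
proof -
  note closed = subringE[OF subfieldE(1)[OF N], simplified]
  show "0 \<in> N" "1 \<in> N" "x \<in> N \<Longrightarrow> y \<in> N \<Longrightarrow> x + y \<in> N" "x \<in> N \<Longrightarrow> y \<in> N \<Longrightarrow> x * y \<in> N" "x \<in> N \<Longrightarrow> - x \<in> N"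
    using closed by auto
  show "x \<in> N \<Longrightarrow> y \<in> N \<Longrightarrow> x - y \<in> N" using closed(7)[of x "- y"] closed(5)[of y] by simp
  show "inverse x \<in> N" if "x \<in> N"
    using that type_field.subfield_m_inv(1)[OF N, of x] closed(2) by (cases "x = 0") auto
qed

lemma field_embedding_type_iff:
  "field_embedding (ring_of_type_algebra :: 'a::field ring) N \<sigma> \<longleftrightarrow> subfield N (ring_of_type_algebra :: 'a ring) \<and>
    \<sigma> 1 = 1 \<and> (\<forall>x\<in>N. \<forall>y\<in>N. \<sigma> (x + y) = \<sigma> x + \<sigma> y \<and> \<sigma> (x * y) = \<sigma> x * \<sigma> y)"
  by (auto simp: field_embedding_def field_embedding_axioms_def field_from_type_algebra)

lemma type_int_elem [simp]: "[k] \<cdot>\<^bsub>ring_of_type_algebra\<^esub> (1::'a::field_char_0) = of_int (k::int)"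
proof -
  have "field_embedding (ring_of_type_algebra :: 'a ring) UNIV id"
    using field.carrier_is_subfield[OF field_from_type_algebra] by (simp add: field_embedding_type_iff)
  from field_embedding.map_int_elem[OF this] show ?thesis by simp
qed

lemma rat_img_type: "rat_img (ring_of_type_algebra :: 'a::field_char_0 ring) = \<rat>"
proof -
  have "x \<in> \<rat> \<longleftrightarrow> (\<exists>a b. b \<noteq> 0 \<and> x * of_int b = of_int a)" for x :: 'a
  proof
    assume "x \<in> \<rat>"
    then obtain a b where "b > 0" "x = of_int a / of_int b" by (metis Rats_cases')
    then show "\<exists>a b. b \<noteq> 0 \<and> x * of_int b = of_int a" by (intro exI[of _ a] exI[of _ b]) auto
  next
    assume "\<exists>a b. b \<noteq> 0 \<and> x * of_int b = of_int a"
    then obtain a b where "b \<noteq> 0" "x = of_int a / of_int b" by (auto simp: field_simps)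
    then show "x \<in> \<rat>" by simp
  qed
  then show ?thesis by (simp add: rat_img_def set_eq_iff)
qed

lemma subfield_Rats: "subfield \<rat> (ring_of_type_algebra :: 'a::field_char_0 ring)"
proof (rule field.subfieldI'[OF field_from_type_algebra])
  show "subring \<rat> (ring_of_type_algebra :: 'a ring)" by (rule type_field.subringI) auto
  show "inv\<^bsub>ring_of_type_algebra\<^esub> k \<in> \<rat>" if "k \<in> \<rat> - {\<zero>\<^bsub>ring_of_type_algebra\<^esub>}" for k :: 'a using that by auto
qed

lemma Rats_subset_type_subfield:
  fixes N :: "'a::field_char_0 set"
  assumes N: "subfield N ring_of_type_algebra" shows "\<rat> \<subseteq> N"
proof
  fix x :: 'a assume "x \<in> \<rat>"
  then obtain a b where x: "x = of_int a / of_int b" by (auto elim: Rats_cases')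
  have "field_embedding ring_of_type_algebra N id" using N by (simp add: field_embedding_type_iff)
  from field_embedding.int_elem_mem[OF this] have "of_int k \<in> N" for k by simp
  then show "x \<in> N" unfolding x divide_inverse by (intro type_subfield_closed[OF N])
qed

lemma embedding_fixes_Rats:
  fixes x :: "'a::field_char_0"
  assumes \<sigma>: "field_embedding ring_of_type_algebra N \<sigma>" and x: "x \<in> \<rat>" shows "\<sigma> x = x"
proof -
  obtain a b where ab: "b \<noteq> 0" "x = of_int a / of_int b" using x by (metis Rats_cases' less_irrefl)
  have "x \<in> N" using Rats_subset_type_subfield[OF field_embedding.subfield[OF \<sigma>]] x by blast
  then have "\<sigma> x = of_int a / of_int b"
    using ab by (intro field_embedding.map_fraction[OF \<sigma>]) simp_all
  then show ?thesis using ab by simp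
qed

lemma embedding_poly_rational:
  fixes q :: "'a::field_char_0 poly"
  assumes \<sigma>: "field_embedding ring_of_type_algebra N \<sigma>" and q: "\<And>i. coeff q i \<in> \<rat>" and x: "x \<in> N"
  shows "\<sigma> (poly q x) = poly q (\<sigma> x)"
proof -
  have coeffs: "set (coeffs q) \<subseteq> \<rat>" using q by (auto simp: coeffs_def)
  then have "map \<sigma> (coeffs q) = coeffs q" using embedding_fixes_Rats[OF \<sigma>] by (intro map_idI) blast
  then have "hom_poly \<sigma> (rev (coeffs q)) = q" "hom_poly id (rev (coeffs q)) = q" by (simp_all add: hom_poly_def rev_map)
  moreover have "set (rev (coeffs q)) \<subseteq> N"
    using coeffs Rats_subset_type_subfield[OF field_embedding.subfield[OF \<sigma>]] by auto
  ultimately show ?thesis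
    using field_embedding.map_eval[OF \<sigma> x, of "rev (coeffs q)"] by (simp add: eval_ring_of_type_algebra)
qed

section \<open>Splitting fields over the rationals\<close>

locale splitting_field =
  fixes f :: "complex poly"
  assumes nonzero: "f \<noteq> 0" and coeff_Rats: "coeff f i \<in> \<rat>"
begin

definition roots :: "complex list" where
  "roots = (SOME xs. set xs = {z. poly f z = 0})"

definition N :: "complex set" where
  "N = type_field.finite_extension \<rat> roots"

lemma set_roots: "set roots = {z. poly f z = 0}"
  unfolding roots_def using finite_list[OF poly_roots_finite[OF nonzero]] by (rule someI_ex)

lemma algebraic_over_Rats_root: "z \<in> set roots \<Longrightarrow> (type_field.algebraic over \<rat>) z"
proof (rule type_field.algebraicI)
  assume z: "z \<in> set roots"
  have nonempty: "coeffs f \<noteq> []" using nonzero by simp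
  then have "hd (rev (coeffs f)) \<noteq> 0" using nonzero by (simp add: hd_rev last_coeffs_eq_coeff_degree)
  moreover have "set (rev (coeffs f)) \<subseteq> \<rat>" using coeff_Rats by (auto simp: coeffs_def)
  ultimately show "rev (coeffs f) \<in> carrier (univ_poly ring_of_type_algebra \<rat>)"
    by (simp add: univ_poly_carrier[symmetric] polynomial_def)
  show "rev (coeffs f) \<noteq> []" using nonempty by simp
  show "type_field.eval (rev (coeffs f)) z = \<zero>\<^bsub>ring_of_type_algebra\<^esub>"
    using z by (simp add: set_roots eval_ring_of_type_algebra hom_poly_def)
qed

lemma subfield_N: "subfield N ring_of_type_algebra"
  unfolding N_def
  by (rule type_field.finite_extension_is_subfield[OF subfield_Rats]) (auto simp: algebraic_over_Rats_root)

lemmas N_closed = type_subfield_closed[OF subfield_N]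

lemma Rats_subset_N: "\<rat> \<subseteq> N"
  by (rule Rats_subset_type_subfield[OF subfield_N])

lemma roots_subset_N: "set roots \<subseteq> N"
  unfolding N_def by (rule type_field.finite_extension_mem[OF subfieldE(1)[OF subfield_Rats]]) auto

lemma N_subset: "subring T ring_of_type_algebra \<Longrightarrow> \<rat> \<subseteq> T \<Longrightarrow> set roots \<subseteq> T \<Longrightarrow> N \<subseteq> T"
  unfolding N_def by (rule type_field.finite_extension_subring_incl)

lemma algebraic_over_Rats: "x \<in> N \<Longrightarrow> (type_field.algebraic over \<rat>) x"
  unfolding N_def
  by (rule type_field.finite_extesion_mem_imp_algebraic[OF subfield_Rats, of roots]) (auto simp: algebraic_over_Rats_root)

lemma exists_int_multiple: assumes x: "x \<in> N" shows "\<exists>n::int. n \<noteq> 0 \<and> algebraic_int (of_int n * x)"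
proof -
  interpret id: field_embedding ring_of_type_algebra N "id :: complex \<Rightarrow> complex"
    using subfield_N by (simp add: field_embedding_type_iff)
  have "algebraic x"
    using id.map_algebraic[OF _ _ x] algebraic_over_Rats[OF x] subfield_Rats Rats_subset_N by (simp add: rat_img_type)
  then show ?thesis by (rule algebraic_imp_int_multiple)
qed

subsection \<open>The Galois group\<close>

definition Gal :: "(complex \<Rightarrow> complex) set" where
  "Gal = {\<sigma>. field_embedding ring_of_type_algebra N \<sigma> \<and> (\<forall>x. x \<notin> N \<longrightarrow> \<sigma> x = x)}"

lemma Gal_embedding: "\<sigma> \<in> Gal \<Longrightarrow> field_embedding ring_of_type_algebra N \<sigma>"
  and Gal_outside: "\<sigma> \<in> Gal \<Longrightarrow> x \<notin> N \<Longrightarrow> \<sigma> x = x"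
  by (auto simp: Gal_def)

lemma GalI:
  assumes j: "field_embedding ring_of_type_algebra N j" shows "(\<lambda>x. if x \<in> N then j x else x) \<in> Gal"
  using j N_closed by (simp add: Gal_def field_embedding_type_iff)

lemma Gal_one: "\<sigma> \<in> Gal \<Longrightarrow> \<sigma> 1 = 1"
  and Gal_add: "\<sigma> \<in> Gal \<Longrightarrow> x \<in> N \<Longrightarrow> y \<in> N \<Longrightarrow> \<sigma> (x + y) = \<sigma> x + \<sigma> y"
  and Gal_mult: "\<sigma> \<in> Gal \<Longrightarrow> x \<in> N \<Longrightarrow> y \<in> N \<Longrightarrow> \<sigma> (x * y) = \<sigma> x * \<sigma> y"
  by (simp_all add: Gal_def field_embedding_type_iff)

lemma Gal_diff: "\<sigma> \<in> Gal \<Longrightarrow> x \<in> N \<Longrightarrow> y \<in> N \<Longrightarrow> \<sigma> (x - y) = \<sigma> x - \<sigma> y"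
  using Gal_add[of \<sigma> "x - y" y] N_closed(6) by simp

lemma Gal_Rats: "\<sigma> \<in> Gal \<Longrightarrow> x \<in> \<rat> \<Longrightarrow> \<sigma> x = x"
  by (rule embedding_fixes_Rats[OF Gal_embedding])

lemma embedding_image:
  assumes \<sigma>: "field_embedding ring_of_type_algebra N \<sigma>" shows "\<sigma> ` N = N"
proof
  interpret \<sigma>: field_embedding ring_of_type_algebra N \<sigma> by (rule \<sigma>)
  have root: "\<sigma> z \<in> set roots" if z: "z \<in> set roots" for z
  proof -
    have "poly f (\<sigma> z) = \<sigma> (poly f z)"
      using embedding_poly_rational[OF \<sigma> coeff_Rats] z roots_subset_N by auto
    then show ?thesis using z \<sigma>.map_zero by (simp add: set_roots)
  qed
  have Rats: "\<sigma> x = x" if "x \<in> \<rat>" for x using that by (rule embedding_fixes_Rats[OF \<sigma>])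
  have "N \<subseteq> {x \<in> N. \<sigma> x \<in> N}"
    using Rats root Rats_subset_N roots_subset_N
    by (intro N_subset \<sigma>.subring_preimage subfieldE(1)[OF subfield_N]) auto
  then show "\<sigma> ` N \<subseteq> N" by blast
  have "inj_on \<sigma> (set roots)" using \<sigma>.inj_on roots_subset_N by (rule inj_on_subset)
  then have "\<sigma> ` set roots = set roots" using root by (intro endo_inj_surj) auto
  moreover have "\<rat> \<subseteq> \<sigma> ` N"
  proof
    fix x :: complex assume "x \<in> \<rat>"
    then show "x \<in> \<sigma> ` N" using Rats[of x] Rats_subset_N by (intro image_eqI[of _ _ x]) auto
  qed
  ultimately show "N \<subseteq> \<sigma> ` N"
    using image_mono[OF roots_subset_N, of \<sigma>] by (intro N_subset subfieldE(1)[OF \<sigma>.image_subfield]) auto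
qed

lemma Gal_image: "\<sigma> \<in> Gal \<Longrightarrow> \<sigma> ` N = N"
  by (rule embedding_image[OF Gal_embedding])

lemma Gal_mem: "\<sigma> \<in> Gal \<Longrightarrow> x \<in> N \<Longrightarrow> \<sigma> x \<in> N"
  using Gal_image by blast

lemma Gal_inj: assumes \<sigma>: "\<sigma> \<in> Gal" shows "inj \<sigma>"
proof (rule injI)
  fix x y assume eq: "\<sigma> x = \<sigma> y"
  then have "x \<in> N \<longleftrightarrow> y \<in> N" using Gal_mem[OF \<sigma>] Gal_outside[OF \<sigma>] by metis
  then show "x = y"
    using eq Gal_outside[OF \<sigma>] field_embedding.map_eq_iff[OF Gal_embedding[OF \<sigma>]] by metis
qed

lemma finite_Gal: "finite Gal"
proof -
  let ?r = "\<lambda>\<sigma>. restrict \<sigma> (set roots)"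
  have "?r ` Gal \<subseteq> set roots \<rightarrow>\<^sub>E set roots"
  proof (rule image_subsetI)
    fix \<sigma> assume \<sigma>: "\<sigma> \<in> Gal"
    have "\<sigma> z \<in> set roots" if z: "z \<in> set roots" for z
      using embedding_poly_rational[OF Gal_embedding[OF \<sigma>] coeff_Rats, of z] z roots_subset_N Gal_Rats[OF \<sigma>, of 0]
      by (auto simp: set_roots)
    then show "?r \<sigma> \<in> set roots \<rightarrow>\<^sub>E set roots" by auto
  qed
  then have "finite (?r ` Gal)" by (rule finite_subset) (intro finite_PiE, auto)
  moreover have "inj_on ?r Gal"
  proof (rule inj_onI)
    fix \<sigma> \<tau> assume \<sigma>: "\<sigma> \<in> Gal" and \<tau>: "\<tau> \<in> Gal" and eq: "?r \<sigma> = ?r \<tau>"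
    have "\<sigma> z = \<tau> z" if "z \<in> set roots" for z using fun_cong[OF eq, of z] that by simp
    then have "N \<subseteq> {x \<in> N. \<sigma> x = \<tau> x}"
      using Rats_subset_N roots_subset_N Gal_Rats[OF \<sigma>] Gal_Rats[OF \<tau>]
      by (intro N_subset field_embedding.subring_equalizer Gal_embedding \<sigma> \<tau>) auto
    then show "\<sigma> = \<tau>"
      using Gal_outside[OF \<sigma>] Gal_outside[OF \<tau>] by (intro ext) (metis (mono_tags, lifting) mem_Collect_eq subsetD)
  qed
  ultimately show ?thesis using finite_imageD by blast
qed

lemma id_Gal: "id \<in> Gal"
  using subfield_N by (simp add: Gal_def field_embedding_type_iff)

lemma comp_Gal: assumes g: "g \<in> Gal" and h: "h \<in> Gal" shows "g \<circ> h \<in> Gal"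
proof -
  have "field_embedding ring_of_type_algebra N (g \<circ> h)"
    using subfield_N g h by (simp add: field_embedding_type_iff Gal_one Gal_add Gal_mult Gal_mem)
  then show ?thesis using Gal_outside[OF g] Gal_outside[OF h] by (simp add: Gal_def)
qed

lemma inverse_Gal: assumes g: "g \<in> Gal" shows "\<exists>h\<in>Gal. h \<circ> g = id \<and> g \<circ> h = id"
proof -
  have inj: "inj (\<lambda>h :: complex \<Rightarrow> complex. g \<circ> h)" using Gal_inj[OF g] by (rule fun.inj_map)
  then have "(\<lambda>h. g \<circ> h) ` Gal = Gal"
    using comp_Gal[OF g] finite_Gal by (intro endo_inj_surj inj_on_subset[OF inj]) auto
  then obtain h where h: "h \<in> Gal" "g \<circ> h = id" using id_Gal by (metis imageE)
  have "g \<circ> (h \<circ> g) = g \<circ> id" using h(2) by (simp add: comp_assoc[symmetric])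
  then have "h \<circ> g = id" by (rule injD[OF inj])
  then show ?thesis using h by blast
qed

lemma exists_conjugate:
  fixes x :: complex
  assumes S: "subfield S ring_of_type_algebra" and x: "(type_field.algebraic over S) x" "x \<notin> S"
  shows "\<exists>z. z \<noteq> x \<and> poly (hom_poly id (type_field.Irr S x)) z = 0"
proof (rule ccontr)
  assume neg: "\<not> ?thesis"
  interpret id: field_embedding ring_of_type_algebra S "id :: complex \<Rightarrow> complex"
    using S by (simp add: field_embedding_type_iff)
  note S_closed = type_subfield_closed[OF S]
  let ?p = "hom_poly id (type_field.Irr S x)"
  have p: "lead_coeff ?p = 1" "degree ?p = length (type_field.Irr S x) - 1" "coeff ?p i \<in> S" for i
    using id.lead_coeff_hom_poly_Irr[of x] id.degree_hom_poly_Irr[of x] id.coeff_hom_poly_Irr_mem[of x] x(1) by simp_all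
  define n where "n = degree ?p"
  have n: "n > 0" using p(2) field.length_Irr_ge_2[OF field_from_type_algebra S _ x(1)] by (simp add: n_def)
  have "poly ?p x = 0"
    using type_field.IrrE(4)[OF S _ x(1)] by (simp add: eval_ring_of_type_algebra)
  then have "{z. poly ?p z = 0} = {x}" using neg by auto
  then have power: "?p = [:- x, 1:] ^ Polynomial.order x ?p" using complex_poly_decompose[of ?p] p(1) by simp
  then have "Polynomial.order x ?p = n" unfolding n_def by (metis degree_linear_power)
  then have "coeff ?p (n - 1) = of_nat (n choose (n - 1)) * (- x)"
    using power n
    by (metis coeff_linear_poly_power[of "n - 1" n "- x" 1] One_nat_def Suc_pred diff_diff_cancel diff_le_self
        mult.right_neutral one_le_numeral power_one power_one_right Suc_leI)
  then have "- (of_nat n * x) \<in> S" using p(3)[of "n - 1"] n binomial_symmetric[of 1 n] by simp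
  then have "of_nat n * x \<in> S" using S_closed(5) by fastforce
  moreover have "inverse (of_nat n) \<in> S" using Rats_subset_type_subfield[OF S] by auto
  ultimately have "inverse (of_nat n) * (of_nat n * x) \<in> S" by (rule S_closed(4)[rotated])
  then show False using x(2) n by (simp add: mult.assoc[symmetric])
qed

lemma exists_Gal_extension:
  assumes j: "field_embedding ring_of_type_algebra T j"
  shows "\<exists>\<sigma>\<in>Gal. \<forall>y\<in>T \<inter> N. \<sigma> y = j y"
proof -
  interpret j: field_embedding ring_of_type_algebra T j by (rule j)
  let ?E = "type_field.finite_extension T roots"
  have Rats: "\<rat> \<subseteq> T" by (rule Rats_subset_type_subfield[OF j.subfield])
  have "(type_field.algebraic over T) z" if "z \<in> set roots" for z
    using algebraic_over_Rats_root[OF that] by (rule type_field.algebraic_mono[OF Rats])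
  then obtain j' where j': "field_embedding ring_of_type_algebra ?E j'" "\<forall>y\<in>T. j' y = j y"
    using field.exists_embedding_finite_extension[OF field_from_type_algebra j, of roots] by auto
  have "N \<subseteq> ?E"
  proof (rule N_subset)
    show "subring ?E ring_of_type_algebra" by (rule type_field.finite_extension_is_subring[OF j.subring]) auto
    show "\<rat> \<subseteq> ?E" using Rats type_field.finite_extension_incl[of T roots] by auto
    show "set roots \<subseteq> ?E" by (rule type_field.finite_extension_mem[OF j.subring]) simp
  qed
  then have "(\<lambda>x. if x \<in> N then j' x else x) \<in> Gal"
    by (intro GalI field_embedding.restrict[OF j'(1) subfield_N])
  then show ?thesis using j'(2) by (intro bexI[of _ "\<lambda>x. if x \<in> N then j' x else x"]) auto
qed

lemma exists_Gal_moving: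
  assumes S: "subfield S ring_of_type_algebra" and x: "x \<in> N" "x \<notin> S"
  shows "\<exists>\<sigma>\<in>Gal. (\<forall>y\<in>S \<inter> N. \<sigma> y = y) \<and> \<sigma> x \<noteq> x"
proof -
  interpret id: field_embedding ring_of_type_algebra S "id :: complex \<Rightarrow> complex"
    using S by (simp add: field_embedding_type_iff)
  have algebraic: "(type_field.algebraic over S) x"
    by (rule type_field.algebraic_mono[OF Rats_subset_type_subfield[OF S] algebraic_over_Rats[OF x(1)]])
  obtain z where z: "z \<noteq> x" "poly (hom_poly id (type_field.Irr S x)) z = 0"
    using exists_conjugate[OF S algebraic x(2)] by blast
  obtain j where j: "field_embedding ring_of_type_algebra (type_field.simple_extension S x) j" "\<forall>y\<in>S. j y = y" "j x = z"
    using id.exists_embedding_simple_extension[OF _ algebraic z(2)] by auto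
  obtain \<sigma> where \<sigma>: "\<sigma> \<in> Gal" "\<forall>y\<in>type_field.simple_extension S x \<inter> N. \<sigma> y = j y"
    using exists_Gal_extension[OF j(1)] by blast
  have "S \<subseteq> type_field.simple_extension S x" "x \<in> type_field.simple_extension S x"
    using type_field.simple_extension_incl[of S x] type_field.simple_extension_mem[OF id.subring, of x] by simp_all
  then show ?thesis using \<sigma> j(2,3) x(1) z(1) by (intro bexI[of _ \<sigma>]) auto
qed

subsection \<open>The ring of integers\<close>

definition ON :: "complex set" where
  "ON = {x \<in> N. algebraic_int x}"

lemma Gal_ON: assumes g: "g \<in> Gal" and x: "x \<in> ON" shows "g x \<in> ON"
proof -
  obtain p where p: "lead_coeff p = 1" "\<forall>i. coeff p i \<in> \<int>" "poly p x = 0"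
    using x by (auto simp: ON_def algebraic_int.simps)
  have "poly p (g x) = g (poly p x)"
    using p(2) Ints_subset_Rats x
    by (intro embedding_poly_rational[symmetric, OF Gal_embedding[OF g]]) (auto simp: ON_def)
  also have "\<dots> = 0" using p(3) Gal_Rats[OF g, of 0] by simp
  finally have "algebraic_int (g x)" using p by (intro algebraic_int.intros) auto
  then show ?thesis using Gal_mem[OF g] x by (simp add: ON_def)
qed

lemma Gal_eq_id_if_fixes_ON:
  assumes g: "g \<in> Gal" and fixes_ON: "\<And>x. x \<in> ON \<Longrightarrow> g x = x" shows "g = id"
proof
  fix x show "g x = id x"
  proof (cases "x \<in> N")
    case True
    obtain n :: int where n: "n \<noteq> 0" "algebraic_int (of_int n * x)" using exists_int_multiple[OF True] by blast
    have of_int: "of_int n \<in> N" using Rats_subset_N by auto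
    then have "of_int n * x \<in> ON" using n N_closed(4) True by (simp add: ON_def)
    then have "g (of_int n) * g x = of_int n * x" using fixes_ON Gal_mult[OF g of_int True] by simp
    then show ?thesis using n(1) Gal_Rats[OF g, of "of_int n"] by simp
  qed (simp add: Gal_outside[OF g])
qed

lemma fixed_ON_in_Ints:
  assumes x: "x \<in> ON" and fixed: "\<And>g. g \<in> Gal \<Longrightarrow> g x = x" shows "x \<in> \<int>"
proof -
  have "x \<in> \<rat>" using exists_Gal_moving[OF subfield_Rats, of x] x fixed by (auto simp: ON_def)
  then show ?thesis using x by (auto simp: ON_def intro: rational_algebraic_int_is_int)
qed

end

sublocale splitting_field \<subseteq> normed_galois_ring ON Gal
proof unfold_locales
  show "1 \<in> ON" using N_closed by (simp add: ON_def)
  show "x - y \<in> ON" if "x \<in> ON" "y \<in> ON" for x y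
    using that N_closed(6) algebraic_int_add[of x "- y"] by (auto simp: ON_def)
  show "x * y \<in> ON" if "x \<in> ON" "y \<in> ON" for x y
    using that N_closed(4) algebraic_int_mult[of x y] by (auto simp: ON_def)
  show "g (x - y) = g x - g y" "g (x * y) = g x * g y" if "g \<in> Gal" "x \<in> ON" "y \<in> ON" for g x y
    using that by (simp_all add: ON_def Gal_diff Gal_mult)
qed (fact finite_Gal id_Gal comp_Gal inverse_Gal Gal_ON Gal_one Gal_eq_id_if_fixes_ON fixed_ON_in_Ints)+

subsection \<open>Relative Galois groups\<close>

lemma (in Ring.field) length_Irr_le_dimension:
  assumes F: "subfield F R" and M: "subring M R" "F \<subseteq> M" "dimension n F M" and x: "x \<in> M"
  shows "length (Irr F x) - 1 \<le> n"
proof -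
  have algebraic: "x \<in> carrier R" "(algebraic over F) x"
    using x subringE(1)[OF M(1)] finite_dimension_imp_algebraic[OF F M(1) finite_dimensionI[OF M(3)] x] by auto
  obtain Us where Us: "set Us \<subseteq> carrier R" "independent F Us" "length Us = length (Irr F x) - 1"
      "Span F Us = simple_extension F x"
    using exists_base[OF F dimension_simple_extension[OF F algebraic]] by blast
  have "set Us \<subseteq> M"
    using Span_base_incl[OF F Us(1)] Us(4) simple_extension_subring_incl[OF M(1,2) x] by blast
  then show ?thesis using independent_length_le_dimension[OF F M(3) Us(2)] Us(3) by simp
qed

locale base_embedding = splitting_field f + base: field_embedding R F \<iota>
  for f and R (structure) and F and \<iota> :: "'a \<Rightarrow> complex" +
  assumes base_image: "\<iota> ` F \<subseteq> N"
begin

definition Gal_F :: "(complex \<Rightarrow> complex) set" where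
  "Gal_F = {g \<in> Gal. \<forall>x\<in>F. g (\<iota> x) = \<iota> x}"

lemma Gal_F_subset: "g \<in> Gal_F \<Longrightarrow> g \<in> Gal"
  and Gal_F_fixes: "g \<in> Gal_F \<Longrightarrow> x \<in> F \<Longrightarrow> g (\<iota> x) = \<iota> x"
  by (auto simp: Gal_F_def)

sublocale relative: finite_perm_group Gal_F
proof
  show "finite Gal_F" using finite_G by (simp add: Gal_F_def)
  show "id \<in> Gal_F" using id_mem by (simp add: Gal_F_def)
  show "g \<circ> h \<in> Gal_F" if "g \<in> Gal_F" "h \<in> Gal_F" for g h using that comp_mem by (simp add: Gal_F_def)
  show "\<exists>h\<in>Gal_F. h \<circ> g = id \<and> g \<circ> h = id" if g: "g \<in> Gal_F" for g
  proof -
    obtain h where h: "h \<in> Gal" "h \<circ> g = id" "g \<circ> h = id" using inverse_mem[OF Gal_F_subset[OF g]] by blast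
    have "h (\<iota> x) = \<iota> x" if "x \<in> F" for x using fun_cong[OF h(2), of "\<iota> x"] Gal_F_fixes[OF g that] by simp
    then show ?thesis using h by (auto simp: Gal_F_def)
  qed
qed

end

locale F_extension = base_embedding f R F \<iota> + ext: field_embedding R M j
  for f and R (structure) and F and \<iota> :: "'a \<Rightarrow> complex" and M and j :: "'a \<Rightarrow> complex" +
  assumes base_subset: "F \<subseteq> M" and map_base: "x \<in> F \<Longrightarrow> j x = \<iota> x" and image: "j ` M \<subseteq> N"
begin

lemma map_mem: "x \<in> M \<Longrightarrow> j x \<in> N"
  using image by blast

lemma conjugate_extension: assumes g: "g \<in> Gal_F" shows "F_extension f R F \<iota> M (g \<circ> j)"
proof -
  have Gal: "g \<in> Gal" by (rule Gal_F_subset[OF g])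
  have "field_embedding R M (g \<circ> j)"
    using base.field_axioms ext.subfield
    by (intro field_embedding.intro field_embedding_axioms.intro)
      (simp_all add: ext.map_one ext.map_add ext.map_mult Gal_one[OF Gal] Gal_add[OF Gal] Gal_mult[OF Gal] map_mem)
  moreover have "F_extension_axioms f F \<iota> M (g \<circ> j)"
    using base_subset map_base Gal_F_fixes[OF g] Gal_mem[OF Gal] map_mem by (auto simp: F_extension_axioms_def)
  ultimately show ?thesis using base_embedding_axioms by (simp add: F_extension_def)
qed

lemma mem_image_if_fixed:
  assumes y: "y \<in> N" and fixed: "\<And>g. g \<in> Gal_F \<Longrightarrow> (\<And>x. x \<in> M \<Longrightarrow> g (j x) = j x) \<Longrightarrow> g y = y"
  shows "y \<in> j ` M"
proof (rule ccontr)
  assume "y \<notin> j ` M"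
  then obtain g where g: "g \<in> Gal" "\<forall>z\<in>j ` M \<inter> N. g z = z" "g y \<noteq> y"
    using exists_Gal_moving[OF ext.image_subfield y] by blast
  then have fixes_M: "g (j x) = j x" if "x \<in> M" for x using that map_mem by auto
  then have "g (\<iota> x) = \<iota> x" if "x \<in> F" for x using base_subset map_base[OF that] that by (metis subsetD)
  then have "g \<in> Gal_F" using g(1) by (simp add: Gal_F_def)
  then show False using fixed[OF _ fixes_M] g(3) by blast
qed

definition primitive :: "'a \<Rightarrow> bool" where
  "primitive \<alpha> \<longleftrightarrow> \<alpha> \<in> M \<and> algebraic_int (j \<alpha>) \<and> (\<forall>g\<in>Gal_F. g (j \<alpha>) = j \<alpha> \<longrightarrow> (\<forall>x\<in>M. g (j x) = j x))"

lemma exists_primitive: "\<exists>\<alpha>. primitive \<alpha>"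
proof -
  note closed = type_subfield_closed[OF ext.image_subfield]
  have Rats: "\<rat> \<subseteq> j ` M" by (rule Rats_subset_type_subfield[OF ext.image_subfield])
  define T where "T = {g \<in> Gal_F. \<exists>y\<in>j ` M. g y \<noteq> y}"
  have T: "g \<in> Gal" if "g \<in> T" for g using that Gal_F_subset by (simp add: T_def)
  have map_multiple: "g (of_int n * y) = of_int n * g y" if "g \<in> Gal" "y \<in> j ` M" for g n y
  proof -
    have "of_int n \<in> N" "y \<in> N" using that(2) image Rats_subset_N by auto
    then show ?thesis using Gal_mult[OF that(1)] Gal_Rats[OF that(1), of "of_int n"] by simp
  qed
  have "\<exists>v\<in>j ` M. \<forall>\<tau>\<in>T. \<tau> v \<noteq> v"
  proof (rule exists_moved_by_all)
    show "finite T" unfolding T_def using relative.finite_G by simp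
    show "j ` M \<noteq> {}" using closed(1) by blast
    have of_nat_mult: "of_nat n * y \<in> j ` M" if "y \<in> j ` M" for y n using Rats that by (intro closed(4)) auto
    show "x + of_nat n * y \<in> j ` M" if "x \<in> j ` M" "y \<in> j ` M" for x y n
      by (intro closed(3) that of_nat_mult)
    show "\<tau> (x + of_nat n * y) = \<tau> x + of_nat n * \<tau> y" if "\<tau> \<in> T" "x \<in> j ` M" "y \<in> j ` M" for \<tau> x y n
      using Gal_add[OF T[OF that(1)], of x "of_nat n * y"] map_multiple[OF T[OF that(1)] that(3), of "int n"]
        of_nat_mult[OF that(3)] that(2) image by auto
  qed (simp add: T_def)
  then obtain v where v: "v \<in> j ` M" "\<And>\<tau>. \<tau> \<in> T \<Longrightarrow> \<tau> v \<noteq> v" by blast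
  obtain n :: int where n: "n \<noteq> 0" "algebraic_int (of_int n * v)" using exists_int_multiple[of v] v(1) image by blast
  have "of_int n * v \<in> j ` M" using Rats v(1) by (intro closed(4)) auto
  then obtain \<alpha> where \<alpha>: "\<alpha> \<in> M" "j \<alpha> = of_int n * v" by auto
  have "g (j x) = j x" if g: "g \<in> Gal_F" "g (j \<alpha>) = j \<alpha>" and x: "x \<in> M" for g x
  proof -
    have "of_int n * g v = of_int n * v" using g map_multiple[OF Gal_F_subset[OF g(1)] v(1)] \<alpha>(2) by simp
    then have "g v = v" using n(1) by simp
    then have "g \<notin> T" using v(2) by blast
    then show ?thesis using g(1) x by (auto simp: T_def)
  qed
  then show ?thesis using \<alpha> n(2) by (auto simp: primitive_def)
qed

lemma primitive_conjugate:
  assumes g: "g \<in> Gal_F" and \<alpha>: "primitive \<alpha>" shows "F_extension.primitive f F \<iota> M (g \<circ> j) \<alpha>"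
proof -
  interpret conj: F_extension f R F \<iota> M "g \<circ> j" by (rule conjugate_extension[OF g])
  obtain h where h: "h \<in> Gal_F" "\<And>x. h (g x) = x" "\<And>x. g (h x) = x" using relative.exists_inverse[OF g] by blast
  have "algebraic_int (g (j \<alpha>))"
    using Gal_ON[OF Gal_F_subset[OF g], of "j \<alpha>"] \<alpha> map_mem by (simp add: primitive_def ON_def)
  moreover have "k (g (j x)) = g (j x)" if k: "k \<in> Gal_F" "k (g (j \<alpha>)) = g (j \<alpha>)" and x: "x \<in> M" for k x
  proof -
    have "h \<circ> (k \<circ> g) \<in> Gal_F" by (intro relative.comp_mem h(1) k(1) g)
    moreover have "(h \<circ> (k \<circ> g)) (j \<alpha>) = j \<alpha>" using k(2) h(2) by simp
    ultimately have "(h \<circ> (k \<circ> g)) (j x) = j x" using \<alpha> x unfolding primitive_def by blast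
    then show ?thesis using h(3)[of "k (g (j x))"] by simp
  qed
  ultimately show ?thesis using \<alpha> by (simp add: conj.primitive_def primitive_def)
qed

lemma card_conjugates_le_ext_degree:
  assumes dim: "base.dimension n F M" and \<alpha>: "\<alpha> \<in> M"
  shows "card (relative.conjugates (j \<alpha>)) \<le> ext_degree R F M"
proof -
  have degree: "ext_degree R F M = n"
    unfolding ext_degree_def by (rule the_equality) (use dim base.dimension_is_inj[OF base.subfield] in auto)
  have x: "\<alpha> \<in> carrier R" "(base.algebraic over F) \<alpha>"
    using \<alpha> ext.subset_carrier
      base.finite_dimension_imp_algebraic[OF base.subfield ext.subring base.finite_dimensionI[OF dim] \<alpha>]
    by auto
  let ?I = "base.Irr F \<alpha>" and ?p = "hom_poly \<iota> (base.Irr F \<alpha>)"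
  have "?p \<noteq> 0" using base.lead_coeff_hom_poly_Irr[OF x] by auto
  have "relative.conjugates (j \<alpha>) \<subseteq> {z. poly ?p z = 0}"
  proof
    fix z assume "z \<in> relative.conjugates (j \<alpha>)"
    then obtain g where g: "g \<in> Gal_F" "z = g (j \<alpha>)" by (auto simp: relative.conjugates_eq)
    interpret conj: F_extension f R F \<iota> M "g \<circ> j" by (rule conjugate_extension[OF g(1)])
    have I: "set ?I \<subseteq> F"
      using base.IrrE(1)[OF base.subfield x] base.polynomial_incl by (simp add: univ_poly_carrier[symmetric])
    then have "?p = hom_poly (g \<circ> j) ?I"
      using conj.map_base by (auto simp: hom_poly_def intro!: arg_cong[of _ _ Poly] map_cong)
    then show "z \<in> {z. poly ?p z = 0}"
      using conj.ext.map_eval[OF \<alpha> subset_trans[OF I base_subset]] base.IrrE(4)[OF base.subfield x] conj.ext.map_zero g(2)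
      by simp
  qed
  then have "card (relative.conjugates (j \<alpha>)) \<le> card {z. poly ?p z = 0}"
    by (rule card_mono[OF poly_roots_finite[OF \<open>?p \<noteq> 0\<close>]])
  also have "\<dots> \<le> degree ?p" by (rule card_poly_roots_bound[OF \<open>?p \<noteq> 0\<close>])
  finally show ?thesis
    using base.length_Irr_le_dimension[OF base.subfield ext.subring base_subset dim \<alpha>]
      base.degree_hom_poly_Irr[OF x] degree by linarith
qed

end

lemma (in base_embedding) base_extension: "F_extension f R F \<iota> F \<iota>"
  using base_embedding_axioms base.field_embedding_axioms base_image
  by (simp add: F_extension_def F_extension_axioms_def)

lemma F_isomorphic_if_images_eq:
  assumes K: "field_embedding R K j" "F \<subseteq> K" and L: "field_embedding R L i" "F \<subseteq> L"
    and image: "j ` K = i ` L" and base: "\<And>x. x \<in> F \<Longrightarrow> j x = i x"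
  shows "F_isomorphic R F K L"
proof -
  interpret j: field_embedding R K j by (rule K(1))
  interpret i: field_embedding R L i by (rule L(1))
  define \<psi> where "\<psi> x = inv_into L i (j x)" for x
  have \<psi>: "\<psi> x \<in> L" "i (\<psi> x) = j x" if "x \<in> K" for x
    using that image inv_into_into[of "j x" i L] f_inv_into_f[of "j x" i L] by (auto simp: \<psi>_def)
  have \<psi>_eqI: "\<psi> x = y" if "x \<in> K" "y \<in> L" "j x = i y" for x y
    unfolding \<psi>_def using that i.inj_on by simp
  note K_closed = subringE[OF j.subring] and L_closed = subringE[OF i.subring]
  have "\<psi> \<in> ring_hom (R\<lparr>carrier := K\<rparr>) (R\<lparr>carrier := L\<rparr>)"
    by (rule ring_hom_memI)
      (auto intro!: \<psi>_eqI simp: \<psi> K_closed L_closed j.map_one i.map_one j.map_add i.map_add j.map_mult i.map_mult)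
  moreover have "bij_betw \<psi> K L"
  proof (rule bij_betwI')
    show "\<psi> x = \<psi> y \<longleftrightarrow> x = y" if "x \<in> K" "y \<in> K" for x y
      using \<psi>(2)[OF that(1)] \<psi>(2)[OF that(2)] j.map_eq_iff[OF that] by metis
    show "\<psi> x \<in> L" if "x \<in> K" for x using \<psi>(1)[OF that] .
    show "\<exists>x\<in>K. y = \<psi> x" if y: "y \<in> L" for y
    proof -
      have "i y \<in> j ` K" using image y by blast
      then show ?thesis using \<psi>_eqI y by (metis imageE)
    qed
  qed
  ultimately have "\<psi> \<in> ring_iso (R\<lparr>carrier := K\<rparr>) (R\<lparr>carrier := L\<rparr>)" by (simp add: ring_iso_def)
  moreover have "\<psi> x = x" if "x \<in> F" for x using \<psi>_eqI[of x x] base[OF that] K(2) L(2) that by blast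
  ultimately show ?thesis unfolding F_isomorphic_def by blast
qed

lemma F_isomorphic_if_equal_stabilizers:
  assumes K: "F_extension f R F \<iota> K j" "F_extension.primitive f F \<iota> K j \<alpha>"
    and L: "F_extension f R F \<iota> L i" "F_extension.primitive f F \<iota> L i \<beta>"
    and stabilizers: "\<And>g. g \<in> base_embedding.Gal_F f F \<iota> \<Longrightarrow> g (j \<alpha>) = j \<alpha> \<longleftrightarrow> g (i \<beta>) = i \<beta>"
  shows "F_isomorphic R F K L"
proof -
  interpret K: F_extension f R F \<iota> K j by (rule K(1))
  interpret L: F_extension f R F \<iota> L i by (rule L(1))
  note \<alpha> = K(2)[unfolded K.primitive_def] and \<beta> = L(2)[unfolded L.primitive_def]
  have "j ` K \<subseteq> i ` L"
    using K.image \<alpha> \<beta> stabilizers by (intro image_subsetI L.mem_image_if_fixed) blast+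
  moreover have "i ` L \<subseteq> j ` K"
    using L.image \<alpha> \<beta> stabilizers by (intro image_subsetI K.mem_image_if_fixed) blast+
  ultimately show ?thesis
    using K.base_subset L.base_subset K.map_base L.map_base
    by (intro F_isomorphic_if_images_eq[OF K.ext.field_embedding_axioms _ L.ext.field_embedding_axioms]) auto
qed

section \<open>Rings of integers\<close>

context field_embedding
begin

lemma ring_of_integers_subset: "ring_of_integers R S \<subseteq> S"
  by (auto simp: ring_of_integers_def)

lemma algebraic_int_map:
  assumes "x \<in> ring_of_integers R S" shows "algebraic_int (j x)"
proof -
  obtain p where p: "p \<noteq> []" "hd p = \<one>" "set p \<subseteq> int_img R" "eval p x = \<zero>" and x: "x \<in> S"
    using assms by (auto simp: ring_of_integers_def)
  have "set p \<subseteq> S" using p(3) int_elem_mem by (auto simp: int_img_def)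
  then have "poly (hom_poly j p) (j x) = 0" using map_eval[OF x] p(4) map_zero by simp
  moreover have "Polynomial.coeff (hom_poly j p) i \<in> \<int>" for i
    using p(3) map_int_elem by (intro coeff_hom_poly_mem) (auto simp: int_img_def)
  moreover have "Polynomial.lead_coeff (hom_poly j p) = 1" using lead_coeff_hom_poly(2)[of p j] p(1,2) map_one by simp
  ultimately show ?thesis by (intro algebraic_int.intros[of "hom_poly j p"]) auto
qed

lemma mem_ring_of_integersI:
  assumes x: "x \<in> S" "algebraic_int (j x)" shows "x \<in> ring_of_integers R S"
proof -
  obtain P where P: "poly (map_poly of_int P) (j x) = 0" "Polynomial.lead_coeff P = 1"
    using x(2) unfolding algebraic_int_altdef_ipoly by blast
  define p where "p = rev (map int_elem (coeffs P))"
  have nonempty: "coeffs P \<noteq> []" using P(2) by auto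
  have p_S: "set p \<subseteq> S" using int_elem_mem by (auto simp: p_def)
  have "hom_poly j p = map_poly of_int P"
    by (simp add: hom_poly_def p_def rev_map map_poly_def map_int_elem comp_def)
  then have "j (eval p x) = j \<zero>" using map_eval[OF x(1) p_S] P(1) map_zero by simp
  moreover have "eval p x \<in> S"
    using ring.eval_in_carrier[OF subring_is_ring[OF subring], of p x] p_S x(1) eval_consistent[OF subring] by simp
  ultimately have "eval p x = \<zero>" using map_eq_iff subringE(2)[OF subring] by simp
  moreover have "hd p = \<one>" using nonempty P(2) by (simp add: p_def hd_rev last_map last_coeffs_eq_coeff_degree)
  moreover have "set p \<subseteq> int_img R" "p \<noteq> []" using nonempty by (auto simp: p_def int_img_def)
  ultimately show ?thesis using x(1) unfolding ring_of_integers_def by blast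
qed

lemma mem_ring_of_integers_iff: "x \<in> S \<Longrightarrow> x \<in> ring_of_integers R S \<longleftrightarrow> algebraic_int (j x)"
  using algebraic_int_map mem_ring_of_integersI by blast

lemma subring_ring_of_integers: "subring (ring_of_integers R S) R"
proof (rule subringI)
  note closed = subringE[OF subring]
  have D: "x \<in> S" "algebraic_int (j x)" if "x \<in> ring_of_integers R S" for x
    using that ring_of_integers_subset algebraic_int_map by auto
  show "ring_of_integers R S \<subseteq> carrier R" using ring_of_integers_subset closed(1) by blast
  show "\<one> \<in> ring_of_integers R S" using closed(3) by (intro mem_ring_of_integersI) (simp_all add: map_one)
  fix x assume x: "x \<in> ring_of_integers R S"
  then show "\<ominus> x \<in> ring_of_integers R S"
    using D closed(5) by (intro mem_ring_of_integersI) (simp_all add: map_minus)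
  fix y assume y: "y \<in> ring_of_integers R S"
  show "x \<otimes> y \<in> ring_of_integers R S" "x \<oplus> y \<in> ring_of_integers R S"
    using D[OF x] D[OF y] closed(6,7)
    by (auto intro!: mem_ring_of_integersI algebraic_int_add algebraic_int_mult simp: map_add map_mult)
qed

end

subsection \<open>Finite residue fields\<close>

lemma (in ring) card_eq_if_dimension:
  assumes K: "subfield K R" "finite K" and dim: "dimension n K E" shows "card E = card K ^ n"
proof -
  obtain Us where Us: "set Us \<subseteq> carrier R" "independent K Us" "length Us = n" "Span K Us = E"
    using exists_base[OF K(1) dim] by blast
  let ?L = "{Ks. set Ks \<subseteq> K \<and> length Ks = n}"
  have Span: "combine Ks Us \<in> E" if "Ks \<in> ?L" for Ks
    using Span_eq_combine_set_length_version[OF K(1) Us(1)] that Us(3,4) by auto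
  have "bij_betw (\<lambda>Ks. combine Ks Us) ?L E"
  proof (rule bij_betwI')
    fix Ks Ks' assume Ks: "Ks \<in> ?L" "Ks' \<in> ?L"
    show "combine Ks Us = combine Ks' Us \<longleftrightarrow> Ks = Ks'"
      using unique_decomposition[OF K(1) Us(2), of "combine Ks Us"] Span[OF Ks(1)] Ks Us(3,4) by auto
  next
    show "\<exists>Ks\<in>?L. y = combine Ks Us" if "y \<in> E" for y
      using Span_eq_combine_set_length_version[OF K(1) Us(1)] that Us(3,4) by auto
  qed (rule Span)
  then have "card ?L = card E" by (rule bij_betw_same_card)
  then show ?thesis using card_lists_length_eq[OF K(2), of n] by simp
qed

lemma (in domain) finite_domain_is_field:
  assumes "finite (carrier R)" shows "field R"
proof (rule cring_fieldI2)
  show "\<zero> \<noteq> \<one>" using one_not_zero by simp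
  fix a assume a: "a \<in> carrier R" "a \<noteq> \<zero>"
  have "inj_on (\<lambda>b. a \<otimes> b) (carrier R)" by (rule inj_onI) (use m_lcancel[OF a(2,1)] in blast)
  then have "(\<lambda>b. a \<otimes> b) ` carrier R = carrier R" using a by (intro endo_inj_surj assms) auto
  then show "\<exists>b\<in>carrier R. a \<otimes> b = \<one>" using one_closed by (metis imageE)
qed

lemma (in domain) finite_subring_is_subfield:
  assumes K: "subring K R" "finite K" shows "subfield K R"
proof -
  interpret K: domain "R\<lparr>carrier := K\<rparr>" by (rule subring_is_domain[OF K(1)])
  show ?thesis using K.finite_domain_is_field K(2) subfield_iff(1)[OF _ subringE(1)[OF K(1)]] by simp
qed

lemma (in Ring.field) pow_card_carrier:
  assumes finite: "finite (carrier R)" and x: "x \<in> carrier R" shows "x [^] card (carrier R) = x"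
proof -
  have pos: "card (carrier R) > 0" using finite x by (auto simp: card_gt_0_iff)
  show ?thesis
  proof (cases "x = \<zero>")
    case True
    then show ?thesis using pos nat_pow_zero by simp
  next
    case False
    interpret mult: group "Multiplicative_Group.mult_of R" by (rule field_mult_group)
    have "x [^] (card (carrier R) - 1) = \<one>"
      using mult.pow_order_eq_1[of x] False x order_mult_of[OF finite]
      by (simp add: Multiplicative_Group.nat_pow_mult_of Coset.order_def)
    moreover have "x [^] card (carrier R) = x [^] (card (carrier R) - 1) \<otimes> x"
      using pos by (metis nat_pow_Suc Suc_diff_1)
    ultimately show ?thesis using x by simp
  qed
qed

section \<open>Splitting types at a Frobenius element\<close>

lemma (in splitting_field) primeideal_ON:
  assumes Q: "is_prime_ideal Q" shows "primeideal Q (ring_of_type_algebra\<lparr>carrier := ON\<rparr>)"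
proof -
  note ideal = prime_ideal_ideal[OF Q]
  have "subring ON ring_of_type_algebra" by (rule type_field.subringI) (auto simp: mem_simps)
  then interpret ON: domain "ring_of_type_algebra\<lparr>carrier := ON\<rparr>" by (rule type_field.subring_is_domain)
  have inv: "\<ominus>\<^bsub>ring_of_type_algebra\<lparr>carrier := ON\<rparr>\<^esub> x = - x" if "x \<in> ON" for x
    using that by (intro ON.minus_equality) (auto simp: mem_simps)
  have "subgroup Q (add_monoid (ring_of_type_algebra\<lparr>carrier := ON\<rparr>))"
  proof (rule ON.add.subgroupI)
    show "\<ominus>\<^bsub>ring_of_type_algebra\<lparr>carrier := ON\<rparr>\<^esub> x \<in> Q" if "x \<in> Q" for x
      using inv[OF ideal_mem[OF ideal that]] ideal_minus[OF ideal that] by simp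
  qed (use ideal_mem[OF ideal] ideal_zero[OF ideal] ideal_add[OF ideal] in auto)
  then have "ideal Q (ring_of_type_algebra\<lparr>carrier := ON\<rparr>)"
    using ideal_mult_left[OF ideal] ideal_mult_right[OF ideal] by (intro idealI ON.ring_axioms) auto
  then show ?thesis
    using prime_ideal_one[OF Q] prime_ideal_multD[OF Q] one_mem by (intro primeidealI ON.is_cring) auto
qed

locale frobenius_prime = base_embedding f R F \<iota>
  for f and R (structure) and F and \<iota> :: "'a \<Rightarrow> complex" +
  fixes p :: nat and Q :: "complex set" and \<phi> :: "complex \<Rightarrow> complex"
  assumes unramified_p: "unramified_prime p" and frobenius_\<phi>: "is_frobenius p Q \<phi>" and \<phi>_mem: "\<phi> \<in> Gal_F"
begin

lemma prime_p: "prime p" and prime_Q: "is_prime_ideal Q" and of_nat_p: "of_nat p \<in> Q"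
  and power_cong: "x \<in> ON \<Longrightarrow> x ^ p - \<phi> x \<in> Q"
  using frobenius_\<phi> by (auto simp: is_frobenius_def)

lemma p_pos: "p > 0"
  by (rule prime_gt_0_nat[OF prime_p])

lemma \<phi>_Gal: "\<phi> \<in> Gal"
  by (rule Gal_F_subset[OF \<phi>_mem])

lemma power_cong_funpow:
  assumes x: "x \<in> ON" shows "x ^ (p ^ n) - (\<phi> ^^ n) x \<in> Q"
proof (induction n)
  case 0
  show ?case using ideal_zero[OF prime_ideal_ideal[OF prime_Q]] by simp
next
  case (Suc n)
  note ideal = prime_ideal_ideal[OF prime_Q]
  have mem: "(\<phi> ^^ n) x \<in> ON" by (rule act_mem[OF funpow_mem[OF \<phi>_Gal] x])
  have "(x ^ (p ^ n)) ^ p - ((\<phi> ^^ n) x) ^ p \<in> Q"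
    by (rule ideal_cong_power[OF ideal Suc power_mem[OF x] mem])
  then have "(x ^ (p ^ n)) ^ p - \<phi> ((\<phi> ^^ n) x) \<in> Q" using power_cong[OF mem] by (rule ideal_cong_trans[OF ideal])
  then show ?case by (simp add: power_mult[symmetric] mult.commute)
qed

definition below :: "'a set" where
  "below = {x \<in> ring_of_integers R F. \<iota> x \<in> Q}"

end

locale frobenius_extension = frobenius_prime f R F \<iota> p Q \<phi> + F_extension f R F \<iota> M j
  for f and R (structure) and F and \<iota> :: "'a \<Rightarrow> complex" and p Q \<phi> and M and j :: "'a \<Rightarrow> complex"
begin

abbreviation \<O> :: "'a set" where
  "\<O> \<equiv> ring_of_integers R M"

lemma mem_\<O>_iff: "x \<in> \<O> \<longleftrightarrow> x \<in> M \<and> j x \<in> ON"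
  using ext.mem_ring_of_integers_iff ext.ring_of_integers_subset map_mem by (auto simp: ON_def)

lemma \<O>_mem: "x \<in> \<O> \<Longrightarrow> x \<in> M" and map_ON: "x \<in> \<O> \<Longrightarrow> j x \<in> ON"
  by (simp_all add: mem_\<O>_iff)

lemma image_\<O>: "j ` \<O> = ON \<inter> j ` M"
  by (auto simp: mem_\<O>_iff)

lemma int_elem_\<O>: "base.int_elem k \<in> \<O>"
  by (simp add: mem_\<O>_iff ext.int_elem_mem ext.map_int_elem of_int_mem)

lemma diff_\<O>: "x \<in> \<O> \<Longrightarrow> y \<in> \<O> \<Longrightarrow> x \<ominus> y \<in> \<O>"
  using subringE(5,7)[OF ext.subring_ring_of_integers] by (simp add: a_minus_def)

lemma domain_\<O>: "domain (OK R M)"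
  by (rule base.subring_is_domain[OF ext.subring_ring_of_integers])

sublocale int: comm_subring "ON \<inter> j ` M"
proof
  note closed = type_subfield_closed[OF ext.image_subfield]
  show "1 \<in> ON \<inter> j ` M" using one_mem closed(2) by simp
  show "x - y \<in> ON \<inter> j ` M" "x * y \<in> ON \<inter> j ` M" if "x \<in> ON \<inter> j ` M" "y \<in> ON \<inter> j ` M" for x y
    using that diff_mem mult_mem closed(4,6) by simp_all
qed

lemma int_multiplesI:
  assumes n: "n > 0" and x: "x \<in> multiples n" "x \<in> j ` M" shows "x \<in> int.multiples n"
proof -
  note closed = type_subfield_closed[OF ext.image_subfield]
  obtain w where w: "w \<in> ON" "x = of_nat n * w" using x(1) by (auto simp: multiples_def)
  have "inverse (of_nat n) \<in> j ` M" using Rats_subset_type_subfield[OF ext.image_subfield] by auto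
  then have "inverse (of_nat n) * x \<in> j ` M" using closed(4) x(2) by blast
  moreover have "inverse (of_nat n) * x = w" using w(2) n by simp
  ultimately have "w \<in> ON \<inter> j ` M" using w(1) by simp
  then show ?thesis unfolding w(2) by (rule int.multiplesI)
qed

lemma primeideal_contraction: "primeideal {x \<in> \<O>. j x \<in> Q} (OK R M)"
proof -
  interpret \<O>: domain "OK R M" by (rule domain_\<O>)
  interpret ON: primeideal Q "ring_of_type_algebra\<lparr>carrier := ON\<rparr>" by (rule primeideal_ON[OF prime_Q])
  have "ring_hom_ring (OK R M) (ring_of_type_algebra\<lparr>carrier := ON\<rparr>) j"
    using \<O>_mem map_ON
    by (intro ring_hom_ringI2 \<O>.ring_axioms ON.ring_axioms ring_hom_memI) (auto simp: ext.map_one ext.map_add ext.map_mult)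
  from ring_hom_ring.primeideal_vimage[OF this \<O>.is_cring ON.primeideal_axioms] show ?thesis by simp
qed

lemma exists_residue:
  assumes x: "x \<in> \<O>" "\<phi> (j x) = j x" shows "\<exists>r<p. j x - of_nat r \<in> Q"
  using exists_of_nat_residue[OF prime_p prime_Q of_nat_p map_ON[OF x(1)]] power_cong[OF map_ON[OF x(1)]] x(2) by simp

end

lemma (in frobenius_prime) base_frobenius_extension: "frobenius_extension f R F \<iota> p Q \<phi> F \<iota>"
  using frobenius_prime_axioms base_extension by (simp add: frobenius_extension_def)

context frobenius_extension
begin

lemma base_\<O>: assumes "x \<in> ring_of_integers R F" shows "x \<in> \<O>" and "j x = \<iota> x"
proof -
  interpret self: frobenius_extension f R F \<iota> p Q \<phi> F \<iota> by (rule base_frobenius_extension)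
  show "x \<in> \<O>" "j x = \<iota> x" using self.mem_\<O>_iff[of x] mem_\<O>_iff[of x] base_subset map_base assms by auto
qed

lemma contraction_above: "{x \<in> \<O>. j x \<in> Q} \<in> primes_above R F M below"
  using primeideal_contraction base_\<O> by (auto simp: primes_above_def below_def)

end

lemma (in frobenius_prime) int_elem_below_iff: "base.int_elem k \<in> below \<longleftrightarrow> int p dvd k"
proof -
  interpret self: frobenius_extension f R F \<iota> p Q \<phi> F \<iota> by (rule base_frobenius_extension)
  show ?thesis
    using self.int_elem_\<O>[of k] prime_ideal_of_int_iff[OF prime_Q of_nat_p prime_p] base.map_int_elem
    by (simp add: below_def)
qed

lemma (in frobenius_prime) nz_prime_below: "nz_prime R F below"
proof -
  interpret self: frobenius_extension f R F \<iota> p Q \<phi> F \<iota> by (rule base_frobenius_extension)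
  have "base.int_elem (int p) \<in> below" by (simp add: int_elem_below_iff)
  moreover have "base.int_elem (int p) \<noteq> \<zero>"
    using base.map_int_elem[of "int p"] base.map_zero p_pos by auto
  ultimately show ?thesis
    unfolding nz_prime_def using self.primeideal_contraction by (auto simp: below_def)
qed

locale prime_above = frobenius_extension f R F \<iota> p Q \<phi> M j
  for f and R (structure) and F and \<iota> :: "'a \<Rightarrow> complex" and p Q \<phi> and M and j :: "'a \<Rightarrow> complex" +
  fixes P :: "'a set"
  assumes above: "P \<in> primes_above R F M below"
begin

sublocale above: primeideal P "OK R M"
  using above by (simp add: primes_above_def)

lemma P_subset: "P \<subseteq> \<O>"
  using above.a_subset by simp

lemma mem_below_iff: "x \<in> below \<longleftrightarrow> x \<in> P \<and> x \<in> ring_of_integers R F"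
  using above by (auto simp: primes_above_def)

lemma int_elem_P_iff: "base.int_elem k \<in> P \<longleftrightarrow> int p dvd k"
proof -
  interpret self: frobenius_extension f R F \<iota> p Q \<phi> F \<iota> by (rule base_frobenius_extension)
  show ?thesis using mem_below_iff[of "base.int_elem k"] int_elem_below_iff self.int_elem_\<O> by simp
qed

lemma P_mem: "x \<in> P \<Longrightarrow> x \<in> M"
  using P_subset \<O>_mem by blast

lemma map_image_iff: "x \<in> \<O> \<Longrightarrow> j x \<in> j ` P \<longleftrightarrow> x \<in> P"
  using inj_on_image_mem_iff[OF ext.inj_on \<O>_mem] P_subset \<O>_mem by blast

lemma prime_image: "int.is_prime_ideal (j ` P)"
  unfolding int.is_prime_ideal_def int.is_ideal_def
proof (intro conjI ballI impI)
  show "j ` P \<subseteq> ON \<inter> j ` M" using P_subset image_\<O> by blast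
  show "0 \<in> j ` P" using map_image_iff[OF int_elem_\<O>[of 0]] int_elem_P_iff[of 0] ext.map_int_elem[of 0] by simp
  show "1 \<notin> j ` P"
    using map_image_iff[OF int_elem_\<O>[of 1]] int_elem_P_iff[of 1] prime_p ext.map_one by (auto simp: prime_nat_iff)
  fix x y assume "x \<in> j ` P" "y \<in> j ` P"
  then obtain a b where ab: "a \<in> P" "x = j a" "b \<in> P" "y = j b" by blast
  then have "a \<oplus> b \<in> P" using additive_subgroup.a_closed[OF ideal.axioms(1)[OF above.ideal_axioms]] by fastforce
  moreover have "x + y = j (a \<oplus> b)" using ab P_mem by (simp add: ext.map_add)
  ultimately show "x + y \<in> j ` P" by blast
next
  fix x y assume "x \<in> ON \<inter> j ` M" "y \<in> j ` P"
  then obtain a b where ab: "a \<in> \<O>" "x = j a" "b \<in> P" "y = j b" using image_\<O> by blast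
  then have "a \<otimes> b \<in> P" using above.I_l_closed[of b a] by simp
  moreover have "x * y = j (a \<otimes> b)" using ab P_mem \<O>_mem by (simp add: ext.map_mult)
  ultimately show "x * y \<in> j ` P" by blast
next
  fix x y assume "x \<in> ON \<inter> j ` M" "y \<in> ON \<inter> j ` M" and xy: "x * y \<in> j ` P"
  then obtain a b where ab: "a \<in> \<O>" "x = j a" "b \<in> \<O>" "y = j b" using image_\<O> by blast
  then have "j (a \<otimes> b) \<in> j ` P" using xy \<O>_mem by (simp add: ext.map_mult)
  moreover have "a \<otimes> b \<in> \<O>" using ab subringE(6)[OF ext.subring_ring_of_integers] by simp
  ultimately have "a \<otimes> b \<in> P" using map_image_iff by blast
  then show "x \<in> j ` P \<or> y \<in> j ` P" using above.I_prime[of a b] ab by auto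
qed

lemmas image_ideal = int.prime_ideal_ideal[OF prime_image]

lemma of_nat_p_image: "of_nat p \<in> j ` P"
  using map_image_iff[OF int_elem_\<O>[of "int p"]] int_elem_P_iff[of "int p"] by (simp add: ext.map_int_elem)

lemma int_multiples_subset: "int.multiples p \<subseteq> j ` P"
  by (rule int.multiples_subset[OF prime_image of_nat_p_image])

subsection \<open>Unramifiedness\<close>

lemma image_ideal_prod: "s \<in> ideal_prod (OK R M) P P \<Longrightarrow> j s \<in> int.local_multiples (j ` P) (p * p)"
proof (induction rule: ideal_prod.induct)
  case (prod a b)
  have "j x \<in> int.local_multiples (j ` P) p" if x: "x \<in> P" for x
  proof -
    have mem: "j x \<in> ON \<inter> j ` M" using x P_subset image_\<O> by blast
    then obtain n where n: "n > 0" "j x * (j x ^ n - 1) \<in> multiples p"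
      using exists_annihilator[OF unramified_p, of "j x"] by blast
    have "j x * (j x ^ n - 1) \<in> ON \<inter> j ` M" by (intro int.mult_mem int.diff_mem int.power_mem int.one_mem mem)
    then show ?thesis
      using n x int_multiplesI[OF p_pos n(2)] by (intro int.local_multiplesI_annihilator[OF prime_image]) auto
  qed
  from int.local_multiples_mult[OF prime_image this[OF prod(1)] this[OF prod(2)]] show ?case
    using prod P_subset \<O>_mem ext.map_mult[of a b] by (auto simp: subset_iff)
next
  case (sum a b)
  have "a \<in> \<O>" "b \<in> \<O>" using sum.hyps above.ideal_prod_in_carrier[OF above.ideal_axioms above.ideal_axioms] by auto
  then show ?case using int.local_multiples_add[OF prime_image sum.IH] \<O>_mem ext.map_add[of a b] by simp
qed

lemma ext_ideal_below_not_subset: "\<not> ext_ideal R M below \<subseteq> ideal_prod (OK R M) P P"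
proof
  assume subset: "ext_ideal R M below \<subseteq> ideal_prod (OK R M) P P"
  have "below \<subseteq> carrier (OK R M)" using base_\<O> by (auto simp: below_def)
  then have "base.int_elem (int p) \<in> ext_ideal R M below"
    unfolding ext_ideal_def using above.genideal_self int_elem_below_iff[of "int p"] by auto
  then have "of_nat p \<in> int.local_multiples (j ` P) (p * p)"
    using image_ideal_prod[of "base.int_elem (int p)"] subset by (auto simp: ext.map_int_elem)
  then obtain t w where t: "t \<in> ON \<inter> j ` M" "t \<notin> j ` P" and w: "w \<in> ON \<inter> j ` M" "t * of_nat p = of_nat (p * p) * w"
    unfolding int.local_multiples_def int.multiples_def by blast
  have "t = of_nat p * w" using w(2) p_pos by simp
  then show False using t(2) int.multiplesI[OF w(1), of p] int_multiples_subset by blast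
qed

subsection \<open>Residue fields\<close>

abbreviation residue :: "'a \<Rightarrow> 'a set" where
  "residue a \<equiv> P +>\<^bsub>OK R M\<^esub> a"

abbreviation residue_ring :: "('a set) ring" where
  "residue_ring \<equiv> OK R M Quot P"

lemma minus_OK: assumes x: "x \<in> \<O>" shows "\<ominus>\<^bsub>OK R M\<^esub> x = \<ominus> x"
proof (rule above.minus_equality)
  note closed = subringE[OF ext.subring_ring_of_integers]
  show "\<ominus> x \<oplus>\<^bsub>OK R M\<^esub> x = \<zero>\<^bsub>OK R M\<^esub>" "\<ominus> x \<in> carrier (OK R M)" "x \<in> carrier (OK R M)"
    using x closed(1,5) base.l_neg by auto
qed

lemma residue_eq_iff:
  assumes a: "a \<in> \<O>" and b: "b \<in> \<O>" shows "residue a = residue b \<longleftrightarrow> j a - j b \<in> j ` P"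
proof -
  have "a \<ominus>\<^bsub>OK R M\<^esub> b = a \<ominus> b" using minus_OK[OF b] by (simp add: a_minus_def)
  then have "residue a = residue b \<longleftrightarrow> a \<ominus> b \<in> P"
    using above.quotient_eq_iff_same_a_r_cos[OF above.ideal_axioms, of a b] a b by simp
  then show ?thesis using map_image_iff[OF diff_\<O>[OF a b]] ext.map_diff a b \<O>_mem by simp
qed

lemma carrier_residue_ring: "carrier residue_ring = residue ` \<O>"
  by (auto simp: FactRing_def A_RCOSETS_def')

lemma finite_residue_ring: "finite (carrier residue_ring)"
proof -
  obtain S where S: "finite S" "\<forall>x\<in>ON. \<exists>r\<in>S. x - r \<in> multiples p" using finite_representatives[OF unramified_p] by blast
  then obtain \<rho> where \<rho>: "\<And>x. x \<in> ON \<Longrightarrow> \<rho> x \<in> S \<and> x - \<rho> x \<in> multiples p" by metis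
  define s where "s r = (SOME a. a \<in> \<O> \<and> \<rho> (j a) = r)" for r
  have "residue a = residue (s (\<rho> (j a)))" if a: "a \<in> \<O>" for a
  proof -
    let ?b = "s (\<rho> (j a))"
    have b: "?b \<in> \<O>" "\<rho> (j ?b) = \<rho> (j a)" unfolding s_def using someI[of "\<lambda>b. b \<in> \<O> \<and> \<rho> (j b) = \<rho> (j a)" a] a by auto
    have "j a - j ?b \<in> multiples p"
      using ideal_cong_trans[OF is_ideal_multiples, of "j a" "\<rho> (j a)" p "j ?b"] ideal_cong_sym[OF is_ideal_multiples]
        \<rho>[OF map_ON[OF a]] \<rho>[OF map_ON[OF b(1)]] b(2) by simp
    moreover have "j a - j ?b \<in> j ` M"
      using type_subfield_closed(6)[OF ext.image_subfield] a b(1) \<O>_mem by blast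
    ultimately show ?thesis
      unfolding residue_eq_iff[OF a b(1)] using int_multiples_subset int_multiplesI[OF p_pos] by blast
  qed
  then have "carrier residue_ring \<subseteq> (\<lambda>r. residue (s r)) ` S"
    unfolding carrier_residue_ring using \<rho> map_ON by blast
  then show ?thesis using S(1) finite_subset by blast
qed

lemma base_residue_eq: assumes "x \<in> ring_of_integers R F" shows "\<exists>r<p. residue x = residue (base.int_elem (int r))"
proof -
  interpret self: frobenius_extension f R F \<iota> p Q \<phi> F \<iota> by (rule base_frobenius_extension)
  obtain r where r: "r < p" "\<iota> x - of_nat r \<in> Q"
    using self.exists_residue[OF assms] Gal_F_fixes[OF \<phi>_mem] self.\<O>_mem[OF assms] by blast
  let ?y = "x \<ominus> base.int_elem (int r)"
  have "?y \<in> ring_of_integers R F" by (rule self.diff_\<O>[OF assms self.int_elem_\<O>])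
  moreover have "\<iota> ?y = \<iota> x - of_nat r"
    using base.map_diff self.\<O>_mem[OF assms] base.int_elem_mem by (simp add: base.map_int_elem)
  ultimately have "?y \<in> P" using r(2) mem_below_iff[of ?y] by (simp add: below_def)
  then have "j x - j (base.int_elem (int r)) \<in> j ` P"
    using ext.map_diff[OF \<O>_mem[OF base_\<O>(1)[OF assms]] ext.int_elem_mem] by (metis image_eqI)
  then show ?thesis using residue_eq_iff[OF base_\<O>(1)[OF assms] int_elem_\<O>] r(1) by blast
qed

lemma residue_base: "residue ` ring_of_integers R F = (\<lambda>r. residue (base.int_elem (int r))) ` {..<p}"
proof
  interpret self: frobenius_extension f R F \<iota> p Q \<phi> F \<iota> by (rule base_frobenius_extension)
  show "(\<lambda>r. residue (base.int_elem (int r))) ` {..<p} \<subseteq> residue ` ring_of_integers R F"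
    using self.int_elem_\<O> by blast
qed (use base_residue_eq in auto)

lemma card_residue_base: "card (residue ` ring_of_integers R F) = p"
proof -
  have "inj_on (\<lambda>r. residue (base.int_elem (int r))) {..<p}"
  proof (rule inj_onI)
    fix r s assume r: "r \<in> {..<p}" and s: "s \<in> {..<p}"
      and "residue (base.int_elem (int r)) = residue (base.int_elem (int s))"
    then have "of_int (int r - int s) \<in> j ` P"
      using residue_eq_iff[OF int_elem_\<O> int_elem_\<O>] by (simp add: ext.map_int_elem)
    then have "int p dvd int r - int s" using int.prime_ideal_of_int_iff[OF prime_image of_nat_p_image prime_p] by blast
    then have "int r mod int p = int s mod int p" by (simp add: mod_eq_dvd_iff)
    then show "r = s" using r s by simp
  qed
  then show ?thesis unfolding residue_base by (simp add: card_image)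
qed

lemma subfield_residue_base: "subfield (residue ` ring_of_integers R F) residue_ring"
proof -
  note closed = subringE[OF base.subring_ring_of_integers]
  interpret residue: ring_hom_ring "OK R M" residue_ring residue by (rule above.rcos_ring_hom_ring)
  have "subring (ring_of_integers R F) (OK R M)"
    by (rule above.subringI) (use closed base_\<O>(1) minus_OK in auto)
  then have "subring (residue ` ring_of_integers R F) residue_ring" by (rule residue.img_is_subring)
  then show ?thesis
    by (rule domain.finite_subring_is_subfield[OF above.quotient_is_domain]) (simp add: residue_base)
qed

lemma field_residue_ring: "field residue_ring"
  by (rule domain.finite_domain_is_field[OF above.quotient_is_domain finite_residue_ring])

lemma
  shows card_residue_ring: "card (carrier residue_ring) = p ^ inertia_degree R F M P"
    and inertia_degree_eq_1: "residue ` ring_of_integers R F = carrier residue_ring \<Longrightarrow> inertia_degree R F M P = 1"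
proof -
  let ?k = "residue ` ring_of_integers R F"
  interpret residue: Ring.field residue_ring by (rule field_residue_ring)
  note k = subfield_residue_base
  obtain Us where Us: "set Us = carrier residue_ring" using finite_list[OF finite_residue_ring] by blast
  have "residue.Span ?k Us = carrier residue_ring"
    using residue.Span_base_incl[OF k, of Us] residue.Span_in_carrier[OF subfieldE(3)[OF k], of Us] Us by blast
  then obtain n where n: "residue.dimension n ?k (carrier residue_ring)"
    using residue.Span_finite_dimension[OF k, of Us] Us by (auto simp: residue.finite_dimension_def)
  have inertia: "inertia_degree R F M P = m" if "residue.dimension m ?k (carrier residue_ring)" for m
    unfolding inertia_degree_def by (rule the_equality) (use that residue.dimension_is_inj[OF k] in auto)
  have "finite ?k" by (simp add: residue_base)
  then show "card (carrier residue_ring) = p ^ inertia_degree R F M P"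
    using residue.card_eq_if_dimension[OF k _ n] inertia[OF n] card_residue_base by simp
  show "inertia_degree R F M P = 1" if "?k = carrier residue_ring"
    using inertia[of 1] residue.dimension_one[OF k] that by simp
qed

lemma power_inertia_degree_cong:
  assumes x: "x \<in> \<O>" shows "j x ^ (p ^ inertia_degree R F M P) - j x \<in> j ` P"
proof -
  let ?n = "p ^ inertia_degree R F M P"
  interpret residue: ring_hom_ring "OK R M" residue_ring residue by (rule above.rcos_ring_hom_ring)
  have pow: "x [^]\<^bsub>OK R M\<^esub> ?n = x [^] ?n" by (simp add: nat_pow_def)
  have mem: "x [^] ?n \<in> \<O>"
    using ext.pow_mem[OF \<O>_mem[OF x]] map_ON[OF x] by (simp add: mem_\<O>_iff ext.map_pow \<O>_mem[OF x] power_mem)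
  have "residue x [^]\<^bsub>residue_ring\<^esub> ?n = residue x"
    using field.pow_card_carrier[OF field_residue_ring finite_residue_ring, of "residue x"] x
    unfolding card_residue_ring by (simp add: carrier_residue_ring)
  then have "residue (x [^] ?n) = residue x" using residue.hom_nat_pow[of x ?n] x pow by simp
  then show ?thesis using residue_eq_iff[OF mem x] by (simp add: ext.map_pow \<O>_mem[OF x])
qed

end

context frobenius_extension
begin

lemma unramified_below: "unramified R F M below"
  unfolding unramified_def
proof
  fix P assume "P \<in> primes_above R F M below"
  then interpret prime_above f R F \<iota> p Q \<phi> M j P by unfold_locales
  show "\<not> ext_ideal R M below \<subseteq> ideal_prod (OK R M) P P" by (rule ext_ideal_below_not_subset)
qed

lemma split_gcd_eq_1_if_fixed:
  assumes fixed: "\<And>x. x \<in> M \<Longrightarrow> \<phi> (j x) = j x" shows "split_gcd R F M below = 1"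
proof -
  let ?P = "{x \<in> \<O>. j x \<in> Q}"
  interpret prime_above f R F \<iota> p Q \<phi> M j ?P by unfold_locales (rule contraction_above)
  interpret self: frobenius_extension f R F \<iota> p Q \<phi> F \<iota> by (rule base_frobenius_extension)
  have "residue x \<in> residue ` ring_of_integers R F" if x: "x \<in> \<O>" for x
  proof -
    obtain r where r: "r < p" "j x - of_nat r \<in> Q" using exists_residue[OF x fixed[OF \<O>_mem[OF x]]] by blast
    let ?r = "base.int_elem (int r)"
    have map_diff: "j (x \<ominus> ?r) = j x - of_nat r"
      using ext.map_diff[OF \<O>_mem[OF x] ext.int_elem_mem] by (simp add: ext.map_int_elem)
    then have "x \<ominus> ?r \<in> ?P" using r(2) diff_\<O>[OF x int_elem_\<O>] by simp
    then have "residue x = residue ?r"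
      unfolding residue_eq_iff[OF x int_elem_\<O>] using map_diff by (simp add: ext.map_int_elem image_iff) metis
    then show ?thesis using self.int_elem_\<O> by blast
  qed
  then have "residue ` ring_of_integers R F = carrier residue_ring"
    unfolding carrier_residue_ring using base_\<O>(1) by blast
  then have "inertia_degree R F M ?P = 1" by (rule inertia_degree_eq_1)
  then have "Gcd (inertia_degree R F M ` primes_above R F M below) dvd 1"
    using Gcd_dvd[OF imageI[OF above]] by metis
  then show ?thesis by (simp add: split_gcd_def)
qed

end

lemma (in base_embedding) prod_conjugates_invariant:
  assumes g: "g \<in> Gal_F" and T: "finite T" "T \<subseteq> ON" "\<And>x. x \<in> T \<Longrightarrow> g x \<in> T"
  shows "g (\<Prod>x\<in>T. x ^ n - x) = (\<Prod>x\<in>T. x ^ n - x)"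
proof -
  note g_Gal = Gal_F_subset[OF g]
  have mem: "x \<in> ON" if "x \<in> T" for x using that T(2) by blast
  have "g (\<Prod>x\<in>T. x ^ n - x) = (\<Prod>x\<in>T. g (x ^ n - x))"
    by (intro act_prod[OF g_Gal] diff_mem power_mem mem)
  also have "\<dots> = (\<Prod>x\<in>T. g x ^ n - g x)"
    by (rule prod.cong) (simp_all add: act_diff[OF g_Gal] act_power[OF g_Gal] mem power_mem)
  also have "\<dots> = (\<Prod>x\<in>T. x ^ n - x)"
    by (rule prod.reindex_bij_betw[OF relative.bij_betw_invariant[OF g T(1,3)]])
  finally show ?thesis .
qed

lemma (in F_extension) conjugates_subset_ON:
  assumes "j \<alpha> \<in> ON" shows "relative.conjugates (j \<alpha>) \<subseteq> ON"
  using act_mem[OF Gal_F_subset assms] by (auto simp: relative.conjugates_eq)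

context prime_above
begin

text \<open>With \<open>h x = x ^ p ^ n - x\<close> for the inertia degree \<open>n\<close>, the norm to \<open>F\<close> of \<open>h \<alpha>\<close> is a multiple of \<open>h \<alpha>\<close>, so it
  lies in \<open>P\<close> and hence in \<open>Q\<close>.\<close>

lemma exists_conjugate_power_cong:
  assumes \<alpha>: "\<alpha> \<in> \<O>"
  shows "\<exists>x\<in>relative.conjugates (j \<alpha>). x ^ (p ^ inertia_degree R F M P) - x \<in> Q"
proof -
  define h where "h x = x ^ (p ^ inertia_degree R F M P) - x" for x :: complex
  let ?Y = "relative.conjugates (j \<alpha>)"
  have Y: "?Y \<subseteq> ON" by (rule conjugates_subset_ON[OF map_ON[OF \<alpha>]])
  have h_ON: "h x \<in> ON" if "x \<in> ?Y" for x unfolding h_def using that Y by (intro diff_mem power_mem) auto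
  have invariant: "g (prod h T) = prod h T" if "g \<in> Gal_F" "T \<subseteq> ?Y" "\<And>x. x \<in> T \<Longrightarrow> g x \<in> T" for g T
    unfolding h_def
    using that Y by (intro prod_conjugates_invariant finite_subset[OF _ relative.finite_conjugates]) auto
  interpret self: frobenius_extension f R F \<iota> p Q \<phi> F \<iota> by (rule base_frobenius_extension)
  have prod_ON: "prod h T \<in> ON" if "T \<subseteq> ?Y" for T using that h_ON by (intro prod_mem) blast
  have "prod h ?Y \<in> \<iota> ` F"
  proof (rule self.mem_image_if_fixed)
    show "prod h ?Y \<in> N" using prod_ON[OF subset_refl] by (simp add: ON_def)
    show "g (prod h ?Y) = prod h ?Y" if "g \<in> Gal_F" for g
      using that relative.conjugates_closed by (intro invariant) auto
  qed
  then obtain z where z: "z \<in> F" "prod h ?Y = \<iota> z" by blast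
  have "prod h (?Y - {j \<alpha>}) \<in> j ` M"
  proof (rule mem_image_if_fixed)
    show "prod h (?Y - {j \<alpha>}) \<in> N" using prod_ON[of "?Y - {j \<alpha>}"] by (auto simp: ON_def)
    fix g assume g: "g \<in> Gal_F" "\<And>x. x \<in> M \<Longrightarrow> g (j x) = j x"
    then have "g x \<noteq> j \<alpha>" if "x \<noteq> j \<alpha>" for x
      using that relative.inj_mem[OF g(1), of x "j \<alpha>"] \<O>_mem[OF \<alpha>] by metis
    then show "g (prod h (?Y - {j \<alpha>})) = prod h (?Y - {j \<alpha>})"
      using g(1) relative.conjugates_closed by (intro invariant) auto
  qed
  then have "prod h (?Y - {j \<alpha>}) \<in> ON \<inter> j ` M" using prod_ON[of "?Y - {j \<alpha>}"] by blast
  moreover have "h (j \<alpha>) \<in> j ` P" unfolding h_def by (rule power_inertia_degree_cong[OF \<alpha>])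
  moreover have "prod h ?Y = h (j \<alpha>) * prod h (?Y - {j \<alpha>})"
    by (rule prod.remove[OF relative.finite_conjugates relative.conjugates_refl])
  ultimately have "\<iota> z \<in> j ` P" using int.ideal_mult_right[OF image_ideal] z(2) by simp
  moreover have z_int: "z \<in> ring_of_integers R F" using z prod_ON[OF subset_refl] by (simp add: self.mem_\<O>_iff)
  ultimately have "z \<in> P" using map_image_iff[OF base_\<O>(1)[OF z_int]] base_\<O>(2)[OF z_int] by simp
  then have "prod h ?Y \<in> Q" using z_int mem_below_iff[of z] z(2) by (simp add: below_def)
  then show ?thesis using prime_ideal_prodD[OF prime_Q h_ON] by (simp add: h_def)
qed

end

lemma fixed_if_funpow_fixed:
  assumes l: "prime l" "\<not> l dvd k" "g ^^ (l ^ a) = id" and fixed: "(g ^^ k) x = x" shows "g x = x"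
proof -
  have multiple: "(g ^^ (m * i)) x = x" if "(g ^^ m) x = x" for m i
    using that by (induction i) (auto simp: funpow_add)
  have "k \<noteq> 0" using l(2) by (intro notI) simp
  moreover have "coprime k (l ^ a)" using prime_imp_coprime[OF l(1,2)] by (simp add: coprime_commute)
  ultimately obtain u v where "k * u = Suc (l ^ a * v)" using bezout_nat[of k "l ^ a"] by auto
  then show ?thesis using multiple[OF fixed, of u] multiple[of "l ^ a" v] l(3) by simp
qed

lemma (in frobenius_extension) prime_dvd_split_gcd:
  assumes \<alpha>: "\<alpha> \<in> \<O>" and l: "prime l" "\<phi> ^^ (l ^ a) = id"
    and moved: "\<And>x. x \<in> relative.conjugates (j \<alpha>) \<Longrightarrow> \<phi> x \<noteq> x"
    and incongruent: "\<And>x y. x \<in> relative.conjugates (j \<alpha>) \<Longrightarrow> y \<in> relative.conjugates (j \<alpha>) \<Longrightarrow> x \<noteq> y \<Longrightarrow> x - y \<notin> Q"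
  shows "l dvd split_gcd R F M below"
  unfolding split_gcd_def
proof (rule Gcd_greatest, elim imageE)
  fix n P assume "P \<in> primes_above R F M below" and n: "n = inertia_degree R F M P"
  then interpret prime_above f R F \<iota> p Q \<phi> M j P by unfold_locales
  note ideal = prime_ideal_ideal[OF prime_Q]
  obtain x where x: "x \<in> relative.conjugates (j \<alpha>)" "x ^ (p ^ n) - x \<in> Q"
    using exists_conjugate_power_cong[OF \<alpha>] n by blast
  have conjugates: "(\<phi> ^^ m) x \<in> relative.conjugates (j \<alpha>)" for m
    using x(1) relative.conjugates_closed[OF relative.funpow_mem[OF \<phi>_mem]] by blast
  have "x \<in> ON" using x(1) conjugates_subset_ON[OF map_ON[OF \<alpha>]] by blast
  then have "(\<phi> ^^ n) x - x \<in> Q"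
    using ideal_cong_trans[OF ideal ideal_cong_sym[OF ideal power_cong_funpow] x(2)] by blast
  then have fixed: "(\<phi> ^^ n) x = x" using incongruent[OF conjugates x(1)] by blast
  show "l dvd n"
  proof (rule ccontr)
    assume "\<not> l dvd n"
    then have "\<phi> x = x" using fixed by (rule fixed_if_funpow_fixed[OF l(1) _ l(2)])
    then show False using moved[OF x(1)] by contradiction
  qed
qed

section \<open>Transfer of fixed points\<close>

lemma (in base_embedding) exists_frobenius_prime:
  assumes \<sigma>: "\<sigma> \<in> Gal_F" "\<sigma> \<noteq> id" "\<sigma> ^^ (l ^ a) = id" and Y: "finite Y" "Y \<subseteq> ON"
  shows "\<exists>p Q k. frobenius_prime f R F \<iota> p Q (\<sigma> ^^ k) \<and> \<not> l dvd k \<and> (\<forall>x\<in>Y. \<forall>y\<in>Y. x \<noteq> y \<longrightarrow> x - y \<notin> Q)"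
proof -
  define T where "T = (\<lambda>(x, y). x - y) ` (Y \<times> Y) - {0}"
  have "finite T" "T \<subseteq> ON - {0}" using Y diff_mem by (auto simp: T_def)
  then obtain B where B: "\<And>p Q. prime p \<Longrightarrow> is_prime_ideal Q \<Longrightarrow> of_nat p \<in> Q \<Longrightarrow> B < p \<Longrightarrow> T \<inter> Q = {}"
    using disjoint_prime_ideal_above_large_prime by blast
  obtain p Q k where p: "max B (nat \<bar>discriminant\<bar>) < p" "\<not> l dvd k" and frobenius: "is_frobenius p Q (\<sigma> ^^ k)"
    using exists_frobenius_power[OF Gal_F_subset[OF \<sigma>(1)] \<sigma>(2,3)] by blast
  have "frobenius_prime f R F \<iota> p Q (\<sigma> ^^ k)"
    using frobenius p(1) relative.funpow_mem[OF \<sigma>(1)] base_embedding_axioms unramified_primeI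
    by (auto simp: frobenius_prime_def frobenius_prime_axioms_def is_frobenius_def)
  moreover have "x - y \<notin> Q" if "x \<in> Y" "y \<in> Y" "x \<noteq> y" for x y
  proof -
    have "x - y \<in> T" using that by (auto simp: T_def)
    then show ?thesis using B[of p Q] p(1) frobenius by (auto simp: is_frobenius_def)
  qed
  ultimately show ?thesis using p(2) by blast
qed

lemma fixed_point_transfer:
  assumes K: "F_extension f R F \<iota> K j" "F_extension.primitive f F \<iota> K j \<alpha>"
    and L: "F_extension f R F \<iota> L i" "F_extension.primitive f F \<iota> L i \<beta>"
    and equivalent: "locally_gcd_equivalent R F K L"
    and l: "prime l" and \<sigma>: "\<sigma> \<in> prime_power_elements l (perm_group (base_embedding.Gal_F f F \<iota>))"
    and y: "y \<in> orbit (perm_group (base_embedding.Gal_F f F \<iota>)) (\<lambda>g. g) (i \<beta>)" "\<sigma> y = y"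
  shows "\<exists>x\<in>orbit (perm_group (base_embedding.Gal_F f F \<iota>)) (\<lambda>g. g) (j \<alpha>). \<sigma> x = x"
proof (rule ccontr)
  assume neg: "\<not> ?thesis"
  interpret K: F_extension f R F \<iota> K j by (rule K(1))
  interpret L: F_extension f R F \<iota> L i by (rule L(1))
  have \<alpha>: "\<alpha> \<in> K" "algebraic_int (j \<alpha>)" using K(2) by (simp_all add: K.primitive_def)
  obtain a where \<sigma>_mem: "\<sigma> \<in> K.Gal_F" "\<sigma> ^^ (l ^ a) = id"
    using \<sigma> by (auto simp: prime_power_elements_def K.relative.pow_perm_group)
  have \<alpha>_ON: "j \<alpha> \<in> K.ON" using \<alpha> K.map_mem[of \<alpha>] by (simp add: K.ON_def)
  have "\<sigma> \<noteq> id" using neg K.relative.conjugates_refl[of "j \<alpha>"] by (metis id_apply)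
  then obtain p Q k where "frobenius_prime f R F \<iota> p Q (\<sigma> ^^ k)" and k: "\<not> l dvd k"
    and incongruent: "\<forall>x\<in>K.relative.conjugates (j \<alpha>). \<forall>y\<in>K.relative.conjugates (j \<alpha>). x \<noteq> y \<longrightarrow> x - y \<notin> Q"
    using K.exists_frobenius_prime[OF \<sigma>_mem(1) _ \<sigma>_mem(2) K.relative.finite_conjugates K.conjugates_subset_ON[OF \<alpha>_ON]]
    by blast
  then interpret frobenius_prime f R F \<iota> p Q "\<sigma> ^^ k" by simp
  interpret K: frobenius_extension f R F \<iota> p Q "\<sigma> ^^ k" K j by unfold_locales
  obtain g where g: "g \<in> K.Gal_F" "y = g (i \<beta>)" using y(1) by (auto simp: K.relative.conjugates_eq)
  interpret gL: F_extension f R F \<iota> L "g \<circ> i" by (rule L.conjugate_extension[OF g(1)])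
  interpret gL: frobenius_extension f R F \<iota> p Q "\<sigma> ^^ k" L "g \<circ> i" by unfold_locales
  have "split_gcd R F L below = 1"
  proof (rule gL.split_gcd_eq_1_if_fixed)
    fix x assume "x \<in> L"
    moreover have "gL.primitive \<beta>" by (rule L.primitive_conjugate[OF g(1) L(2)])
    ultimately have "\<sigma> ((g \<circ> i) x) = (g \<circ> i) x" using y(2) g(2) \<sigma>_mem(1) by (simp add: gL.primitive_def)
    then show "(\<sigma> ^^ k) ((g \<circ> i) x) = (g \<circ> i) x" by (induction k) simp_all
  qed
  moreover have "l dvd split_gcd R F K below"
  proof (rule K.prime_dvd_split_gcd[OF _ l])
    show "\<alpha> \<in> ring_of_integers R K" using \<alpha> \<alpha>_ON by (simp add: K.mem_\<O>_iff)
    show "(\<sigma> ^^ k) ^^ (l ^ a) = id" using \<sigma>_mem(2) by (metis funpow_mult id_funpow mult.commute)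
    show "(\<sigma> ^^ k) x \<noteq> x" if "x \<in> K.relative.conjugates (j \<alpha>)" for x
      using neg that fixed_if_funpow_fixed[OF l k \<sigma>_mem(2), of x] by blast
  qed (use incongruent in blast)
  moreover have "split_gcd R F K below = split_gcd R F L below"
    using equivalent nz_prime_below K.unramified_below gL.unramified_below by (simp add: locally_gcd_equivalent_def)
  ultimately show False using l by simp
qed


section \<open>A common splitting field\<close>

lemma exists_rational_poly_vanishing:
  fixes Z :: "complex set"
  assumes "finite Z" "\<And>z. z \<in> Z \<Longrightarrow> algebraic z"
  shows "\<exists>f. f \<noteq> 0 \<and> (\<forall>i. coeff f i \<in> \<rat>) \<and> (\<forall>z\<in>Z. poly f z = 0)"
  using assms
proof (induction Z rule: finite_induct)
  case empty
  show ?case by (intro exI[of _ 1]) (auto simp: coeff_1)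
next
  case (insert z Z)
  then obtain f where f: "f \<noteq> 0" "\<And>i. coeff f i \<in> \<rat>" "\<forall>z\<in>Z. poly f z = 0" by auto
  obtain g where g: "g \<noteq> 0" "\<And>i. coeff g i \<in> \<rat>" "poly g z = 0" using insert.prems[of z] by (auto simp: algebraic_altdef)
  have "coeff (f * g) i \<in> \<rat>" for i unfolding coeff_mult by (intro Rats_sum Rats_mult f g)
  then show ?case using f g by (intro exI[of _ "f * g"]) auto
qed

lemma (in splitting_field) field_embedding_image_subset:
  assumes j: "field_embedding R M j" and generators: "rat_img R \<subseteq> M" "set us \<subseteq> M" "j ` set us \<subseteq> set roots"
    and M: "ring.finite_extension R (rat_img R) us = M"
  shows "j ` M \<subseteq> N"
proof -
  interpret j: field_embedding R M j by (rule j)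
  let ?T = "{x \<in> M. j x \<in> N}"
  have "j.finite_extension (rat_img R) us \<subseteq> ?T"
  proof (rule j.finite_extension_subring_incl)
    show "subring ?T R" by (rule j.subring_preimage[OF subfieldE(1)[OF subfield_N]])
    show "rat_img R \<subseteq> ?T" using generators(1) j.map_rat_img Rats_subset_N by blast
    show "set us \<subseteq> ?T" using generators(2,3) roots_subset_N by blast
  qed
  then show ?thesis using M by blast
qed

context Ring.field
begin

lemma exists_embedding_finite_ext:
  fixes \<iota> :: "'a \<Rightarrow> 'c::{alg_closed_field, field_char_0}"
  assumes \<iota>: "field_embedding R F \<iota>" and M: "finite_ext R F M"
  shows "\<exists>j. field_embedding R M j \<and> (\<forall>x\<in>F. j x = \<iota> x)"
proof -
  have "subfield F R" "subfield M R" "F \<subseteq> M" "finite_dimension F M"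
    using M by (auto simp: finite_ext_def intro: finite_dimensionI)
  then obtain us where us: "set us \<subseteq> M" "finite_extension F us = M" "\<And>x. x \<in> M \<Longrightarrow> (algebraic over F) x"
    using finite_dimension_as_finite_extension[of F M] by blast
  have "set us \<subseteq> carrier R" using us(1) subfieldE(3)[OF \<open>subfield M R\<close>] by blast
  then show ?thesis using exists_embedding_finite_extension[OF \<iota>, of us] us by blast
qed

lemma number_field_generators:
  assumes j: "field_embedding R M j" and M: "number_field R F" "finite_ext R F M"
  obtains us where "set us \<subseteq> M" "finite_extension (rat_img R) us = M" "\<And>u. u \<in> set us \<Longrightarrow> Polynomial.algebraic (j u)"
proof -
  have Q: "subfield (rat_img R) R" "rat_img R \<subseteq> M" "finite_dimension (rat_img R) M"
    using M telescopic_base_dim(1)[of "rat_img R" F M]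
    by (auto simp: number_field_def finite_ext_def intro: finite_dimensionI)
  obtain us where us: "set us \<subseteq> M" "finite_extension (rat_img R) us = M" "\<And>x. x \<in> M \<Longrightarrow> (algebraic over (rat_img R)) x"
    using finite_dimension_as_finite_extension[OF Q(1) field_embedding.subfield[OF j] Q(2,3)] by blast
  show ?thesis
    by (rule that[OF us(1,2)]) (use field_embedding.map_algebraic[OF j Q(1,2)] us(1,3) in blast)
qed

end

lemma exists_common_splitting_field:
  assumes char: "char_zero_field R" and F: "number_field R F" and K: "finite_ext R F K" and L: "finite_ext R F L"
  shows "\<exists>f \<iota> j i. F_extension f R F \<iota> K j \<and> F_extension f R F \<iota> L i"
proof -
  interpret Ring.field R using char by (simp add: char_zero_field_def)
  have subset: "rat_img R \<subseteq> F" "F \<subseteq> K" "F \<subseteq> L" using F K L by (auto simp: number_field_def finite_ext_def)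
  have "field_embedding R (rat_img R) (rat_embedding :: 'a \<Rightarrow> complex)"
    using F by (intro field_embedding_rat_embedding[OF char]) (simp add: number_field_def finite_ext_def)
  then obtain \<iota> :: "'a \<Rightarrow> complex" where \<iota>: "field_embedding R F \<iota>"
    using exists_embedding_finite_ext F unfolding number_field_def by blast
  obtain j where j: "field_embedding R K j" "\<And>x. x \<in> F \<Longrightarrow> j x = \<iota> x" using exists_embedding_finite_ext[OF \<iota> K] by blast
  obtain i where i: "field_embedding R L i" "\<And>x. x \<in> F \<Longrightarrow> i x = \<iota> x" using exists_embedding_finite_ext[OF \<iota> L] by blast
  obtain us where us: "set us \<subseteq> K" "finite_extension (rat_img R) us = K" "\<And>u. u \<in> set us \<Longrightarrow> Polynomial.algebraic (j u)"
    using number_field_generators[OF j(1) F K] by blast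
  obtain vs where vs: "set vs \<subseteq> L" "finite_extension (rat_img R) vs = L" "\<And>v. v \<in> set vs \<Longrightarrow> Polynomial.algebraic (i v)"
    using number_field_generators[OF i(1) F L] by blast
  have "Polynomial.algebraic z" if "z \<in> j ` set us \<union> i ` set vs" for z using that us(3) vs(3) by blast
  then obtain f where f: "f \<noteq> 0" "\<forall>i. Polynomial.coeff f i \<in> \<rat>" "\<forall>z\<in>j ` set us \<union> i ` set vs. poly f z = 0"
    using exists_rational_poly_vanishing[of "j ` set us \<union> i ` set vs"] by blast
  interpret splitting: splitting_field f using f(1,2) by unfold_locales auto
  have image_K: "j ` K \<subseteq> splitting.N"
  proof (rule splitting.field_embedding_image_subset[OF j(1) _ us(1) _ us(2)])
    show "j ` set us \<subseteq> set splitting.roots" using f(3) splitting.set_roots by blast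
  qed (use subset in blast)
  have image_L: "i ` L \<subseteq> splitting.N"
  proof (rule splitting.field_embedding_image_subset[OF i(1) _ vs(1) _ vs(2)])
    show "i ` set vs \<subseteq> set splitting.roots" using f(3) splitting.set_roots by blast
  qed (use subset in blast)
  have "base_embedding f R F \<iota>"
    using \<iota> splitting.splitting_field_axioms image_K j(2) subset(2)
    by (force simp: base_embedding_def base_embedding_axioms_def)
  then have "F_extension f R F \<iota> K j" "F_extension f R F \<iota> L i"
    using j i image_K image_L subset by (simp_all add: F_extension_def F_extension_axioms_def)
  then show ?thesis by blast
qed

lemma exists_conjugate_with_stabilizer:
  assumes K: "F_extension f R F \<iota> K j" "F_extension.primitive f F \<iota> K j \<alpha>" "finite_ext R F K" "ext_degree R F K \<le> 5"
    and L: "F_extension f R F \<iota> L i" "F_extension.primitive f F \<iota> L i \<beta>" "finite_ext R F L" "ext_degree R F L \<le> 5"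
    and equivalent: "locally_gcd_equivalent R F K L"
  shows "\<exists>g\<in>base_embedding.Gal_F f F \<iota>. \<forall>h\<in>base_embedding.Gal_F f F \<iota>.
    h (g (j \<alpha>)) = g (j \<alpha>) \<longleftrightarrow> h (i \<beta>) = i \<beta>"
proof -
  interpret K: F_extension f R F \<iota> K j by (rule K(1))
  interpret L: F_extension f R F \<iota> L i by (rule L(1))
  have equivalent': "locally_gcd_equivalent R F L K" using equivalent by (auto simp: locally_gcd_equivalent_def)
  have "\<exists>x\<in>K.relative.conjugates (j \<alpha>).
      stabilizer (perm_group K.Gal_F) (\<lambda>g. g) x = stabilizer (perm_group K.Gal_F) (\<lambda>g. g) (i \<beta>)"
  proof (rule K.relative.perm.exists_equal_stabilizers)
    show "card (K.relative.conjugates (j \<alpha>)) \<le> 5"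
      using K.card_conjugates_le_ext_degree[of _ \<alpha>] K(2-4) by (force simp: K.primitive_def finite_ext_def)
    show "card (K.relative.conjugates (i \<beta>)) \<le> 5"
      using L.card_conjugates_le_ext_degree[of _ \<beta>] L(2-4) by (force simp: L.primitive_def finite_ext_def)
    fix l \<sigma> assume l: "prime l" "\<sigma> \<in> prime_power_elements l (perm_group K.Gal_F)"
    show "(\<exists>z\<in>K.relative.conjugates (j \<alpha>). \<sigma> z = z) \<longleftrightarrow> (\<exists>z\<in>K.relative.conjugates (i \<beta>). \<sigma> z = z)"
      using fixed_point_transfer[OF K(1,2) L(1,2) equivalent l] fixed_point_transfer[OF L(1,2) K(1,2) equivalent' l]
      by blast
  qed simp_all
  then obtain g where g: "g \<in> K.Gal_F"
      "stabilizer (perm_group K.Gal_F) (\<lambda>g. g) (g (j \<alpha>)) = stabilizer (perm_group K.Gal_F) (\<lambda>g. g) (i \<beta>)"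
    by (auto simp: K.relative.conjugates_eq)
  then show ?thesis by (intro bexI[of _ g]) (auto simp: stabilizer_def)
qed

theorem theorem1:
  fixes R :: "('a, 'b) ring_scheme" and F K L :: "'a set"
  assumes "char_zero_field R"
    and "number_field R F"
    and "finite_ext R F K" and "finite_ext R F L"
    and "ext_degree R F K \<le> 5" and "ext_degree R F L \<le> 5"
    and "locally_gcd_equivalent R F K L"
  shows "F_isomorphic R F K L"
proof -
  obtain f \<iota> j i where K: "F_extension f R F \<iota> K j" and L: "F_extension f R F \<iota> L i"
    using exists_common_splitting_field[OF assms(1-4)] by blast
  interpret K: F_extension f R F \<iota> K j by (rule K)
  interpret L: F_extension f R F \<iota> L i by (rule L)
  obtain \<alpha> where \<alpha>: "K.primitive \<alpha>" using K.exists_primitive by blast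
  obtain \<beta> where \<beta>: "L.primitive \<beta>" using L.exists_primitive by blast
  obtain g where g: "g \<in> K.Gal_F" "\<And>h. h \<in> K.Gal_F \<Longrightarrow> h (g (j \<alpha>)) = g (j \<alpha>) \<longleftrightarrow> h (i \<beta>) = i \<beta>"
    using exists_conjugate_with_stabilizer[OF K \<alpha> assms(3,5) L \<beta> assms(4,6,7)] by blast
  have "F_extension f R F \<iota> K (g \<circ> j)" "F_extension.primitive f F \<iota> K (g \<circ> j) \<alpha>"
    using K.conjugate_extension[OF g(1)] K.primitive_conjugate[OF g(1) \<alpha>] .
  then show ?thesis by (rule F_isomorphic_if_equal_stabilizers[OF _ _ L \<beta>]) (simp add: g(2))
qed

end
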